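(* Assume (A1), (A2) and (A3) (stated in the context). For $\theta\in\Theta$ let $\ell(\theta)=\mathbb{E}[\ln \pi^\theta_Y(Y_{-\infty}^{0})]$. Then $\theta\mapsto \ell(\theta)$ is upper semi-continuous on $\Theta$ and, defining $\Theta^\star\subset\Theta$ by $\Theta^\star=\arg\max_{\theta\in\Theta}\ell(\theta)$, for every probability measure $\chi\in\mathcal{M}(\mathsf{D},r)$, $$\lim_{n\to\infty} d(\hat\theta_{\chi,n},\Theta^\star)=0,\qquad \mathbb{P}\text{-a.s.}$$
   Context: Setting. $\Theta$ is a compact metric space with metric $d$; $d(\theta,A)$ is the distance from a point to a set. $(\mathsf{X},\mathcal{X})$ is a measurable space and $(\mathsf{Y},\mathcal{Y})$ a standard Borel space. For each $\theta\in\Theta$, $Q^\theta$ is a Markov transition kernel on $(\mathsf{X},\mathcal{X})$ and $g^\theta:\mathsf{X}\times\mathsf{Y}\to[0,\infty)$ is measurable, $g^\theta(x,\cdot)$ being the conditional density (with respect to a fixed reference measure on $\mathsf{Y}$) of the observation given hidden state $x$. $(Y_k)_{k\in\mathbb{Z}}$ is a stationary ergodic process on $(\Omega,\mathcal{F},\mathbb{P})$ with values in $(\mathsf{Y},\mathcal{Y})$; its law need not belong to the parametric family. Write $a_m^n=(a_m,\dots,a_n)$. For a probability measure $\chi$ on $(\mathsf{X},\mathcal{X})$, $$p_\chi^\theta(y_m^n)=\int\cdots\int\chi(dx_m)g^\theta(x_m,y_m)\prod_{p=m+1}^n Q^\theta(x_{p-1},dx_p)g^\theta(x_p,y_p),$$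 $p_\chi^\theta(y_p^n|y_m^{p-1})=p_\chi^\theta(y_m^n)/p_\chi^\theta(y_m^{p-1})$, and $p_x^\theta=p_{\delta_x}^\theta$. The maximum likelihood estimator is $\hat\theta_{\chi,n}\in\arg\max_{\theta\in\Theta}\ln p_\chi^\theta(Y_0^{n-1})$ (a maximizer). For $t\ge1$ and $y_0^{t-1}\in\mathsf{Y}^t$, $\mathbf{L}^\theta\langle y_0^{t-1}\rangle$ is the unnormalized kernel $$\mathbf{L}^\theta\langle y_0^{t-1}\rangle(x_0,A)=\int\cdots\int\Big[\prod_{i=0}^{t-1}g^\theta(x_i,y_i)Q^\theta(x_i,dx_{i+1})\Big]\mathbb{1}_A(x_t).$$ Local Doeblin set. For an integer $r\ge 1$, $\mathsf{C}\in\mathcal{X}$ is an $r$-local Doeblin set if there exist positive functions $\epsilon_{\mathsf C}^-,\epsilon_{\mathsf C}^+:\mathsf{Y}^r\to\mathbb{R}^+$, probability measures $\lambda^\theta_{\mathsf C}\langle z\rangle$ and positive functions $\varphi^\theta_{\mathsf C}\langle z\rangle$ on $\mathsf{X}$ ($\theta\in\Theta,z\in\mathsf{Y}^r$) such that $\lambda^\theta_{\mathsf C}\langle z\rangle(\mathsf{C})=1$ and, for all $\theta\in\Theta$, $z\in\mathsf{Y}^r$, $A\in\mathcal{X}$, $x\in\mathsf{C}$, $$\epsilon^-_{\mathsf C}(z)\varphi^\theta_{\mathsf C}\langle z\rangle(x)\lambda^\theta_{\mathsf C}\langle z\rangle(A)\le\mathbf{L}^\theta\langle z\rangle(x,A\cap\mathsf{C})\le\epsilon^+_{\mathsf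 C}(z)\varphi^\theta_{\mathsf C}\langle z\rangle(x)\lambda^\theta_{\mathsf C}\langle z\rangle(A).$$ (A1) There exist an integer $r\ge1$ and a set $\mathsf{K}\in\mathcal{Y}^{\otimes r}$ such that: (i) $\mathbb{P}[Y_0^{r-1}\in\mathsf{K}]>2/3$; (ii) for all $\eta>0$ there is an $r$-local Doeblin set $\mathsf{C}\in\mathcal{X}$ such that for all $\theta\in\Theta$ and $y_0^{r-1}\in\mathsf{K}$, $\sup_{x_0\in\mathsf{C}^c}p_{x_0}^\theta(y_0^{r-1})\le\eta\sup_{x_0\in\mathsf{X}}p_{x_0}^\theta(y_0^{r-1})<\infty$, and $\inf_{y_0^{r-1}\in\mathsf{K}}\epsilon^-_{\mathsf C}(y_0^{r-1})/\epsilon^+_{\mathsf C}(y_0^{r-1})>0$; (iii) there is a set $\mathsf{D}\in\mathcal{X}$ with $\mathbb{E}[\ln^-\inf_{\theta\in\Theta}\inf_{x\in\mathsf{D}}\mathbf{L}^\theta\langle Y_0^{r-1}\rangle(x,\mathsf{D})]<\infty$. (A2) (i) For any $\theta\in\Theta$, $g^\theta$ is positive on $\mathsf{X}\times\mathsf{Y}$; (ii) $\mathbb{E}[\ln^+\sup_{\theta\in\Theta}\sup_{x\in\mathsf{X}}g^\theta(x,Y_0)]<\infty$. (A3) There exists $p\in\mathbb{N}$ such that for any $x\in\mathsf{X}$ and $n\ge p$, $\mathbb{P}$-a.s. the function $\theta\mapsto p_x^\theta(Y_0^n)$ is continuous on $\Theta$. With $r,\mathsf{D}$ from (A1), $\mathcal{M}(\mathsf{D},r)$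 is the set of probability measures $\chi$ on $(\mathsf{X},\mathcal{X})$ with $\mathbb{E}[\ln^-\inf_{\theta\in\Theta}\chi\mathbf{L}^\theta\langle Y_0^{u-1}\rangle\mathbb{1}_{\mathsf D}]<\infty$ for all $u\in\{1,\dots,r\}$, where $\chi\mathbf{L}\mathbb{1}_{\mathsf D}=\int\chi(dx)\mathbf{L}(x,\mathsf{D})$. The function $\pi_Y^\theta$: under (A1)–(A2), for each $\theta$ there is a measurable function $\pi_Y^\theta$ on $\mathsf{Y}^{\mathbb{Z}^-}$ ($\mathbb{Z}^-=\{\dots,-1,0\}$) such that for every $\chi\in\mathcal{M}(\mathsf{D},r)$, $\lim_{m\to\infty}p_\chi^\theta(Y_0|Y_{-m}^{-1})=\pi_Y^\theta(Y_{-\infty}^0)$ $\mathbb{P}$-a.s., and $\ln\pi_Y^\theta(Y_{-\infty}^0)$ is $\mathbb{P}$-integrable. *)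

theory Defs
  imports "HOL-Probability.Probability"
begin

definition standard_borel :: "'a measure \<Rightarrow> bool" where
  "standard_borel M \<longleftrightarrow>
     (\<exists>T. topspace T = space M \<and> completely_metrizable_space T \<and> second_countable T \<and>
          sets M = sigma_sets (space M) {U. openin T U})"

definition upper_semicontinuous_on :: "'a::topological_space set \<Rightarrow> ('a \<Rightarrow> real) \<Rightarrow> bool" where
  "upper_semicontinuous_on S f \<longleftrightarrow>
     (\<forall>x\<in>S. \<forall>a. f x < a \<longrightarrow> (\<forall>\<^sub>F y in at x within S. f y < a))"

text \<open>The logarithm on \<open>[0, \<infinity>]\<close> with \<open>ln 0 = -\<infinity>\<close>; the library's real \<open>ln\<close> has \<open>ln 0 = 0\<close>.\<close>

definition eln :: "ennreal \<Rightarrow> ereal" where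
  "eln x = (if x = 0 then -\<infinity> else if x = \<infinity> then \<infinity> else ereal (ln (enn2real x)))"

definition ln_pos :: "ennreal \<Rightarrow> ennreal" where
  "ln_pos x = e2ennreal (max 0 (eln x))"

definition ln_neg :: "ennreal \<Rightarrow> ennreal" where
  "ln_neg x = e2ennreal (max 0 (- eln x))"

text \<open>Finiteness of the expectation of a nonnegative function. It is applied to uncountable
  suprema and infima, which need not be measurable, and \<open>nn_integral\<close> is only a lower integral for
  such functions; hence an integrable measurable majorant is required (finite outer expectation).
  For measurable \<open>f\<close> this is \<open>(\<integral>\<^sup>+ z. f z \<partial>N) < \<infinity>\<close>.\<close>

definition finite_expectation :: "'a measure \<Rightarrow> ('a \<Rightarrow> ennreal) \<Rightarrow> bool" where
  "finite_expectation N f \<longleftrightarrow>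
     (\<exists>h\<in>borel_measurable N. (\<forall>z\<in>space N. f z \<le> h z) \<and> (\<integral>\<^sup>+ z. h z \<partial>N) < \<infinity>)"

section \<open>The observation process\<close>

text \<open>Finite blocks of observations are functions on \<open>{..<n}\<close>, elements of
  \<open>\<Pi>\<^sub>M i\<in>{..<n}. Y\<close>.\<close>

definition block :: "(int \<Rightarrow> 'w \<Rightarrow> 'y) \<Rightarrow> nat \<Rightarrow> 'w \<Rightarrow> nat \<Rightarrow> 'y" where
  "block Yp n \<omega> = (\<lambda>i\<in>{..<n}. Yp (int i) \<omega>)"

definition block_law :: "'w measure \<Rightarrow> 'y measure \<Rightarrow> (int \<Rightarrow> 'w \<Rightarrow> 'y) \<Rightarrow> nat \<Rightarrow> (nat \<Rightarrow> 'y) measure" where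
  "block_law P Y Yp n = distr P (\<Pi>\<^sub>M i\<in>{..<n}. Y) (block Yp n)"

definition process_law :: "'w measure \<Rightarrow> 'y measure \<Rightarrow> (int \<Rightarrow> 'w \<Rightarrow> 'y) \<Rightarrow> (int \<Rightarrow> 'y) measure" where
  "process_law P Y Yp = distr P (\<Pi>\<^sub>M k\<in>UNIV. Y) (\<lambda>\<omega> k. Yp k \<omega>)"

definition shift :: "(int \<Rightarrow> 'y) \<Rightarrow> int \<Rightarrow> 'y" where
  "shift y = (\<lambda>k. y (k + 1))"

definition stationary_ergodic :: "'w measure \<Rightarrow> 'y measure \<Rightarrow> (int \<Rightarrow> 'w \<Rightarrow> 'y) \<Rightarrow> bool" where
  "stationary_ergodic P Y Yp \<longleftrightarrow>
     prob_space P \<and> (\<forall>k. Yp k \<in> P \<rightarrow>\<^sub>M Y) \<and>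
     process_law P Y (\<lambda>k. Yp (k + 1)) = process_law P Y Yp \<and>
     (\<forall>A\<in>sets (\<Pi>\<^sub>M k\<in>UNIV. Y).
        shift -` A \<inter> space (\<Pi>\<^sub>M k\<in>UNIV. Y) = A \<longrightarrow>
        measure (process_law P Y Yp) A \<in> {0, 1})"

section \<open>Likelihoods and unnormalized kernels\<close>

text \<open>With \<open>z = y_m, y_{m+1}, \<dots>\<close>, the value \<open>lik_from Q g \<theta> n z x\<close> is the likelihood
  of the \<open>n + 1\<close> observations \<open>z 0, \<dots>, z n\<close> given that the hidden chain starts in \<open>x\<close>.\<close>

primrec lik_from ::
  "('t \<Rightarrow> 'x \<Rightarrow> 'x measure) \<Rightarrow> ('t \<Rightarrow> 'x \<Rightarrow> 'y \<Rightarrow> real) \<Rightarrow> 't \<Rightarrow> nat \<Rightarrow> (nat \<Rightarrow> 'y) \<Rightarrow> 'x \<Rightarrow> ennreal" where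
  "lik_from Q g \<theta> 0 z x = ennreal (g \<theta> x (z 0))"
| "lik_from Q g \<theta> (Suc n) z x =
     ennreal (g \<theta> x (z 0)) * (\<integral>\<^sup>+ x'. lik_from Q g \<theta> n (\<lambda>i. z (Suc i)) x' \<partial>Q \<theta> x)"

text \<open>\<open>lik Q g chi \<theta> n z\<close> is \<open>p_chi^\<theta>(z_0, \<dots>, z_n)\<close>: the argument \<open>n\<close> is the last index,
  not the number of observations.\<close>

definition lik ::
  "('t \<Rightarrow> 'x \<Rightarrow> 'x measure) \<Rightarrow> ('t \<Rightarrow> 'x \<Rightarrow> 'y \<Rightarrow> real) \<Rightarrow> 'x measure \<Rightarrow> 't \<Rightarrow> nat \<Rightarrow> (nat \<Rightarrow> 'y) \<Rightarrow> ennreal" where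
  "lik Q g chi \<theta> n z = (\<integral>\<^sup>+ x. lik_from Q g \<theta> n z x \<partial>chi)"

text \<open>\<open>p_chi^\<theta>(y_0 | y_{-m}, \<dots>, y_{-1})\<close> for a two-sided sequence and \<open>m \<ge> 1\<close>.\<close>

definition cond_lik ::
  "('t \<Rightarrow> 'x \<Rightarrow> 'x measure) \<Rightarrow> ('t \<Rightarrow> 'x \<Rightarrow> 'y \<Rightarrow> real) \<Rightarrow> 'x measure \<Rightarrow> 't \<Rightarrow> nat \<Rightarrow> (int \<Rightarrow> 'y) \<Rightarrow> ennreal" where
  "cond_lik Q g chi \<theta> m y =
     lik Q g chi \<theta> m (\<lambda>i. y (int i - int m)) / lik Q g chi \<theta> (m - 1) (\<lambda>i. y (int i - int m))"

text \<open>\<open>Lker Q g \<theta> t z x A\<close> is \<open>L^\<theta>\<langle>z_0, \<dots>, z_{t-1}\<rangle>(x, A)\<close>; here \<open>t\<close> is the number of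
  observations, and \<open>t = 0\<close> gives the identity kernel.\<close>

primrec Lker ::
  "('t \<Rightarrow> 'x \<Rightarrow> 'x measure) \<Rightarrow> ('t \<Rightarrow> 'x \<Rightarrow> 'y \<Rightarrow> real) \<Rightarrow> 't \<Rightarrow> nat \<Rightarrow> (nat \<Rightarrow> 'y) \<Rightarrow> 'x \<Rightarrow> 'x set \<Rightarrow> ennreal" where
  "Lker Q g \<theta> 0 z x A = indicator A x"
| "Lker Q g \<theta> (Suc t) z x A =
     ennreal (g \<theta> x (z 0)) * (\<integral>\<^sup>+ x'. Lker Q g \<theta> t (\<lambda>i. z (Suc i)) x' A \<partial>Q \<theta> x)"

section \<open>Local Doeblin sets and the assumptions\<close>

definition local_doeblin_with ::
  "'t set \<Rightarrow> 'x measure \<Rightarrow> 'y measure \<Rightarrow> ('t \<Rightarrow> 'x \<Rightarrow> 'x measure) \<Rightarrow> ('t \<Rightarrow> 'x \<Rightarrow> 'y \<Rightarrow> real) \<Rightarrow> nat \<Rightarrow>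
   'x set \<Rightarrow> ((nat \<Rightarrow> 'y) \<Rightarrow> real) \<Rightarrow> ((nat \<Rightarrow> 'y) \<Rightarrow> real) \<Rightarrow> bool" where
  "local_doeblin_with \<Theta> X Y Q g r C em ep \<longleftrightarrow>
     C \<in> sets X \<and>
     (\<forall>z\<in>space (\<Pi>\<^sub>M i\<in>{..<r}. Y). 0 < em z \<and> 0 < ep z) \<and>
     (\<exists>(lam :: 't \<Rightarrow> (nat \<Rightarrow> 'y) \<Rightarrow> 'x measure) (phi :: 't \<Rightarrow> (nat \<Rightarrow> 'y) \<Rightarrow> 'x \<Rightarrow> real).
        \<forall>\<theta>\<in>\<Theta>. \<forall>z\<in>space (\<Pi>\<^sub>M i\<in>{..<r}. Y).
          lam \<theta> z \<in> space (prob_algebra X) \<and>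
          emeasure (lam \<theta> z) C = 1 \<and>
          (\<forall>x\<in>space X. 0 < phi \<theta> z x) \<and>
          (\<forall>A\<in>sets X. \<forall>x\<in>C.
             ennreal (em z * phi \<theta> z x) * emeasure (lam \<theta> z) A \<le> Lker Q g \<theta> r z x (A \<inter> C) \<and>
             Lker Q g \<theta> r z x (A \<inter> C) \<le> ennreal (ep z * phi \<theta> z x) * emeasure (lam \<theta> z) A))"

text \<open>\<open>r\<close> and \<open>D\<close> are arguments because \<open>\<M>(D, r)\<close> refers to them.\<close>

definition A1 ::
  "'t set \<Rightarrow> 'x measure \<Rightarrow> 'y measure \<Rightarrow> ('t \<Rightarrow> 'x \<Rightarrow> 'x measure) \<Rightarrow> ('t \<Rightarrow> 'x \<Rightarrow> 'y \<Rightarrow> real) \<Rightarrow>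
   'w measure \<Rightarrow> (int \<Rightarrow> 'w \<Rightarrow> 'y) \<Rightarrow> nat \<Rightarrow> 'x set \<Rightarrow> bool" where
  "A1 \<Theta> X Y Q g P Yp r D \<longleftrightarrow>
     1 \<le> r \<and>
     (\<exists>K\<in>sets (\<Pi>\<^sub>M i\<in>{..<r}. Y).
        2 / 3 < measure (block_law P Y Yp r) K \<and>
        (\<forall>\<eta>>0. \<exists>C em ep.
           local_doeblin_with \<Theta> X Y Q g r C em ep \<and>
           (\<forall>\<theta>\<in>\<Theta>. \<forall>z\<in>K.
              (SUP x\<in>space X - C. lik Q g (return X x) \<theta> (r - 1) z)
                \<le> ennreal \<eta> * (SUP x\<in>space X. lik Q g (return X x) \<theta> (r - 1) z) \<and>
              (SUP x\<in>space X. lik Q g (return X x) \<theta> (r - 1) z) < \<infinity>) \<and>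
           0 < (INF z\<in>K. ennreal (em z / ep z)))) \<and>
     D \<in> sets X \<and>
     finite_expectation (block_law P Y Yp r)
       (\<lambda>z. ln_neg (INF \<theta>\<in>\<Theta>. INF x\<in>D. Lker Q g \<theta> r z x D))"

definition A2 ::
  "'t set \<Rightarrow> 'x measure \<Rightarrow> 'y measure \<Rightarrow> ('t \<Rightarrow> 'x \<Rightarrow> 'y \<Rightarrow> real) \<Rightarrow>
   'w measure \<Rightarrow> (int \<Rightarrow> 'w \<Rightarrow> 'y) \<Rightarrow> bool" where
  "A2 \<Theta> X Y g P Yp \<longleftrightarrow>
     (\<forall>\<theta>\<in>\<Theta>. \<forall>x\<in>space X. \<forall>y\<in>space Y. 0 < g \<theta> x y) \<and>
     finite_expectation (distr P Y (Yp 0)) (\<lambda>y. ln_pos (SUP \<theta>\<in>\<Theta>. SUP x\<in>space X. ennreal (g \<theta> x y)))"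

definition A3 ::
  "'t::metric_space set \<Rightarrow> 'x measure \<Rightarrow> ('t \<Rightarrow> 'x \<Rightarrow> 'x measure) \<Rightarrow> ('t \<Rightarrow> 'x \<Rightarrow> 'y \<Rightarrow> real) \<Rightarrow>
   'w measure \<Rightarrow> (int \<Rightarrow> 'w \<Rightarrow> 'y) \<Rightarrow> bool" where
  "A3 \<Theta> X Q g P Yp \<longleftrightarrow>
     (\<exists>p. \<forall>x\<in>space X. \<forall>n\<ge>p. AE \<omega> in P.
        continuous_on \<Theta> (\<lambda>\<theta>. lik Q g (return X x) \<theta> n (\<lambda>i. Yp (int i) \<omega>)))"

definition init_measures ::
  "'t set \<Rightarrow> 'x measure \<Rightarrow> 'y measure \<Rightarrow> ('t \<Rightarrow> 'x \<Rightarrow> 'x measure) \<Rightarrow> ('t \<Rightarrow> 'x \<Rightarrow> 'y \<Rightarrow> real) \<Rightarrow>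
   'w measure \<Rightarrow> (int \<Rightarrow> 'w \<Rightarrow> 'y) \<Rightarrow> 'x set \<Rightarrow> nat \<Rightarrow> 'x measure set" where
  "init_measures \<Theta> X Y Q g P Yp D r =
     {chi\<in>space (prob_algebra X). \<forall>u\<in>{1..r}.
        finite_expectation (block_law P Y Yp u)
          (\<lambda>z. ln_neg (INF \<theta>\<in>\<Theta>. \<integral>\<^sup>+ x. Lker Q g \<theta> u z x D \<partial>chi))}"

section \<open>The limiting conditional density and the contrast\<close>

definition past :: "(int \<Rightarrow> 'w \<Rightarrow> 'y) \<Rightarrow> 'w \<Rightarrow> int \<Rightarrow> 'y" where
  "past Yp \<omega> = (\<lambda>k\<in>{..0}. Yp k \<omega>)"

text \<open>The defining properties of \<open>\<pi>_Y\<close>. Integrability of \<open>ln \<pi>_Y\<close> in the sense of \<open>ln 0 = -\<infinity>\<close>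
  includes almost sure positivity, which is stated separately since \<open>ln 0 = 0\<close> here.\<close>

definition limit_density ::
  "'t set \<Rightarrow> 'x measure \<Rightarrow> 'y measure \<Rightarrow> ('t \<Rightarrow> 'x \<Rightarrow> 'x measure) \<Rightarrow> ('t \<Rightarrow> 'x \<Rightarrow> 'y \<Rightarrow> real) \<Rightarrow>
   'w measure \<Rightarrow> (int \<Rightarrow> 'w \<Rightarrow> 'y) \<Rightarrow> 'x set \<Rightarrow> nat \<Rightarrow> ('t \<Rightarrow> (int \<Rightarrow> 'y) \<Rightarrow> real) \<Rightarrow> bool" where
  "limit_density \<Theta> X Y Q g P Yp D r piY \<longleftrightarrow>
     (\<forall>\<theta>\<in>\<Theta>.
        piY \<theta> \<in> borel_measurable (\<Pi>\<^sub>M k\<in>{..0}. Y) \<and>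
        (\<forall>chi\<in>init_measures \<Theta> X Y Q g P Yp D r. AE \<omega> in P.
           (\<lambda>m. cond_lik Q g chi \<theta> m (\<lambda>k. Yp k \<omega>)) \<longlonglongrightarrow> ennreal (piY \<theta> (past Yp \<omega>))) \<and>
        (AE \<omega> in P. 0 < piY \<theta> (past Yp \<omega>)) \<and>
        integrable P (\<lambda>\<omega>. ln (piY \<theta> (past Yp \<omega>))))"

definition contrast ::
  "'w measure \<Rightarrow> (int \<Rightarrow> 'w \<Rightarrow> 'y) \<Rightarrow> ('t \<Rightarrow> (int \<Rightarrow> 'y) \<Rightarrow> real) \<Rightarrow> 't \<Rightarrow> real" where
  "contrast P Yp piY \<theta> = (\<integral>\<omega>. ln (piY \<theta> (past Yp \<omega>)) \<partial>P)"

definition Theta_star ::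
  "'t set \<Rightarrow> 'w measure \<Rightarrow> (int \<Rightarrow> 'w \<Rightarrow> 'y) \<Rightarrow> ('t \<Rightarrow> (int \<Rightarrow> 'y) \<Rightarrow> real) \<Rightarrow> 't set" where
  "Theta_star \<Theta> P Yp piY = {\<theta>. is_arg_max (contrast P Yp piY) (\<lambda>\<theta>. \<theta> \<in> \<Theta>) \<theta>}"

text \<open>Almost surely, \<open>\<theta>hat n\<close> maximizes \<open>\<theta> \<mapsto> ln p_chi^\<theta>(Y_0, \<dots>, Y_{n-1})\<close> over \<open>\<Theta>\<close> for all large
  \<open>n\<close>; for small \<open>n\<close> a maximizer need not exist. No measurability of \<open>\<theta>hat n\<close> is required.\<close>

definition is_mle ::
  "'t set \<Rightarrow> ('t \<Rightarrow> 'x \<Rightarrow> 'x measure) \<Rightarrow> ('t \<Rightarrow> 'x \<Rightarrow> 'y \<Rightarrow> real) \<Rightarrow>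
   'w measure \<Rightarrow> (int \<Rightarrow> 'w \<Rightarrow> 'y) \<Rightarrow> 'x measure \<Rightarrow> (nat \<Rightarrow> 'w \<Rightarrow> 't) \<Rightarrow> bool" where
  "is_mle \<Theta> Q g P Yp chi \<theta>hat \<longleftrightarrow>
     (AE \<omega> in P. \<forall>\<^sub>F n in sequentially.
        is_arg_max (\<lambda>\<theta>. eln (lik Q g chi \<theta> (n - 1) (\<lambda>i. Yp (int i) \<omega>))) (\<lambda>\<theta>. \<theta> \<in> \<Theta>) (\<theta>hat n \<omega>))"

end

theory Submission
  imports Defs
begin

text \<open>
  A multiplicative comparison replaces the usual geometric forgetting of the initial distribution.
  Fix a parameter and call an observation time good for an initial law if, given the observations,
  the hidden path is in the Doeblin set \<open>C\<close> at that time and one block later with posterior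
  probability at least 1/2. In an initial window of length proportional to \<open>n\<close>, most times at which
  the observed block and the next one lie in \<open>K\<close> are good, for any initial law whose likelihood is not
  exponentially small relative to the upper bounds: leaving \<open>C\<close> costs a factor \<open>\<eta>\<close>. Two initial laws
  therefore share a good time \<open>t\<close>. At \<open>t\<close> the Doeblin condition forgets the past, so the two
  likelihoods differ by at most the contribution of the window, that is by \<open>exp (\<delta> n)\<close>, uniformly
  in the parameter and in the initial law of the larger one.

  The lower bound for the log-likelihood follows from Birkhoff's theorem for \<open>ln \<pi>\<^sub>Y\<close>, since products of
  one-step conditional densities are at most the supremum of the likelihood over the starting point.
  For the upper bound, that supremum is submultiplicative in the observations, and by comparison it
  can be replaced by the likelihood started from a fixed point, which is continuous in the parameter,
  so that the parameter neighbourhood can be shrunk for a fixed block length. Fatou's lemma, applied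
  to the logarithms of the one-step conditional densities, bounds the resulting rate by the mean of
  \<open>ln \<pi>\<^sub>Y\<close>. Compactness and the two bounds give consistency.
\<close>

section \<open>Birkhoff's ergodic theorem\<close>

text \<open>The Doeblin constants may deteriorate as \<eta> decreases, which rules out a rate of
  forgetting fixed in advance. It does no harm here: they enter a comparison once, through the
  constant \<open>rho ^ 3\<close>, while the comparison may lose \<open>exp (\<delta> n)\<close>.
  The order of choices is therefore: given \<delta>, a window of length about
  \<open>r \<kappa> n\<close> with \<kappa> so small that its own contribution stays below
  \<open>exp (\<delta> n)\<close>; then \<eta> = \<open>1 / q\<close> so small that a law whose
  likelihood is at least \<open>exp (- c0 n)\<close> times the crude bound makes on average at most
  about \<open>\<kappa> n / 128\<close> excursions from \<open>C\<close>, counted over disjoint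
  blocks; only then \<open>C\<close> and \<open>rho\<close>. The second obstacle is measurability.
  Suprema over parameters and starting points are uncountable, so bounds are stated pointwise for
  almost every sequence, and whatever is integrated is built from measurable data: the majorants
  \<open>u\<close>, \<open>v\<close>, \<open>c\<close>, the events \<open>G n\<close>, and suprema
  over countable sets of parameters. On exceptional events only crude bounds remain, and uniform
  integrability makes their means negligible.\<close>

lemma lim_const_over_n: "(\<lambda>n. c / real n) \<longlonglongrightarrow> 0" for c :: real
  using tendsto_mult_left[OF lim_inverse_n, of c] by (simp add: divide_inverse)

locale ergodic_system = prob_space M for M :: "'a measure" +
  fixes T :: "'a \<Rightarrow> 'a"
  assumes T_measurable: "T \<in> M \<rightarrow>\<^sub>M M"
    and T_preserving: "distr M M T = M"
    and T_ergodic: "\<And>A. A \<in> sets M \<Longrightarrow> T -` A \<inter> space M = A \<Longrightarrow> prob A \<in> {0, 1}"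
begin

lemma T_pow_measurable [measurable]: "(T ^^ n) \<in> M \<rightarrow>\<^sub>M M"
proof (induction n)
  case (Suc n)
  then show ?case using measurable_comp[OF Suc T_measurable] by (simp add: comp_def)
qed (simp add: id_def)

lemma T_pow_space: "x \<in> space M \<Longrightarrow> (T ^^ n) x \<in> space M"
  using measurable_space[OF T_pow_measurable] by blast

lemma T_pow_preserving: "distr M M (T ^^ n) = M"
proof (induction n)
  case 0
  then show ?case by (simp add: id_def distr_id)
next
  case (Suc n)
  have "distr M M (T ^^ Suc n) = distr (distr M M (T ^^ n)) M T"
    using T_measurable T_pow_measurable by (subst distr_distr) auto
  then show ?case using Suc T_preserving by (simp add: comp_def)
qed

lemma AE_T_pow:
  assumes "AE x in M. R x"
  shows "AE x in M. R ((T ^^ n) x)"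
  by (rule AE_distrD[OF T_pow_measurable[of n]]) (subst T_pow_preserving, rule assms)

lemma integrable_T_pow:
  fixes f :: "'a \<Rightarrow> real"
  assumes "integrable M f"
  shows "integrable M (\<lambda>x. f ((T ^^ n) x))"
  using assms integrable_distr[OF T_pow_measurable[of n], of f] by (simp add: T_pow_preserving)

lemma integral_T_pow:
  fixes f :: "'a \<Rightarrow> real"
  assumes "f \<in> borel_measurable M"
  shows "(\<integral>x. f ((T ^^ n) x) \<partial>M) = (\<integral>x. f x \<partial>M)"
  using integral_distr[OF T_pow_measurable[of n], of f] assms by (simp add: T_pow_preserving)

definition orbit_sum :: "('a \<Rightarrow> real) \<Rightarrow> nat \<Rightarrow> 'a \<Rightarrow> real" where
  "orbit_sum f n x = (\<Sum>k<n. f ((T ^^ k) x))"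

lemma orbit_sum_measurable [measurable]:
  "f \<in> borel_measurable M \<Longrightarrow> orbit_sum f n \<in> borel_measurable M"
  unfolding orbit_sum_def[abs_def]
  by (intro borel_measurable_sum measurable_compose[OF T_pow_measurable])

lemma orbit_sum_Suc: "orbit_sum f (Suc n) x = f x + orbit_sum f n (T x)"
  unfolding orbit_sum_def
  by (subst sum.lessThan_Suc_shift) (simp add: funpow_swap1)

lemma orbit_sum_add: "orbit_sum f (m + n) x = orbit_sum f m x + orbit_sum f n ((T ^^ m) x)"
  unfolding orbit_sum_def
proof (induction n)
  case (Suc n)
  then show ?case by (simp add: funpow_add[symmetric, THEN fun_cong, simplified] add.commute)
qed simp

lemma orbit_sum_integrable:
  "integrable M f \<Longrightarrow> integrable M (orbit_sum f n)"
  unfolding orbit_sum_def[abs_def] by (intro Bochner_Integration.integrable_sum integrable_T_pow)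

lemma integral_orbit_sum:
  assumes "integrable M f"
  shows "(\<integral>x. orbit_sum f n x \<partial>M) = n * (\<integral>x. f x \<partial>M)"
  unfolding orbit_sum_def using assms
  by (subst Bochner_Integration.integral_sum) (auto intro: integrable_T_pow simp: integral_T_pow)

text \<open>Garsia's argument: \<open>f \<ge> F n - F n \<circ> T\<close> where the running maximum \<open>F n\<close> is positive.\<close>

lemma maximal_ergodic:
  assumes f: "integrable M f" and pos: "\<And>x. x \<in> space M \<Longrightarrow> \<exists>n. 0 < orbit_sum f n x"
  shows "0 \<le> (\<integral>x. f x \<partial>M)"
proof -
  define F where "F n x = Max ((\<lambda>k. orbit_sum f k x) ` {..n})" for n x
  have F_ge: "orbit_sum f k x \<le> F n x" if "k \<le> n" for k n x
    unfolding F_def using that by (intro Max_ge) auto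
  have F0: "0 \<le> F n x" for n x
    using F_ge[of 0 n x] by (simp add: orbit_sum_def)
  have Fint: "integrable M (F n)" for n
  proof (induction n)
    case 0
    then show ?case by (simp add: F_def[abs_def] orbit_sum_def)
  next
    case (Suc n)
    have "F (Suc n) x = max (orbit_sum f (Suc n) x) (F n x)" for x
      unfolding F_def by (simp add: atMost_Suc)
    then have "F (Suc n) = (\<lambda>x. max (orbit_sum f (Suc n) x) (F n x))" by auto
    then show ?case using Suc orbit_sum_integrable[OF f] by auto
  qed
  have Tint: "integrable M (\<lambda>x. F n (T x))" for n
    using integrable_T_pow[OF Fint, of n 1] by simp
  have main: "F n x - F n (T x) \<le> (if 0 < F n x then f x else 0)" for n x
  proof (cases "0 < F n x")
    case True
    have "F n x \<in> (\<lambda>k. orbit_sum f k x) ` {..n}"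
      unfolding F_def by (intro Max_in) auto
    then obtain k where k: "k \<le> n" "F n x = orbit_sum f k x" by auto
    with True have "k \<noteq> 0" by (intro notI) (simp add: orbit_sum_def)
    then obtain j where j: "k = Suc j" by (cases k) auto
    have "orbit_sum f j (T x) \<le> F n (T x)" using k j by (intro F_ge) auto
    then show ?thesis using True k j by (simp add: orbit_sum_Suc)
  next
    case False
    then show ?thesis using F0[of n x] F0[of n "T x"] by simp
  qed
  have [measurable]: "f \<in> borel_measurable M" using f by auto
  have [measurable]: "F n \<in> borel_measurable M" for n using Fint by auto
  have int_if: "integrable M (\<lambda>x. if 0 < F n x then f x else 0)" for n
    by (rule Bochner_Integration.integrable_bound[OF f]) auto
  have "0 \<le> (\<integral>x. (if 0 < F n x then f x else 0) \<partial>M)" for n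
  proof -
    have "(\<integral>x. F n (T x) \<partial>M) = (\<integral>x. F n x \<partial>M)"
      using integral_T_pow[of "F n" 1] by simp
    then have "0 = (\<integral>x. F n x - F n (T x) \<partial>M)"
      using Fint Tint by simp
    also have "\<dots> \<le> (\<integral>x. (if 0 < F n x then f x else 0) \<partial>M)"
      using Fint Tint int_if main by (intro integral_mono) auto
    finally show ?thesis .
  qed
  \<comment> \<open>By \<open>pos\<close> the events \<open>0 < F n\<close> exhaust the space, so
    the restriction disappears in the limit.\<close>
  moreover have "(\<lambda>n. \<integral>x. (if 0 < F n x then f x else 0) \<partial>M) \<longlonglongrightarrow> (\<integral>x. f x \<partial>M)"
  proof (rule integral_dominated_convergence[where w = "\<lambda>x. \<bar>f x\<bar>"])
    show "AE x in M. (\<lambda>n. if 0 < F n x then f x else 0) \<longlonglongrightarrow> f x"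
    proof (rule AE_I2)
      fix x assume "x \<in> space M"
      then obtain k where "0 < orbit_sum f k x" using pos by blast
      then have "0 < F n x" if "k \<le> n" for n using F_ge[OF that, of x] by simp
      then show "(\<lambda>n. if 0 < F n x then f x else 0) \<longlonglongrightarrow> f x"
        by (intro tendsto_eventually eventually_sequentiallyI[of k]) auto
    qed
  qed (use f in auto)
  ultimately show ?thesis by (intro LIMSEQ_le_const) auto
qed

text \<open>The points with unbounded orbit sums form an invariant event, which has probability 0 or
  1. Probability 1 would force a nonnegative mean by \<open>maximal_ergodic\<close>.\<close>

lemma orbit_sum_bounded_above:
  assumes f: "integrable M f" and neg: "(\<integral>x. f x \<partial>M) < 0"
  shows "AE x in M. \<exists>c. \<forall>n. orbit_sum f n x \<le> c"
proof -
  define B where "B = {x \<in> space M. \<forall>c::nat. \<exists>n. real c < orbit_sum f n x}"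
  have [measurable]: "f \<in> borel_measurable M" using f by auto
  have [measurable]: "B \<in> sets M" unfolding B_def by measurable
  have B_iff: "x \<in> B \<longleftrightarrow> (\<forall>c. \<exists>n. c < orbit_sum f n x)" if "x \<in> space M" for x
    using that unfolding B_def
    by simp (metis less_le_trans linorder_not_le order.strict_trans reals_Archimedean2)
  have inv: "x \<in> B \<longleftrightarrow> T x \<in> B" if x: "x \<in> space M" for x
  proof -
    have Tx: "T x \<in> space M" using T_pow_space[OF x, of 1] by simp
    show ?thesis unfolding B_iff[OF x] B_iff[OF Tx]
    proof safe
      fix c assume *: "\<forall>c. \<exists>n. c < orbit_sum f n x"
      obtain n where n: "max 0 (c + f x) < orbit_sum f n x" using * by blast
      then have "n \<noteq> 0" by (intro notI) (simp add: orbit_sum_def)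
      then obtain k where "n = Suc k" by (cases n) auto
      with n show "\<exists>n. c < orbit_sum f n (T x)"
        by (intro exI[of _ k]) (simp add: orbit_sum_Suc)
    next
      fix c assume *: "\<forall>c. \<exists>n. c < orbit_sum f n (T x)"
      obtain n where "c - f x < orbit_sum f n (T x)" using * by blast
      then show "\<exists>n. c < orbit_sum f n x"
        by (intro exI[of _ "Suc n"]) (simp add: orbit_sum_Suc)
    qed
  qed
  have BM: "B \<subseteq> space M" by (auto simp: B_def)
  have "T -` B \<inter> space M = B" using inv BM by auto
  then have "prob B \<in> {0, 1}" by (intro T_ergodic) auto
  moreover have "prob B \<noteq> 1"
  proof
    assume "prob B = 1"
    then have ae: "AE x in M. x \<in> B" by (subst (asm) prob_eq_1) auto
    \<comment> \<open>\<open>maximal_ergodic\<close> asks for a positive orbit sum at every point;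
      the value 1 off the full set \<open>B\<close> provides it there and leaves the integral
      unchanged.\<close>
    define h where "h = (\<lambda>x. if x \<in> B then f x else 1)"
    have [measurable]: "h \<in> borel_measurable M" unfolding h_def by measurable
    have hf: "AE x in M. h x = f x" using ae by (auto simp: h_def)
    have hint: "integrable M h" using f hf by (subst integrable_cong_AE[of _ _ f]) auto
    have "0 \<le> (\<integral>x. h x \<partial>M)"
    proof (rule maximal_ergodic[OF hint])
      fix x assume x: "x \<in> space M"
      show "\<exists>n. 0 < orbit_sum h n x"
      proof (cases "x \<in> B")
        case True
        have TB: "(T ^^ k) x \<in> B" for k
          by (induction k) (use True inv BM in auto)
        have "orbit_sum h n x = orbit_sum f n x" for n
          unfolding orbit_sum_def h_def using TB by simp
        then show ?thesis using True B_iff[OF x] by auto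
      next
        case False
        then show ?thesis by (intro exI[of _ 1]) (simp add: orbit_sum_def h_def)
      qed
    qed
    also have "(\<integral>x. h x \<partial>M) = (\<integral>x. f x \<partial>M)" by (rule integral_cong_AE) (use hf in auto)
    finally show False using neg by simp
  qed
  ultimately have "prob B = 0" by simp
  then have "AE x in M. x \<notin> B" by (subst (asm) prob_eq_0) auto
  then show ?thesis
  proof (rule AE_mp, intro AE_I2 impI)
    fix x assume "x \<in> space M" "x \<notin> B"
    then show "\<exists>c. \<forall>n. orbit_sum f n x \<le> c"
      using B_iff[of x] by (meson not_le_imp_less)
  qed
qed

text \<open>Subtracting a number \<open>d\<close> strictly between the mean and \<open>c\<close>
  makes the mean negative; bounded orbit sums then leave the margin \<open>c - d\<close> per
  step.\<close>

lemma orbit_mean_eventually_less: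
  assumes f: "integrable M f" and c: "(\<integral>x. f x \<partial>M) < c"
  shows "AE x in M. \<forall>\<^sub>F n in sequentially. orbit_sum f n x / n < c"
proof -
  define d where "d = ((\<integral>x. f x \<partial>M) + c) / 2"
  have d: "(\<integral>x. f x \<partial>M) < d" "d < c" using c by (auto simp: d_def field_simps)
  have "AE x in M. \<exists>b. \<forall>n. orbit_sum (\<lambda>x. f x - d) n x \<le> b"
    using f d by (intro orbit_sum_bounded_above) (auto simp: prob_space)
  then show ?thesis
  proof (rule AE_mp, intro AE_I2 impI)
    fix x assume "\<exists>b. \<forall>n. orbit_sum (\<lambda>x. f x - d) n x \<le> b"
    then obtain b where b: "\<And>n. orbit_sum f n x - n * d \<le> b"
      by (auto simp: orbit_sum_def sum_subtractf)
    have "\<forall>\<^sub>F n in sequentially. b / real n < c - d"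
      using d order_tendstoD(2)[OF lim_const_over_n[of b], of "c - d"] by simp
    then show "\<forall>\<^sub>F n in sequentially. orbit_sum f n x / n < c"
      using eventually_gt_at_top[of 0]
    proof eventually_elim
      case (elim n)
      have "orbit_sum f n x \<le> b + n * d" using b[of n] by simp
      with elim show ?case by (simp add: field_simps)
    qed
  qed
qed

theorem birkhoff:
  assumes f: "integrable M f"
  shows "AE x in M. (\<lambda>n. orbit_sum f n x / n) \<longlonglongrightarrow> (\<integral>x. f x \<partial>M)"
proof -
  let ?e = "\<integral>x. f x \<partial>M"
  have "AE x in M. \<forall>j::nat. \<forall>\<^sub>F n in sequentially. orbit_sum f n x / n < ?e + 1 / Suc j"
    unfolding AE_all_countable using f by (intro allI orbit_mean_eventually_less) auto
  moreover have "AE x in M. \<forall>j::nat. \<forall>\<^sub>F n in sequentially.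
      orbit_sum (\<lambda>x. - f x) n x / n < - ?e + 1 / Suc j"
    unfolding AE_all_countable using f by (intro allI orbit_mean_eventually_less) auto
  ultimately show ?thesis
  proof eventually_elim
    case (elim x)
    show ?case
    proof (rule tendstoI)
      fix e :: real assume "e > 0"
      then obtain j where j: "1 / Suc j < e" using nat_approx_posE by blast
      have "\<forall>\<^sub>F n in sequentially. orbit_sum f n x / n < ?e + 1 / Suc j" using elim(1) by blast
      moreover have "\<forall>\<^sub>F n in sequentially. orbit_sum (\<lambda>x. - f x) n x / n < - ?e + 1 / Suc j"
        using elim(2) by blast
      ultimately show "\<forall>\<^sub>F n in sequentially. dist (orbit_sum f n x / n) ?e < e"
      proof eventually_elim
        case (elim n)
        then show ?case using j by (auto simp: orbit_sum_def sum_negf dist_real_def)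
      qed
    qed
  qed
qed

text \<open>Orbit averages of an integrable function are uniformly integrable.\<close>

lemma orbit_sum_vanishing_events:
  assumes f: "integrable M f" and f0: "\<And>x. x \<in> space M \<Longrightarrow> 0 \<le> f x"
    and A: "\<And>n. A n \<in> sets M" and A0: "AE x in M. \<forall>\<^sub>F n in sequentially. x \<notin> A n"
  shows "(\<lambda>n. (\<integral>x. indicator (A n) x * orbit_sum f n x \<partial>M) / n) \<longlonglongrightarrow> 0"
proof -
  have [measurable]: "f \<in> borel_measurable M" using f by auto
  note A[measurable]
  have pA: "(\<lambda>n. prob (A n)) \<longlonglongrightarrow> 0"
  proof -
    have "(\<lambda>n. \<integral>x. indicator (A n) x \<partial>M) \<longlonglongrightarrow> (\<integral>x. (0::real) \<partial>M)"
    proof (rule integral_dominated_convergence[where w = "\<lambda>_. 1"])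
      show "AE x in M. (\<lambda>n. indicat_real (A n) x) \<longlonglongrightarrow> 0"
        using A0
      proof eventually_elim
        case (elim x)
        then show ?case by (intro tendsto_eventually) (auto elim!: eventually_mono)
      qed
    qed (auto simp: indicator_def)
    then show ?thesis by simp
  qed
  have tr: "(\<lambda>a. \<integral>x. max 0 (f x - real a) \<partial>M) \<longlonglongrightarrow> (\<integral>x. 0 \<partial>M)"
  proof (rule integral_dominated_convergence[where w = f])
    show "AE x in M. (\<lambda>a. max 0 (f x - real a)) \<longlonglongrightarrow> 0"
    proof (rule AE_I2)
      fix x
      obtain k where "f x < real k" using reals_Archimedean2 by blast
      then show "(\<lambda>a. max 0 (f x - real a)) \<longlonglongrightarrow> 0"
        by (intro tendsto_eventually eventually_sequentiallyI[of k]) auto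
    qed
  qed (use f f0 in auto)
  show ?thesis
  proof (rule tendstoI)
    fix e :: real assume e: "e > 0"
    have "\<forall>\<^sub>F a in sequentially. (\<integral>x. max 0 (f x - real a) \<partial>M) < e / 2"
      using order_tendstoD(2)[OF tr, of "e / 2"] e by simp
    then obtain a where a: "(\<integral>x. max 0 (f x - real a) \<partial>M) < e / 2"
      by (meson eventually_happens' sequentially_bot)
    \<comment> \<open>The excess over the level \<open>a\<close>. The bounded part is controlled by
      the probability of \<open>A n\<close>, the excess by its mean, which is the same at each
      time.\<close>
    define h where "h = (\<lambda>x. max 0 (f x - real a))"
    have hint: "integrable M h"
      unfolding h_def by (rule Bochner_Integration.integrable_bound[OF f]) (use f0 in auto)
    have fh: "f x \<le> real a + h x" for x by (simp add: h_def)
    have h0: "0 \<le> h x" for x by (simp add: h_def)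
    have "(\<lambda>n. real a * prob (A n)) \<longlonglongrightarrow> 0" using tendsto_mult_left[OF pA, of "real a"] by simp
    then have "\<forall>\<^sub>F n in sequentially. real a * prob (A n) < e / 2"
      using order_tendstoD(2)[of _ 0 _ "e/2"] e by simp
    then show "\<forall>\<^sub>F n in sequentially.
        dist ((\<integral>x. indicator (A n) x * orbit_sum f n x \<partial>M) / n) 0 < e"
      using eventually_gt_at_top[of 0]
    proof eventually_elim
      case (elim n)
      have s0: "0 \<le> orbit_sum f n x" if "x \<in> space M" for x
        unfolding orbit_sum_def using that f0 T_pow_space by (auto intro!: sum_nonneg)
      have ii: "integrable M (\<lambda>x. indicator (A n) x * orbit_sum f n x)"
        using orbit_sum_integrable[OF f, of n] A[of n]
        by (auto intro!: integrable_mult_indicator[where 'b = real, simplified])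
      have I0: "0 \<le> (\<integral>x. indicator (A n) x * orbit_sum f n x \<partial>M)"
        using s0 by (intro integral_nonneg_AE AE_I2) auto
      have pw: "indicator (A n) x * orbit_sum f n x
          \<le> n * (real a * indicator (A n) x) + orbit_sum h n x" for x
      proof -
        have "orbit_sum f n x \<le> (\<Sum>k<n. real a + h ((T ^^ k) x))"
          unfolding orbit_sum_def by (intro sum_mono fh)
        also have "\<dots> = n * a + orbit_sum h n x" by (simp add: sum.distrib orbit_sum_def)
        finally have 1: "orbit_sum f n x \<le> n * a + orbit_sum h n x" .
        have 2: "0 \<le> orbit_sum h n x" unfolding orbit_sum_def by (intro sum_nonneg h0)
        show ?thesis using 1 2 by (auto simp: indicator_def)
      qed
      have ia: "integrable M (\<lambda>x. n * (real a * indicator (A n) x))"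
        by (intro integrable_mult_right integrable_real_indicator A) (simp add: emeasure_eq_measure)
      have "(\<integral>x. indicator (A n) x * orbit_sum f n x \<partial>M)
          \<le> (\<integral>x. n * (real a * indicator (A n) x) + orbit_sum h n x \<partial>M)"
        using ii ia orbit_sum_integrable[OF hint, of n] pw by (intro integral_mono) auto
      also have "\<dots> = n * (real a * prob (A n)) + n * (\<integral>x. h x \<partial>M)"
        using ia orbit_sum_integrable[OF hint, of n] by (simp add: integral_orbit_sum[OF hint])
      also have "\<dots> < n * (e / 2) + n * (e / 2)"
        using elim a unfolding h_def by (intro add_strict_mono) auto
      finally have "(\<integral>x. indicator (A n) x * orbit_sum f n x \<partial>M) < n * e" by (simp add: mult.commute)
      then show ?case using I0 elim by (simp add: field_simps dist_real_def)
    qed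
  qed
qed

end

section \<open>Likelihoods of a hidden Markov model\<close>

text \<open>\<open>Lker\<close> acting on functions instead of sets: splitting at a time becomes
  composition, and the likelihood of later observations can be inserted as the function.\<close>

primrec Lop ::
  "('x \<Rightarrow> 'x measure) \<Rightarrow> ('x \<Rightarrow> 'y \<Rightarrow> real) \<Rightarrow> nat \<Rightarrow> (nat \<Rightarrow> 'y) \<Rightarrow> ('x \<Rightarrow> ennreal) \<Rightarrow> 'x \<Rightarrow> ennreal"
where
  "Lop Q g 0 z f x = f x"
| "Lop Q g (Suc n) z f x =
     ennreal (g x (z 0)) * (\<integral>\<^sup>+ x'. Lop Q g n (\<lambda>i. z (Suc i)) f x' \<partial>Q x)"

text \<open>Indexed by the number of observations, so that 0 gives the constant 1 and lengths add
  up; \<open>lik_from\<close> at index \<open>n\<close> is \<open>plik\<close> at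
  \<open>Suc n\<close>.\<close>

definition plik ::
  "('x \<Rightarrow> 'x measure) \<Rightarrow> ('x \<Rightarrow> 'y \<Rightarrow> real) \<Rightarrow> nat \<Rightarrow> (nat \<Rightarrow> 'y) \<Rightarrow> 'x \<Rightarrow> ennreal" where
  "plik Q g n z = Lop Q g n z (\<lambda>_. 1)"

lemma Lop_cong_obs: "(\<And>i. i < n \<Longrightarrow> z i = z' i) \<Longrightarrow> Lop Q g n z f x = Lop Q g n z' f x"
proof (induction n arbitrary: z z' x)
  case (Suc n)
  then have "Lop Q g n (\<lambda>i. z (Suc i)) f x' = Lop Q g n (\<lambda>i. z' (Suc i)) f x'" for x'
    by (intro Suc.IH) auto
  with Suc.prems show ?case by simp
qed simp

lemma Lker_eq_Lop: "Lker Q g \<theta> t z x A = Lop (Q \<theta>) (g \<theta>) t z (indicator A) x"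
  by (induction t arbitrary: z x) auto

locale hmm_kernel =
  fixes X :: "'x measure" and Y :: "'y measure"
    and Q :: "'x \<Rightarrow> 'x measure" and g :: "'x \<Rightarrow> 'y \<Rightarrow> real"
  assumes Q_measurable: "Q \<in> X \<rightarrow>\<^sub>M prob_algebra X"
    and g_measurable: "(\<lambda>(x, y). g x y) \<in> borel_measurable (X \<Otimes>\<^sub>M Y)"
begin

abbreviation L where "L \<equiv> Lop Q g"
abbreviation p where "p \<equiv> plik Q g"
text \<open>Infinite sequences, although finitely many coordinates are read: dropping observations
  then stays within one space, as the recursion on \<open>n\<close> requires.\<close>

abbreviation Z :: "(nat \<Rightarrow> 'y) measure" where "Z \<equiv> \<Pi>\<^sub>M i\<in>UNIV. Y"

lemma Z_space: "z \<in> space Z \<longleftrightarrow> (\<forall>i. z i \<in> space Y)"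
  by (auto simp: space_PiM PiE_def Pi_def)

lemma Z_shift: "z \<in> space Z \<Longrightarrow> (\<lambda>i. z (i + k)) \<in> space Z"
  and Z_Suc: "z \<in> space Z \<Longrightarrow> (\<lambda>i. z (Suc i)) \<in> space Z"
  by (auto simp: Z_space)

lemma Q_space: "x \<in> space X \<Longrightarrow> prob_space (Q x)"
  and Q_sets: "x \<in> space X \<Longrightarrow> sets (Q x) = sets X"
  and Q_space_eq: "x \<in> space X \<Longrightarrow> space (Q x) = space X"
  using measurable_space[OF Q_measurable, of x]
  by (auto simp: space_prob_algebra dest: sets_eq_imp_space_eq)

lemma borel_Q: "x \<in> space X \<Longrightarrow> f \<in> borel_measurable X \<Longrightarrow> f \<in> borel_measurable (Q x)"
  using measurable_cong_sets[OF Q_sets refl] by blast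

text \<open>Joint measurability carries the induction, because the kernel integral depends on the
  state through \<open>Q\<close> and on the observations through the integrand.\<close>

lemma L_measurable_pair:
  assumes "f \<in> borel_measurable X"
  shows "(\<lambda>w. L n (fst w) f (snd w)) \<in> borel_measurable (Z \<Otimes>\<^sub>M X)"
proof (induction n)
  case 0
  then show ?case using assms by simp
next
  case (Suc n)
  have [measurable]: "(\<lambda>w. g (fst w) (snd w)) \<in> borel_measurable (X \<Otimes>\<^sub>M Y)"
    using g_measurable by (simp add: case_prod_beta')
  have gm: "(\<lambda>w. g (snd w) (fst w 0)) \<in> borel_measurable (Z \<Otimes>\<^sub>M X)"
  proof -
    have "(\<lambda>w. (snd w, fst w 0)) \<in> (Z \<Otimes>\<^sub>M X) \<rightarrow>\<^sub>M (X \<Otimes>\<^sub>M Y)" by measurable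
    from measurable_compose[OF this, of "\<lambda>w. g (fst w) (snd w)" borel] show ?thesis by simp
  qed
  have sh: "(\<lambda>w. (\<lambda>i. fst (fst w) (Suc i), snd w)) \<in> ((Z \<Otimes>\<^sub>M X) \<Otimes>\<^sub>M X) \<rightarrow>\<^sub>M (Z \<Otimes>\<^sub>M X)"
    by (intro measurable_Pair measurable_PiM_single') (auto simp: space_pair_measure space_PiM PiE_def Pi_def)
  have "(\<lambda>w. \<integral>\<^sup>+ x'. L n (\<lambda>i. fst w (Suc i)) f x' \<partial>Q (snd w)) \<in> borel_measurable (Z \<Otimes>\<^sub>M X)"
  proof (rule nn_integral_measurable_subprob_algebra2)
    show "(\<lambda>(w, x'). L n (\<lambda>i. fst w (Suc i)) f x') \<in> borel_measurable ((Z \<Otimes>\<^sub>M X) \<Otimes>\<^sub>M X)"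
      using measurable_compose[OF sh Suc] by (simp add: case_prod_beta')
    show "(\<lambda>w. Q (snd w)) \<in> Z \<Otimes>\<^sub>M X \<rightarrow>\<^sub>M subprob_algebra X"
      using measurable_compose[OF measurable_snd measurable_prob_algebraD[OF Q_measurable]] .
  qed
  then show ?case using gm by simp
qed

lemma L_measurable:
  assumes "f \<in> borel_measurable X" "z \<in> space Z"
  shows "L n z f \<in> borel_measurable X"
  using measurable_compose[OF measurable_Pair1'[OF assms(2)] L_measurable_pair[OF assms(1)], of n]
  by simp

lemma p_measurable: "z \<in> space Z \<Longrightarrow> p n z \<in> borel_measurable X"
  unfolding plik_def by (rule L_measurable) auto

section \<open>Monotonicity, linearity, continuity and composition of the operators\<close>

lemma L_mono:
  assumes "\<And>x. x \<in> space X \<Longrightarrow> f x \<le> h x" "x \<in> space X"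
  shows "L n z f x \<le> L n z h x"
  using assms(2)
proof (induction n arbitrary: z x)
  case (Suc n)
  then show ?case
    using Q_space_eq by (auto intro!: mult_left_mono nn_integral_mono)
qed (use assms in simp)

lemma L_cong:
  assumes "\<And>x. x \<in> space X \<Longrightarrow> f x = h x" "x \<in> space X"
  shows "L n z f x = L n z h x"
  using L_mono[of f h x n z] L_mono[of h f x n z] assms by (simp add: order_antisym)

lemma L_add:
  assumes f: "f \<in> borel_measurable X" and h: "h \<in> borel_measurable X" and "x \<in> space X" "z \<in> space Z"
  shows "L n z (\<lambda>x. f x + h x) x = L n z f x + L n z h x"
  using assms(3,4)
proof (induction n arbitrary: z x)
  case (Suc n)
  have [simp]: "(\<lambda>i. z (Suc i)) \<in> space Z" using Suc.prems by (intro Z_Suc)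
  have "(\<integral>\<^sup>+ x'. L n (\<lambda>i. z (Suc i)) (\<lambda>x. f x + h x) x' \<partial>Q x) =
      (\<integral>\<^sup>+ x'. L n (\<lambda>i. z (Suc i)) f x' + L n (\<lambda>i. z (Suc i)) h x' \<partial>Q x)"
    using Suc Q_space_eq by (intro nn_integral_cong) auto
  also have "\<dots> = (\<integral>\<^sup>+ x'. L n (\<lambda>i. z (Suc i)) f x' \<partial>Q x) + (\<integral>\<^sup>+ x'. L n (\<lambda>i. z (Suc i)) h x' \<partial>Q x)"
    using f h Suc.prems by (intro nn_integral_add borel_Q L_measurable) auto
  finally show ?case by (simp add: distrib_left)
qed simp

lemma L_cmult:
  assumes f: "f \<in> borel_measurable X" and "x \<in> space X" "z \<in> space Z"
  shows "L n z (\<lambda>x. c * f x) x = c * L n z f x"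
  using assms(2,3)
proof (induction n arbitrary: z x)
  case (Suc n)
  have [simp]: "(\<lambda>i. z (Suc i)) \<in> space Z" using Suc.prems by (intro Z_Suc)
  have "(\<integral>\<^sup>+ x'. L n (\<lambda>i. z (Suc i)) (\<lambda>x. c * f x) x' \<partial>Q x) =
      (\<integral>\<^sup>+ x'. c * L n (\<lambda>i. z (Suc i)) f x' \<partial>Q x)"
    using Suc Q_space_eq by (intro nn_integral_cong) auto
  also have "\<dots> = c * (\<integral>\<^sup>+ x'. L n (\<lambda>i. z (Suc i)) f x' \<partial>Q x)"
    using f Suc.prems by (intro nn_integral_cmult borel_Q L_measurable) auto
  finally show ?case by (simp add: ac_simps)
qed simp

lemma L_SUP:
  assumes f: "\<And>i. F i \<in> borel_measurable X" and inc: "incseq F" and "x \<in> space X" "z \<in> space Z"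
  shows "L n z (\<lambda>x. SUP i. F i x) x = (SUP i::nat. L n z (F i) x)"
  using assms(3,4)
proof (induction n arbitrary: z x)
  case (Suc n)
  have [simp]: "(\<lambda>i. z (Suc i)) \<in> space Z" using Suc.prems by (intro Z_Suc)
  have "(\<integral>\<^sup>+ x'. L n (\<lambda>i. z (Suc i)) (\<lambda>x. SUP i. F i x) x' \<partial>Q x) =
      (\<integral>\<^sup>+ x'. (SUP i. L n (\<lambda>i. z (Suc i)) (F i) x') \<partial>Q x)"
    using Suc Q_space_eq by (intro nn_integral_cong) auto
  also have "\<dots> = (SUP i. (\<integral>\<^sup>+ x'. L n (\<lambda>i. z (Suc i)) (F i) x' \<partial>Q x))"
  proof (rule nn_integral_monotone_convergence_SUP_AE)
    show "AE x' in Q x. L n (\<lambda>i. z (Suc i)) (F i) x' \<le> L n (\<lambda>i. z (Suc i)) (F (Suc i)) x'" for i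
      using inc Suc.prems Q_space_eq
      by (intro AE_I2 L_mono) (auto simp: incseq_Suc_iff le_fun_def)
  qed (use f Suc.prems in \<open>auto intro!: borel_Q L_measurable\<close>)
  finally show ?case by (simp add: SUP_mult_left_ennreal)
qed simp

lemma L_comp:
  "L (m + n) z f x = L m z (L n (\<lambda>i. z (i + m)) f) x"
  by (induction m arbitrary: z x) simp_all

lemma p_split: "m \<le> n \<Longrightarrow> p n z x = L m z (p (n - m) (\<lambda>i. z (i + m))) x"
  unfolding plik_def using L_comp[of m "n - m" z "\<lambda>_. 1" x] by simp

lemma p_0 [simp]: "p 0 z x = 1"
  by (simp add: plik_def)

lemma p_Suc: "p (Suc n) z x = ennreal (g x (z 0)) * (\<integral>\<^sup>+ x'. p n (\<lambda>i. z (Suc i)) x' \<partial>Q x)"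
  by (simp add: plik_def)

lemma L_le_sup:
  assumes "\<And>x. x \<in> space X \<Longrightarrow> f x \<le> c" "x \<in> space X" "z \<in> space Z"
  shows "L n z f x \<le> c * p n z x"
proof -
  have "L n z f x \<le> L n z (\<lambda>x. c * 1) x" using assms by (intro L_mono) auto
  then show ?thesis unfolding plik_def using L_cmult[of "\<lambda>_. 1" x z n c] assms by simp
qed

lemma lik_from_eq:
  assumes "Q' th = Q" "g' th = g" "x \<in> space X"
  shows "lik_from Q' g' th n z x = p (Suc n) z x"
  using assms(3)
proof (induction n arbitrary: z x)
  case 0
  then show ?case using assms by (simp add: plik_def prob_space.emeasure_space_1[OF Q_space])
next
  case (Suc n)
  have "(\<integral>\<^sup>+ x'. lik_from Q' g' th n (\<lambda>i. z (Suc i)) x' \<partial>Q x)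
      = (\<integral>\<^sup>+ x'. p (Suc n) (\<lambda>i. z (Suc i)) x' \<partial>Q x)"
    using Suc Q_space_eq by (intro nn_integral_cong) auto
  then show ?case using assms by (simp add: plik_def)
qed

lemma p_integral_measurable:
  assumes "mu \<in> space (prob_algebra X)" "f \<in> borel_measurable X"
  shows "(\<lambda>z. \<integral>\<^sup>+ x. L n z f x \<partial>mu) \<in> borel_measurable Z"
proof (rule nn_integral_measurable_subprob_algebra2[where N = X])
  show "(\<lambda>(z, x). L n z f x) \<in> borel_measurable (Z \<Otimes>\<^sub>M X)"
    using L_measurable_pair[OF assms(2), of n] by (simp add: case_prod_beta')
  show "(\<lambda>z. mu) \<in> Z \<rightarrow>\<^sub>M subprob_algebra X"
    using assms(1) by (intro measurable_prob_algebraD[of _ _ X] measurable_const)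
qed

end

section \<open>Hidden paths outside a local Doeblin set\<close>

context hmm_kernel
begin

text \<open>The likelihood of \<open>n\<close> observations in which every time in \<open>T\<close> at which the hidden path is
  outside \<open>C\<close> contributes an additional factor \<open>q\<close>.\<close>

primrec Wop :: "'x set \<Rightarrow> ennreal \<Rightarrow> nat \<Rightarrow> nat set \<Rightarrow> (nat \<Rightarrow> 'y) \<Rightarrow> 'x \<Rightarrow> ennreal" where
  "Wop C q 0 T z x = 1"
| "Wop C q (Suc n) T z x = (if 0 \<in> T \<and> x \<notin> C then q else 1) *
     (ennreal (g x (z 0)) * (\<integral>\<^sup>+ x'. Wop C q n {i. Suc i \<in> T} (\<lambda>i. z (Suc i)) x' \<partial>Q x))"

text \<open>The likelihood of \<open>n\<close> observations carried by the hidden paths that are outside \<open>C\<close> at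
  time \<open>t\<close>.\<close>

definition vis :: "'x set \<Rightarrow> nat \<Rightarrow> nat \<Rightarrow> (nat \<Rightarrow> 'y) \<Rightarrow> 'x \<Rightarrow> ennreal" where
  "vis C n t z = L t z (\<lambda>x. indicator (space X - C) x * p (n - t) (\<lambda>i. z (i + t)) x)"

lemma Wop_measurable:
  assumes "C \<in> sets X" "z \<in> space Z"
  shows "Wop C q n T z \<in> borel_measurable X"
  using assms(2)
proof (induction n arbitrary: z T)
  case 0
  have "Wop C q 0 T z = (\<lambda>x. 1)" by auto
  then show ?case by simp
next
  case (Suc n)
  have [measurable]: "(\<lambda>x. g x (z 0)) \<in> borel_measurable X"
    using measurable_compose[OF measurable_Pair2'[of "z 0" Y X] g_measurable] Suc.prems
    by (simp add: Z_space)
  have [measurable]: "(\<lambda>x. \<integral>\<^sup>+ x'. Wop C q n {i. Suc i \<in> T} (\<lambda>i. z (Suc i)) x' \<partial>Q x)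
      \<in> borel_measurable X"
    by (rule measurable_compose[OF measurable_prob_algebraD[OF Q_measurable]
          nn_integral_measurable_subprob_algebra[OF Suc.IH]]) (use Suc.prems in \<open>simp add: Z_Suc\<close>)
  have [measurable]: "C \<in> sets X" by fact
  show ?case by (cases "0 \<in> T") simp_all
qed

lemma vis_measurable:
  assumes "C \<in> sets X" "z \<in> space Z"
  shows "vis C n t z \<in> borel_measurable X"
proof -
  have [measurable]: "p (n - t) (\<lambda>i. z (i + t)) \<in> borel_measurable X"
    using assms by (intro p_measurable Z_shift)
  show ?thesis unfolding vis_def using assms by (intro L_measurable) auto
qed

lemma p_le_Wop:
  assumes "1 \<le> q" "x \<in> space X"
  shows "p n z x \<le> Wop C q n T z x"
  using assms(2)
proof (induction n arbitrary: z T x)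
  case (Suc n)
  have "1 * p (Suc n) z x \<le> Wop C q (Suc n) T z x"
    unfolding p_Suc Wop.simps using assms(1) Suc Q_space_eq
    by (intro mult_mono nn_integral_mono) auto
  then show ?case by simp
qed simp

lemma vis_Suc:
  "vis C (Suc n) (Suc t) z x = ennreal (g x (z 0)) * (\<integral>\<^sup>+ x'. vis C n t (\<lambda>i. z (Suc i)) x' \<partial>Q x)"
  by (simp add: vis_def)

text \<open>Integrated form of \<open>k \<le> N + q ^ k / q ^ N\<close>, valid for \<open>q \<ge> 2\<close>, applied to the number \<open>k\<close>
  of times in \<open>T\<close> that a hidden path spends outside \<open>C\<close>.\<close>

lemma vis_sum_le:
  assumes C: "C \<in> sets X" and q: "2 \<le> q" and "x \<in> space X" "z \<in> space Z"
  shows "q ^ N * (\<Sum>t\<in>T \<inter> {..<n}. vis C n t z x) \<le> q ^ N * of_nat N * p n z x + Wop C q n T z x"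
  using assms(3,4)
proof (induction n arbitrary: N T z x)
  case (Suc n)
  define z' where "z' = (\<lambda>i. z (Suc i))"
  define T' where "T' = {i. Suc i \<in> T}"
  define a where "a = ennreal (g x (z 0))"
  define S' where "S' x = (\<Sum>t\<in>T' \<inter> {..<n}. vis C n t z' x)" for x
  have z': "z' \<in> space Z" using Suc.prems unfolding z'_def by (intro Z_Suc)
  have mS: "S' \<in> borel_measurable (Q x)"
    unfolding S'_def[abs_def] using C z' Suc.prems by (intro borel_Q borel_measurable_sum vis_measurable)
  have mp: "p n z' \<in> borel_measurable (Q x)"
    using z' Suc.prems by (intro borel_Q p_measurable)
  have mW: "Wop C q n T' z' \<in> borel_measurable (Q x)"
    using z' Suc.prems C by (intro borel_Q Wop_measurable)
  define IS where "IS = a * (\<integral>\<^sup>+ x'. S' x' \<partial>Q x)"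
  define IW where "IW = a * (\<integral>\<^sup>+ x'. Wop C q n T' z' x' \<partial>Q x)"
  \<comment> \<open>Kept general in \<open>M\<close>: an excursion at time 0 uses up one unit of
    \<open>N\<close>.\<close>
  have IH: "q ^ M * IS \<le> q ^ M * of_nat M * p (Suc n) z x + IW" for M
  proof -
    have "(\<integral>\<^sup>+ x'. q ^ M * S' x' \<partial>Q x) \<le>
        (\<integral>\<^sup>+ x'. q ^ M * of_nat M * p n z' x' + Wop C q n T' z' x' \<partial>Q x)"
      unfolding S'_def using Suc.IH z' Q_space_eq Suc.prems by (intro nn_integral_mono) auto
    then have "q ^ M * (\<integral>\<^sup>+ x'. S' x' \<partial>Q x) \<le>
        q ^ M * of_nat M * (\<integral>\<^sup>+ x'. p n z' x' \<partial>Q x) + (\<integral>\<^sup>+ x'. Wop C q n T' z' x' \<partial>Q x)"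
      using mS mp mW by (simp add: nn_integral_cmult nn_integral_add)
    from mult_left_mono[OF this, of a] show ?thesis
      unfolding IS_def IW_def p_Suc a_def z'_def by (simp add: distrib_left ac_simps)
  qed
  have split: "(\<Sum>t\<in>T \<inter> {..<Suc n}. vis C (Suc n) t z x)
      = (if 0 \<in> T then indicator (space X - C) x * p (Suc n) z x else 0) + IS"
  proof -
    have eq: "T \<inter> {..<Suc n} = (if 0 \<in> T then {0} else {}) \<union> Suc ` (T' \<inter> {..<n})"
      by (auto simp: T'_def image_iff less_Suc_eq_0_disj)
    have "(\<Sum>t\<in>T \<inter> {..<Suc n}. vis C (Suc n) t z x)
        = (\<Sum>t\<in>(if 0 \<in> T then {0} else {}). vis C (Suc n) t z x)
          + (\<Sum>t\<in>Suc ` (T' \<inter> {..<n}). vis C (Suc n) t z x)"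
      unfolding eq by (rule sum.union_disjoint) auto
    also have "(\<Sum>t\<in>Suc ` (T' \<inter> {..<n}). vis C (Suc n) t z x)
        = (\<Sum>t\<in>T' \<inter> {..<n}. vis C (Suc n) (Suc t) z x)"
      by (subst sum.reindex) auto
    also have "\<dots> = a * (\<Sum>t\<in>T' \<inter> {..<n}. (\<integral>\<^sup>+ x'. vis C n t z' x' \<partial>Q x))"
      by (simp add: vis_Suc sum_distrib_left a_def z'_def)
    also have "\<dots> = IS"
      unfolding IS_def S'_def using C z' Suc.prems
      by (subst nn_integral_sum) (auto intro!: borel_Q vis_measurable)
    finally show ?thesis by (auto simp: vis_def)
  qed
  have W: "Wop C q (Suc n) T z x = (if 0 \<in> T \<and> x \<notin> C then q else 1) * IW"
    unfolding Wop.simps IW_def a_def T'_def z'_def ..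
  show ?case
  proof (cases "0 \<in> T \<and> x \<notin> C")
    case False
    then have "(\<Sum>t\<in>T \<inter> {..<Suc n}. vis C (Suc n) t z x) = IS"
      unfolding split by auto
    moreover have "Wop C q (Suc n) T z x = IW" unfolding W using False by auto
    ultimately show ?thesis using IH[of N] by simp
  next
    case True
    then have s: "(\<Sum>t\<in>T \<inter> {..<Suc n}. vis C (Suc n) t z x) = p (Suc n) z x + IS"
      unfolding split using Suc.prems by auto
    have w: "Wop C q (Suc n) T z x = q * IW" unfolding W using True by simp
    show ?thesis
    proof (cases N)
      \<comment> \<open>With no unit left, both terms are at most \<open>IW\<close>, and q \<ge> 2
        absorbs their sum.\<close>
      case 0
      have "1 \<le> q" using q order_trans[of 1 2 q] by simp
      then have "p (Suc n) z x \<le> IW"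
        unfolding p_Suc IW_def a_def z'_def[symmetric] using Q_space_eq Suc.prems
        by (intro mult_left_mono nn_integral_mono p_le_Wop) auto
      moreover have "IS \<le> IW" using IH[of 0] by simp
      ultimately have "p (Suc n) z x + IS \<le> IW + IW" by (rule add_mono)
      also have "\<dots> = 2 * IW" by (simp add: mult_2)
      also have "\<dots> \<le> q * IW" using q by (rule mult_right_mono) simp
      finally show ?thesis unfolding s w 0 by simp
    next
      \<comment> \<open>One unit of \<open>N\<close> accounts for the excursion at time 0; the
        factor \<open>q\<close> between the powers of order \<open>N\<close> and \<open>M\<close> is
        the one that \<open>Wop\<close> gains.\<close>
      case (Suc M)
      have "q ^ N * (p (Suc n) z x + IS) = q ^ N * p (Suc n) z x + q * (q ^ M * IS)"
        by (simp add: Suc distrib_left mult.assoc)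
      also have "\<dots> \<le> q ^ N * p (Suc n) z x + q * (q ^ M * of_nat M * p (Suc n) z x + IW)"
        by (intro add_left_mono mult_left_mono IH) simp
      also have "\<dots> = q ^ N * of_nat N * p (Suc n) z x + q * IW"
        by (simp add: Suc algebra_simps)
      finally show ?thesis unfolding s w .
    qed
  qed
qed simp

lemma Wop_skip:
  assumes "\<And>i. i < b \<Longrightarrow> i \<notin> T"
  shows "Wop C q (b + n) T z x = L b z (Wop C q n {i. i + b \<in> T} (\<lambda>i. z (i + b))) x"
  using assms
proof (induction b arbitrary: T z x)
  case (Suc b)
  have "Wop C q (b + n) {i. Suc i \<in> T} z' x' =
      L b z' (Wop C q n {i. i + b \<in> {i. Suc i \<in> T}} (\<lambda>i. z' (i + b))) x'" for z' x'
    using Suc.prems by (intro Suc.IH) auto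
  then show ?case using Suc.prems by simp
qed simp

lemma Wop_block:
  assumes "0 < b" "\<And>i. 0 < i \<Longrightarrow> i < b \<Longrightarrow> i \<notin> T"
  shows "Wop C q (b + n) T z x = (if 0 \<in> T \<and> x \<notin> C then q else 1) *
    L b z (Wop C q n {i. i + b \<in> T} (\<lambda>i. z (i + b))) x"
proof -
  obtain c where c: "b = Suc c" using assms(1) by (cases b) auto
  have "Wop C q (c + n) {i. Suc i \<in> T} z' x' =
      L c z' (Wop C q n {i. i + c \<in> {i. Suc i \<in> T}} (\<lambda>i. z' (i + c))) x'" for z' x'
    using assms(2) c by (intro Wop_skip) auto
  then show ?thesis by (simp add: c)
qed

lemma p_le_exp:
  assumes "\<And>i x. i < n \<Longrightarrow> x \<in> space X \<Longrightarrow> g x (z i) \<le> exp (u i)" "x \<in> space X"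
  shows "p n z x \<le> ennreal (exp (\<Sum>i<n. u i))"
  using assms
proof (induction n arbitrary: z u x)
  case (Suc n)
  have "(\<integral>\<^sup>+ x'. p n (\<lambda>i. z (Suc i)) x' \<partial>Q x) \<le> (\<integral>\<^sup>+ x'. ennreal (exp (\<Sum>i<n. u (Suc i))) \<partial>Q x)"
    using Suc.prems Q_space_eq by (intro nn_integral_mono Suc.IH) auto
  also have "\<dots> = ennreal (exp (\<Sum>i<n. u (Suc i)))"
    using Suc.prems by (simp add: prob_space.emeasure_space_1[OF Q_space])
  finally have "p (Suc n) z x \<le> ennreal (exp (u 0)) * ennreal (exp (\<Sum>i<n. u (Suc i)))"
    unfolding p_Suc using Suc.prems by (intro mult_mono ennreal_leI) auto
  also have "\<dots> = ennreal (exp (\<Sum>i<Suc n. u i))"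
    by (subst sum.lessThan_Suc_shift) (simp add: exp_add ennreal_mult)
  finally show ?case .
qed simp

text \<open>Only blocks started at \<open>k\<close> or later are removed, since
  \<open>Wop_le_exp\<close> reads the observations from time \<open>k\<close> on.\<close>

definition uncovered :: "nat set \<Rightarrow> nat \<Rightarrow> nat \<Rightarrow> nat \<Rightarrow> nat set" where
  "uncovered T b k n = {k..<n} - (\<Union>t\<in>T \<inter> {k..}. {t..<t + b})"

text \<open>Observations are consumed from time \<open>k\<close> on: a time outside \<open>T\<close>
  singly, at the cost \<open>u\<close>, and a time in \<open>T\<close> together with its whole
  block, at the cost \<open>B\<close>, which includes the weight \<open>q\<close> of a start outside
  \<open>C\<close>.\<close>

lemma Wop_le_exp:
  assumes z: "z \<in> space Z" and C: "C \<in> sets X" and b: "0 < b"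
    and T: "\<And>t. t \<in> T \<Longrightarrow> t + b \<le> n"
    and spaced: "\<And>t i. t \<in> T \<Longrightarrow> 0 < i \<Longrightarrow> i < b \<Longrightarrow> t + i \<notin> T"
    and U: "\<And>i x. i < n \<Longrightarrow> x \<in> space X \<Longrightarrow> g x (z i) \<le> exp (u i)"
    and B: "\<And>t x. t \<in> T \<Longrightarrow> x \<in> space X \<Longrightarrow>
      (if x \<in> C then 1 else q) * p b (\<lambda>i. z (i + t)) x \<le> ennreal (exp (B t))"
    and k: "k \<le> n" and x: "x \<in> space X"
  shows "Wop C q (n - k) {i. i + k \<in> T} (\<lambda>i. z (i + k)) x
    \<le> ennreal (exp ((\<Sum>t\<in>T \<inter> {k..}. B t) + (\<Sum>i\<in>uncovered T b k n. u i)))"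
  using k x
proof (induction "n - k" arbitrary: k x rule: less_induct)
  case less
  have finT: "finite (T \<inter> {k..})" for k
    by (rule finite_subset[of _ "{..n}"]) (use T in force)+
  have finU: "finite (uncovered T b k n)" for k by (simp add: uncovered_def)
  consider "k = n" | "k < n" "k \<notin> T" | "k \<in> T" using less.prems by force
  then show ?case
  proof cases
    case 1
    then have "T \<inter> {k..} = {}" "uncovered T b k n = {}" using T b by (force simp: uncovered_def)+
    with 1 show ?thesis by simp
  next
    case 2
    have s1: "T \<inter> {k..} = T \<inter> {Suc k..}" using 2 by (auto simp: Suc_le_eq le_less)
    have s2: "uncovered T b k n = insert k (uncovered T b (Suc k) n)"
      using 2 unfolding uncovered_def s1 by auto
    have kn: "k \<notin> uncovered T b (Suc k) n" by (simp add: uncovered_def)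
    define h where "h = (\<Sum>t\<in>T \<inter> {Suc k..}. B t) + (\<Sum>i\<in>uncovered T b (Suc k) n. u i)"
    have nk: "n - k = Suc (n - Suc k)" using 2 by simp
    have "Wop C q (n - k) {i. i + k \<in> T} (\<lambda>i. z (i + k)) x =
        ennreal (g x (z k)) * (\<integral>\<^sup>+ x'. Wop C q (n - Suc k) {i. i + Suc k \<in> T} (\<lambda>i. z (i + Suc k)) x' \<partial>Q x)"
      unfolding nk using 2 by simp
    also have "\<dots> \<le> ennreal (exp (u k)) * (\<integral>\<^sup>+ x'. ennreal (exp h) \<partial>Q x)"
      unfolding h_def using 2 less.prems U Q_space_eq
      by (intro mult_mono nn_integral_mono less.hyps ennreal_leI) auto
    also have "\<dots> = ennreal (exp (u k + h))"
      using less.prems by (simp add: prob_space.emeasure_space_1[OF Q_space] exp_add ennreal_mult)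
    also have "u k + h = (\<Sum>t\<in>T \<inter> {k..}. B t) + (\<Sum>i\<in>uncovered T b k n. u i)"
      unfolding h_def s1 s2 using kn finU by simp
    finally show ?thesis .
  next
    case 3
    have kb: "k + b \<le> n" using T 3 by auto
    have s1: "T \<inter> {k..} = insert k (T \<inter> {k + b..})"
    proof -
      have "k + b \<le> t" if "t \<in> T" "k \<le> t" "t \<noteq> k" for t
        by (rule ccontr) (use spaced[OF 3, of "t - k"] that in \<open>simp add: less_diff_conv2\<close>)
      then show ?thesis using 3 by auto
    qed
    have s2: "uncovered T b k n = uncovered T b (k + b) n"
      unfolding uncovered_def s1 by auto
    define h where "h = (\<Sum>t\<in>T \<inter> {k + b..}. B t) + (\<Sum>i\<in>uncovered T b (k + b) n. u i)"
    have nk: "n - k = b + (n - (k + b))" using kb by simp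
    have "Wop C q (n - k) {i. i + k \<in> T} (\<lambda>i. z (i + k)) x =
        (if x \<in> C then 1 else q) * L b (\<lambda>i. z (i + k))
          (Wop C q (n - (k + b)) {i. i + (k + b) \<in> T} (\<lambda>i. z (i + (k + b)))) x"
    proof -
      have "i + k \<notin> T" if "0 < i" "i < b" for i
        using spaced[OF 3 that] by (simp add: add.commute)
      then show ?thesis
        unfolding nk using 3 b by (subst Wop_block) (auto simp: ac_simps)
    qed
    also have "\<dots> \<le> (if x \<in> C then 1 else q) * (ennreal (exp h) * p b (\<lambda>i. z (i + k)) x)"
      unfolding h_def using less.prems kb b Z_shift[OF z]
      by (intro mult_left_mono L_le_sup less.hyps) auto
    also have "\<dots> = ennreal (exp h) * ((if x \<in> C then 1 else q) * p b (\<lambda>i. z (i + k)) x)"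
      by (simp add: ac_simps)
    also have "\<dots> \<le> ennreal (exp h) * ennreal (exp (B k))"
      using less.prems 3 by (intro mult_left_mono B) auto
    also have "\<dots> = ennreal (exp (h + B k))" by (simp add: exp_add ennreal_mult)
    also have "h + B k = (\<Sum>t\<in>T \<inter> {k..}. B t) + (\<Sum>i\<in>uncovered T b k n. u i)"
      unfolding h_def s1 s2 using finT b by simp
    finally show ?thesis .
  qed
qed

text \<open>With \<open>space X\<close> in the role of \<open>C\<close> every weight is 1, which
  leaves a submultiplicative bound for a packing by disjoint blocks.\<close>

lemma p_le_block_exp:
  assumes z: "z \<in> space Z" and b: "0 < b"
    and T: "\<And>t. t \<in> T \<Longrightarrow> t + b \<le> n"
    and spaced: "\<And>t i. t \<in> T \<Longrightarrow> 0 < i \<Longrightarrow> i < b \<Longrightarrow> t + i \<notin> T"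
    and U: "\<And>i x. i < n \<Longrightarrow> x \<in> space X \<Longrightarrow> g x (z i) \<le> exp (u i)"
    and B: "\<And>t x. t \<in> T \<Longrightarrow> x \<in> space X \<Longrightarrow> p b (\<lambda>i. z (i + t)) x \<le> ennreal (exp (B t))"
    and x: "x \<in> space X"
  shows "p n z x \<le> ennreal (exp ((\<Sum>t\<in>T. B t) + (\<Sum>i\<in>uncovered T b 0 n. u i)))"
proof -
  have "p n z x \<le> Wop (space X) 1 n T z x" by (rule p_le_Wop) (auto simp: x)
  also have "\<dots> \<le> ennreal (exp ((\<Sum>t\<in>T. B t) + (\<Sum>i\<in>uncovered T b 0 n. u i)))"
    using Wop_le_exp[of z "space X" b T n u 1 B 0 x] assms by simp
  finally show ?thesis .
qed

section \<open>Excursions from \<open>C\<close> under an initial law, and the Doeblin condition for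
  functions\<close>

abbreviation pm :: "'x measure \<Rightarrow> nat \<Rightarrow> (nat \<Rightarrow> 'y) \<Rightarrow> ennreal" where
  "pm mu n z \<equiv> \<integral>\<^sup>+ x. p n z x \<partial>mu"

lemma prob_algebra_D:
  assumes "mu \<in> space (prob_algebra X)"
  shows "prob_space mu" "sets mu = sets X" "space mu = space X"
    "f \<in> borel_measurable X \<Longrightarrow> f \<in> borel_measurable mu"
  using assms by (auto simp: space_prob_algebra dest: sets_eq_imp_space_eq cong: measurable_cong_sets)

lemma pm_le_const:
  assumes "mu \<in> space (prob_algebra X)" "\<And>x. x \<in> space X \<Longrightarrow> f x \<le> c"
  shows "(\<integral>\<^sup>+ x. f x \<partial>mu) \<le> c"
proof -
  have "(\<integral>\<^sup>+ x. f x \<partial>mu) \<le> (\<integral>\<^sup>+ x. c \<partial>mu)"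
    using assms prob_algebra_D[OF assms(1)] by (intro nn_integral_mono) auto
  then show ?thesis
    using prob_space.emeasure_space_1[OF prob_algebra_D(1)[OF assms(1)]] by simp
qed

text \<open>On a block in \<open>T\<close>, a start outside \<open>C\<close> puts the likelihood
  below the crude bound by a factor \<open>q\<close>, so weighting each excursion by
  \<open>q\<close> keeps the total below the crude bound \<open>exp (\<Sum>i<n. u i)\<close>. If
  that bound is within \<open>q ^ N\<close> of the likelihood, \<open>vis_sum_le\<close> leaves at
  most \<open>N + 1\<close> excursions on average, given the observations.\<close>

lemma vis_integral_sum_le:
  assumes z: "z \<in> space Z" and mu: "mu \<in> space (prob_algebra X)" and C: "C \<in> sets X" and b: "0 < b"
    and T: "\<And>t. t \<in> T \<Longrightarrow> t + b \<le> n"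
    and spaced: "\<And>t i. t \<in> T \<Longrightarrow> 0 < i \<Longrightarrow> i < b \<Longrightarrow> t + i \<notin> T"
    and U: "\<And>i x. i < n \<Longrightarrow> x \<in> space X \<Longrightarrow> g x (z i) \<le> exp (u i)"
    and q: "2 \<le> (q::real)"
    and K: "\<And>t x. t \<in> T \<Longrightarrow> x \<in> space X - C \<Longrightarrow>
      ennreal q * p b (\<lambda>i. z (i + t)) x \<le> ennreal (exp (\<Sum>i<b. u (i + t)))"
    and N: "ennreal (exp (\<Sum>i<n. u i)) \<le> ennreal (q ^ N) * pm mu n z"
  shows "(\<Sum>t\<in>T. \<integral>\<^sup>+ x. vis C n t z x \<partial>mu) \<le> of_nat (N + 1) * pm mu n z"
proof -
  note mD = prob_algebra_D[OF mu]
  have Tn: "T \<inter> {..<n} = T" using T b by force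
  have finT: "finite T" by (subst Tn[symmetric]) simp
  have B: "(if x \<in> C then 1 else ennreal q) * p b (\<lambda>i. z (i + t)) x \<le> ennreal (exp (\<Sum>i<b. u (i + t)))"
    if "t \<in> T" "x \<in> space X" for t x
  proof (cases "x \<in> C")
    case True
    have "p b (\<lambda>i. z (i + t)) x \<le> ennreal (exp (\<Sum>i<b. u (i + t)))"
      using that T[of t] U by (intro p_le_exp) auto
    then show ?thesis using True by simp
  qed (use K that in auto)
  \<comment> \<open>Blocks and uncovered times partition \<open>{..<n}\<close>, so the costs add up
    to the crude bound.\<close>
  have cover: "(\<Sum>t\<in>T. \<Sum>i<b. u (i + t)) + (\<Sum>i\<in>uncovered T b 0 n. u i) = (\<Sum>i<n. u i)"
  proof -
    have "(\<Sum>t\<in>T. \<Sum>i<b. u (i + t)) = (\<Sum>t\<in>T. \<Sum>i\<in>{t..<t + b}. u i)"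
    proof (rule sum.cong)
      fix t
      show "(\<Sum>i<b. u (i + t)) = (\<Sum>i\<in>{t..<t + b}. u i)"
        using sum.shift_bounds_nat_ivl[of u 0 t b] by (simp add: atLeast0LessThan add.commute)
    qed simp
    also have "\<dots> = (\<Sum>i\<in>(\<Union>t\<in>T. {t..<t + b}). u i)"
    proof (rule sum.UNION_disjoint[symmetric])
      show "\<forall>s\<in>T. \<forall>t\<in>T. s \<noteq> t \<longrightarrow> {s..<s + b} \<inter> {t..<t + b} = {}"
      proof (intro ballI impI)
        fix s t assume st: "s \<in> T" "t \<in> T" "s \<noteq> t"
        have "\<not> (s < t \<and> t < s + b)" using spaced[OF st(1), of "t - s"] st by (auto simp: less_diff_conv2)
        moreover have "\<not> (t < s \<and> s < t + b)" using spaced[OF st(2), of "s - t"] st by (auto simp: less_diff_conv2)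
        ultimately show "{s..<s + b} \<inter> {t..<t + b} = {}" using st by auto
      qed
    qed (use finT in auto)
    finally have "(\<Sum>t\<in>T. \<Sum>i<b. u (i + t)) = (\<Sum>i\<in>(\<Union>t\<in>T. {t..<t + b}). u i)" .
    moreover have "(\<Union>t\<in>T. {t..<t + b}) \<subseteq> {..<n}" using T by force
    moreover have "uncovered T b 0 n = {..<n} - (\<Union>t\<in>T. {t..<t + b})"
      by (auto simp: uncovered_def)
    ultimately show ?thesis using sum.subset_diff[of "\<Union>t\<in>T. {t..<t + b}" "{..<n}" u] by simp
  qed
  have W: "Wop C (ennreal q) n T z x \<le> ennreal (exp (\<Sum>i<n. u i))" if "x \<in> space X" for x
    using Wop_le_exp[OF z C b T spaced U B, of 0 x] that cover by simp
  have "ennreal (q ^ N) * (\<Sum>t\<in>T. \<integral>\<^sup>+ x. vis C n t z x \<partial>mu)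
      = (\<integral>\<^sup>+ x. ennreal q ^ N * (\<Sum>t\<in>T \<inter> {..<n}. vis C n t z x) \<partial>mu)"
  proof -
    have vm: "vis C n t z \<in> borel_measurable mu" for t using C z by (intro mD(4) vis_measurable)
    have "(\<integral>\<^sup>+ x. ennreal q ^ N * (\<Sum>t\<in>T. vis C n t z x) \<partial>mu) =
        ennreal q ^ N * (\<integral>\<^sup>+ x. (\<Sum>t\<in>T. vis C n t z x) \<partial>mu)"
      using vm by (intro nn_integral_cmult borel_measurable_sum)
    then show ?thesis
      using vm q unfolding Tn by (simp add: nn_integral_sum ennreal_power)
  qed
  also have "\<dots> \<le> (\<integral>\<^sup>+ x. ennreal q ^ N * of_nat N * p n z x + Wop C (ennreal q) n T z x \<partial>mu)"
    using C z q mD by (intro nn_integral_mono vis_sum_le) (auto simp: numeral_le_ennreal_iff)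
  also have "\<dots> = ennreal q ^ N * of_nat N * pm mu n z + (\<integral>\<^sup>+ x. Wop C (ennreal q) n T z x \<partial>mu)"
    using mD(4)[OF p_measurable[OF z, of n]] mD(4)[OF Wop_measurable[OF C z, of "ennreal q" n T]]
    by (simp add: nn_integral_add nn_integral_cmult)
  also have "(\<integral>\<^sup>+ x. Wop C (ennreal q) n T z x \<partial>mu) \<le> ennreal (exp (\<Sum>i<n. u i))"
    using mu W by (rule pm_le_const)
  also note N
  also have "ennreal q ^ N * of_nat N * pm mu n z + ennreal (q ^ N) * pm mu n z
      = ennreal (q ^ N) * (of_nat (N + 1) * pm mu n z)"
    using q by (simp add: ennreal_power algebra_simps)
  finally have "ennreal (q ^ N) * (\<Sum>t\<in>T. \<integral>\<^sup>+ x. vis C n t z x \<partial>mu)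
      \<le> ennreal (q ^ N) * (of_nat (N + 1) * pm mu n z)" by (simp add: add_left_mono)
  then show ?thesis
    using q by (subst (asm) ennreal_mult_le_mult_iff) auto
qed

text \<open>The comparison with \<open>lam\<close> is preserved by scaling, sums and increasing
  limits, hence passes from sets to functions. The function of interest is the likelihood of the
  observations after the Doeblin block.\<close>

lemma doeblin_fun:
  assumes z: "z \<in> space Z" and x: "x \<in> space X" and C: "C \<in> sets X"
    and lam: "lam \<in> space (prob_algebra X)"
    and D: "\<And>A. A \<in> sets X \<Longrightarrow> L r z (indicator C) x * emeasure lam A \<le> rho * L r z (indicator (A \<inter> C)) x
      \<and> L r z (indicator (A \<inter> C)) x \<le> rho * L r z (indicator C) x * emeasure lam A"
    and f: "f \<in> borel_measurable X"
  shows "L r z (indicator C) x * (\<integral>\<^sup>+ y. f y \<partial>lam) \<le> rho * L r z (\<lambda>y. indicator C y * f y) x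
      \<and> L r z (\<lambda>y. indicator C y * f y) x \<le> rho * L r z (indicator C) x * (\<integral>\<^sup>+ y. f y \<partial>lam)"
  using f
proof (induction rule: borel_measurable_induct)
  case (cong f h)
  have "(\<integral>\<^sup>+ y. f y \<partial>lam) = (\<integral>\<^sup>+ y. h y \<partial>lam)"
    using cong prob_algebra_D[OF lam] by (intro nn_integral_cong) auto
  moreover have "L r z (\<lambda>y. indicator C y * f y) x = L r z (\<lambda>y. indicator C y * h y) x"
    using cong x by (intro L_cong) auto
  ultimately show ?case using cong by simp
next
  case (set A)
  have "(\<lambda>y. indicator C y * indicator A y :: ennreal) = indicator (A \<inter> C)"
    by (auto simp: indicator_def fun_eq_iff)
  then show ?case using D[OF set] set prob_algebra_D[OF lam] by simp
next
  case (mult u c)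
  have [measurable]: "C \<in> sets X" "u \<in> borel_measurable X" by fact+
  have "L r z (\<lambda>y. indicator C y * (c * u y)) x = c * L r z (\<lambda>y. indicator C y * u y) x"
    using L_cmult[of "\<lambda>y. indicator C y * u y" x z r c] x z by (simp add: ac_simps)
  moreover have "(\<integral>\<^sup>+ y. c * u y \<partial>lam) = c * (\<integral>\<^sup>+ y. u y \<partial>lam)"
    using mult prob_algebra_D[OF lam] by (intro nn_integral_cmult) auto
  moreover have "c * (L r z (indicator C) x * (\<integral>\<^sup>+ y. u y \<partial>lam)) \<le> c * (rho * L r z (\<lambda>y. indicator C y * u y) x)"
    "c * L r z (\<lambda>y. indicator C y * u y) x \<le> c * (rho * L r z (indicator C) x * (\<integral>\<^sup>+ y. u y \<partial>lam))"
    using mult by (auto intro: mult_left_mono)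
  ultimately show ?case by (simp add: ac_simps)
next
  case (add u v)
  have [measurable]: "C \<in> sets X" "u \<in> borel_measurable X" "v \<in> borel_measurable X" by fact+
  have "L r z (\<lambda>y. indicator C y * (v y + u y)) x =
      L r z (\<lambda>y. indicator C y * v y) x + L r z (\<lambda>y. indicator C y * u y) x"
    using L_add[of "\<lambda>y. indicator C y * v y" "\<lambda>y. indicator C y * u y" x z r] x z
    by (simp add: distrib_left)
  moreover have "(\<integral>\<^sup>+ y. v y + u y \<partial>lam) = (\<integral>\<^sup>+ y. v y \<partial>lam) + (\<integral>\<^sup>+ y. u y \<partial>lam)"
    using add prob_algebra_D[OF lam] by (intro nn_integral_add) auto
  ultimately show ?case using add by (auto simp: distrib_left intro: add_mono)
next
  case (seq U)
  have [measurable]: "C \<in> sets X" "U i \<in> borel_measurable X" for i using seq C by auto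
  have "(\<lambda>y. indicator C y * (SUP i. U i) y) = (\<lambda>y. SUP i. indicator C y * U i y)"
    by (auto simp: fun_eq_iff image_comp SUP_mult_left_ennreal)
  then have 1: "L r z (\<lambda>y. indicator C y * (SUP i. U i) y) x = (SUP i. L r z (\<lambda>y. indicator C y * U i y) x)"
    using L_SUP[of "\<lambda>i y. indicator C y * U i y" x z r] x z seq
    by (simp add: incseq_def le_fun_def mult_left_mono)
  have "(\<integral>\<^sup>+ y. (SUP i. U i) y \<partial>lam) = (\<integral>\<^sup>+ y. (SUP i. U i y) \<partial>lam)"
    by (simp add: image_comp)
  also have "\<dots> = (SUP i. \<integral>\<^sup>+ y. U i y \<partial>lam)"
    using seq prob_algebra_D[OF lam] by (intro nn_integral_monotone_convergence_SUP) auto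
  finally have 2: "(\<integral>\<^sup>+ y. (SUP i. U i) y \<partial>lam) = (SUP i. \<integral>\<^sup>+ y. U i y \<partial>lam)" .
  show ?case
    unfolding 1 2 SUP_mult_left_ennreal using seq by (auto intro!: SUP_mono)
qed

text \<open>The likelihood of \<open>n\<close> observations carried by the paths that are in \<open>C\<close> at both times \<open>t\<close>
  and \<open>t + r\<close>.\<close>

definition good :: "'x set \<Rightarrow> nat \<Rightarrow> nat \<Rightarrow> nat \<Rightarrow> (nat \<Rightarrow> 'y) \<Rightarrow> 'x \<Rightarrow> ennreal" where
  "good C r n t z = L t z (\<lambda>x. indicator C x *
     L r (\<lambda>i. z (i + t)) (\<lambda>y. indicator C y * p (n - (t + r)) (\<lambda>i. z (i + (t + r))) y) x)"

lemma good_measurable: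
  assumes "C \<in> sets X" "z \<in> space Z"
  shows "good C r n t z \<in> borel_measurable X"
proof -
  have [measurable]: "C \<in> sets X" by fact
  have [measurable]: "p (n - (t + r)) (\<lambda>i. z (i + (t + r))) \<in> borel_measurable X"
    by (intro p_measurable Z_shift assms)
  have [measurable]: "L r (\<lambda>i. z (i + t)) (\<lambda>y. indicator C y * p (n - (t + r)) (\<lambda>i. z (i + (t + r))) y)
      \<in> borel_measurable X"
    by (intro L_measurable Z_shift assms) measurable
  show ?thesis
    unfolding good_def by (intro L_measurable assms) measurable
qed

text \<open>A path that misses \<open>C\<close> at \<open>t\<close> or at \<open>t + r\<close> is
  charged to the corresponding \<open>vis\<close>; one that misses both is charged twice, hence only
  an inequality.\<close>

lemma p_le_good_vis:
  assumes z: "z \<in> space Z" and C: "C \<in> sets X" and x: "x \<in> space X" and n: "t + r \<le> n"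
  shows "p n z x \<le> good C r n t z x + (vis C n t z x + vis C n (t + r) z x)"
proof -
  have [measurable]: "C \<in> sets X" by fact
  define F where "F = p (n - (t + r)) (\<lambda>i. z (i + (t + r)))"
  define z' where "z' = (\<lambda>i. z (i + t))"
  have z': "z' \<in> space Z" unfolding z'_def by (rule Z_shift[OF z])
  have F[measurable]: "F \<in> borel_measurable X"
    unfolding F_def by (intro p_measurable Z_shift z)
  have pt[measurable]: "p (n - t) z' \<in> borel_measurable X" by (intro p_measurable z')
  define F1 where "F1 = (\<lambda>y. indicator C y * F y)"
  define F2 where "F2 = (\<lambda>y. indicator (space X - C) y * F y)"
  have [measurable]: "F1 \<in> borel_measurable X" "F2 \<in> borel_measurable X" unfolding F1_def F2_def by measurable
  have Lm[measurable]: "L r z' F1 \<in> borel_measurable X" "L r z' F2 \<in> borel_measurable X"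
    using z' by (auto intro: L_measurable)
  have pn: "p (n - t) z' y = L r z' F1 y + L r z' F2 y" if y: "y \<in> space X" for y
  proof -
    have "p (n - t) z' y = L r z' F y"
      using n p_split[of r "n - t" z' y] by (simp add: F_def z'_def ac_simps)
    also have "\<dots> = L r z' (\<lambda>y. F1 y + F2 y) y"
      using y by (intro L_cong) (auto simp: F1_def F2_def indicator_def)
    also have "\<dots> = L r z' F1 y + L r z' F2 y"
      using y z' by (intro L_add) auto
    finally show ?thesis .
  qed
  have "p n z x = L t z (p (n - t) z') x" unfolding z'_def using n by (intro p_split) auto
  also have "\<dots> \<le> L t z (\<lambda>y. indicator C y * L r z' F1 y + (indicator (space X - C) y * p (n - t) z' y + L r z' F2 y)) x"
    using x by (intro L_mono) (auto simp: indicator_def pn)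
  also have "\<dots> = L t z (\<lambda>y. indicator C y * L r z' F1 y) x +
      (L t z (\<lambda>y. indicator (space X - C) y * p (n - t) z' y) x + L t z (L r z' F2) x)"
    using x z by (simp add: L_add)
  also have "L t z (L r z' F2) x = vis C n (t + r) z x"
    unfolding vis_def L_comp z'_def F2_def F_def by simp
  finally show ?thesis unfolding good_def vis_def F1_def F_def z'_def by simp
qed

end

section \<open>Comparison of likelihoods\<close>

lemma ennreal_half_le:
  fixes P W v :: ennreal
  assumes "P < \<infinity>" "P \<le> W + v" "2 * v \<le> P"
  shows "P \<le> 2 * W"
proof -
  have "P + P \<le> 2 * W + 2 * v" using mult_left_mono[OF assms(2), of 2] by (simp add: mult_2 distrib_left)
  also have "\<dots> \<le> 2 * W + P" using assms(3) by (rule add_left_mono)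
  finally have "P + P \<le> P + 2 * W" by (simp add: add.commute)
  then show ?thesis using assms(1) by (subst (asm) ennreal_add_left_cancel_le) auto
qed

text \<open>Markov's inequality for the counting measure.\<close>

lemma light_index_count:
  fixes a :: "nat \<Rightarrow> ennreal"
  assumes S: "finite S" and le: "(\<Sum>t\<in>S. a t) \<le> of_nat m * P" and P: "0 < P" "P < \<infinity>"
  shows "card {t \<in> S. P < 2 * a t} \<le> 2 * m"
proof -
  let ?S = "{t \<in> S. P < 2 * a t}"
  have "of_nat (card ?S) * P = (\<Sum>t\<in>?S. P)" by simp
  also have "\<dots> \<le> (\<Sum>t\<in>?S. 2 * a t)" by (intro sum_mono) auto
  also have "\<dots> \<le> (\<Sum>t\<in>S. 2 * a t)" using S by (intro sum_mono2) auto
  also have "\<dots> = 2 * (\<Sum>t\<in>S. a t)" by (simp add: sum_distrib_left)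
  also have "\<dots> \<le> 2 * (of_nat m * P)" using le by (rule mult_left_mono) simp
  also have "\<dots> = P * of_nat (2 * m)" by (simp add: ac_simps)
  finally have "P * of_nat (card ?S) \<le> P * of_nat (2 * m)" by (simp only: mult.commute)
  then have "(of_nat (card ?S) :: ennreal) \<le> of_nat (2 * m)"
    using P by (subst (asm) ennreal_mult_le_mult_iff) auto
  then show ?thesis by (simp only: of_nat_le_iff)
qed

context hmm_kernel
begin

text \<open>The times \<open>t\<close> and the times \<open>t + b\<close> both lie in
  \<open>T\<close>, so each family carries at most \<open>N + 1\<close> excursions; Markov's
  inequality at level 1/2 doubles the sum, which gives the factor 4. The remaining times of
  \<open>S\<close> are good.\<close>

lemma light_count:
  assumes z: "z \<in> space Z" and mu: "mu \<in> space (prob_algebra X)" and C: "C \<in> sets X" and b: "0 < b"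
    and T: "\<And>t. t \<in> T \<Longrightarrow> t + b \<le> n"
    and spaced: "\<And>t i. t \<in> T \<Longrightarrow> 0 < i \<Longrightarrow> i < b \<Longrightarrow> t + i \<notin> T"
    and U: "\<And>i x. i < n \<Longrightarrow> x \<in> space X \<Longrightarrow> g x (z i) \<le> exp (u i)"
    and q: "2 \<le> (q::real)"
    and K: "\<And>t x. t \<in> T \<Longrightarrow> x \<in> space X - C \<Longrightarrow>
      ennreal q * p b (\<lambda>i. z (i + t)) x \<le> ennreal (exp (\<Sum>i<b. u (i + t)))"
    and N: "ennreal (exp (\<Sum>i<n. u i)) \<le> ennreal (q ^ N) * pm mu n z"
    and S: "S \<subseteq> T" "\<And>t. t \<in> S \<Longrightarrow> t + b \<in> T"
  shows "card {t \<in> S. pm mu n z < 2 * ((\<integral>\<^sup>+ x. vis C n t z x \<partial>mu) + (\<integral>\<^sup>+ x. vis C n (t + b) z x \<partial>mu))}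
    \<le> 4 * (N + 1)"
proof -
  define a where "a t = (\<integral>\<^sup>+ x. vis C n t z x \<partial>mu)" for t
  have finT: "finite T" by (rule finite_subset[of _ "{..n}"]) (use T in force)+
  then have finS: "finite S" using S finite_subset by blast
  have sT: "(\<Sum>t\<in>T. a t) \<le> of_nat (N + 1) * pm mu n z"
    unfolding a_def by (rule vis_integral_sum_le[OF z mu C b T spaced U q K N])
  have "(\<Sum>t\<in>S. a t) \<le> (\<Sum>t\<in>T. a t)" using S finT by (intro sum_mono2) auto
  moreover have "(\<Sum>t\<in>S. a (t + b)) \<le> (\<Sum>t\<in>T. a t)"
  proof -
    have "(\<Sum>t\<in>S. a (t + b)) = (\<Sum>t\<in>(\<lambda>t. t + b) ` S. a t)"
      by (subst sum.reindex) (auto simp: inj_on_def)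
    also have "\<dots> \<le> (\<Sum>t\<in>T. a t)" using S finT by (intro sum_mono2) auto
    finally show ?thesis .
  qed
  ultimately have "(\<Sum>t\<in>S. a t + a (t + b)) \<le> of_nat (N + 1) * pm mu n z + of_nat (N + 1) * pm mu n z"
    using sT by (auto simp: sum.distrib intro!: add_mono intro: order_trans)
  also have "\<dots> = of_nat (2 * (N + 1)) * pm mu n z"
    by (simp only: mult_2 of_nat_add distrib_right)
  finally have "card {t \<in> S. pm mu n z < 2 * (a t + a (t + b))} \<le> 2 * (2 * (N + 1))"
  proof (rule light_index_count[OF finS])
    show "0 < pm mu n z"
    proof (rule ccontr)
      assume "\<not> 0 < pm mu n z"
      then show False using N by (simp add: not_less)
    qed
    have "pm mu n z \<le> ennreal (exp (\<Sum>i<n. u i))"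
      by (intro pm_le_const mu p_le_exp U)
    then show "pm mu n z < \<infinity>" using order_le_less_trans by fastforce
  qed
  then show ?thesis by (simp add: a_def)
qed

text \<open>Each law spoils at most \<open>4 * (N + 1)\<close> times of \<open>S\<close>, so some
  time is good for \<open>mu1\<close> over \<open>n\<close> observations and for \<open>mu2\<close>
  over the window \<open>w\<close>. There the likelihoods factor, up to \<open>rho\<close>, into a
  past term depending on the law and a future term depending on \<open>lam\<close> only. Using
  goodness of \<open>mu2\<close> over the window, and not over all \<open>n\<close> observations,
  bounds its past term below at a cost exponential in \<open>w\<close> only.\<close>

lemma comparison:
  assumes z: "z \<in> space Z" and mu1: "mu1 \<in> space (prob_algebra X)" and mu2: "mu2 \<in> space (prob_algebra X)"
    and C: "C \<in> sets X" and b: "0 < b" and w: "w \<le> n"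
    and T: "\<And>t. t \<in> T \<Longrightarrow> t + b \<le> w"
    and spaced: "\<And>t i. t \<in> T \<Longrightarrow> 0 < i \<Longrightarrow> i < b \<Longrightarrow> t + i \<notin> T"
    and u0: "\<And>i. 0 \<le> u i"
    and U: "\<And>i x. i < n \<Longrightarrow> x \<in> space X \<Longrightarrow> g x (z i) \<le> exp (u i)"
    and q: "2 \<le> (q::real)"
    and K: "\<And>t x. t \<in> T \<Longrightarrow> x \<in> space X - C \<Longrightarrow>
      ennreal q * p b (\<lambda>i. z (i + t)) x \<le> ennreal (exp (\<Sum>i<b. u (i + t)))"
    and S: "S \<subseteq> T" "\<And>t. t \<in> S \<Longrightarrow> t + b \<in> T"
    and D: "\<And>t. t \<in> S \<Longrightarrow> \<exists>lam\<in>space (prob_algebra X). \<forall>x\<in>C. \<forall>A\<in>sets X.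
      L b (\<lambda>i. z (i + t)) (indicator C) x * emeasure lam A \<le> rho * L b (\<lambda>i. z (i + t)) (indicator (A \<inter> C)) x
      \<and> L b (\<lambda>i. z (i + t)) (indicator (A \<inter> C)) x \<le> rho * L b (\<lambda>i. z (i + t)) (indicator C) x * emeasure lam A"
    and N1: "ennreal (exp (\<Sum>i<n. u i)) \<le> ennreal (q ^ N) * pm mu1 n z"
    and N2: "ennreal (exp (\<Sum>i<w. u i)) \<le> ennreal (q ^ N) * pm mu2 w z"
    and card: "8 * (N + 1) < card S"
  shows "pm mu1 n z * pm mu2 w z \<le> 4 * rho ^ 3 * (ennreal (exp (\<Sum>i<w. u i)))\<^sup>2 * pm mu2 n z"
proof -
  define E where "E = ennreal (exp (\<Sum>i<w. u i))"
  have [measurable]: "C \<in> sets X" by fact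
  define H1 where "H1 = {t \<in> S. pm mu1 n z < 2 * ((\<integral>\<^sup>+ x. vis C n t z x \<partial>mu1) + (\<integral>\<^sup>+ x. vis C n (t + b) z x \<partial>mu1))}"
  define H2 where "H2 = {t \<in> S. pm mu2 w z < 2 * ((\<integral>\<^sup>+ x. vis C w t z x \<partial>mu2) + (\<integral>\<^sup>+ x. vis C w (t + b) z x \<partial>mu2))}"
  have Tn: "t + b \<le> n" if "t \<in> T" for t using T[OF that] w by simp
  have c1: "card H1 \<le> 4 * (N + 1)"
    unfolding H1_def by (rule light_count[OF z mu1 C b Tn spaced U q K N1 S])
  have c2: "card H2 \<le> 4 * (N + 1)"
    unfolding H2_def by (rule light_count[OF z mu2 C b T spaced _ q K N2 S]) (use U w in auto)
  have finT: "finite T" by (rule finite_subset[of _ "{..n}"]) (use Tn in force)+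
  then have finS: "finite S" using S finite_subset by blast
  have "\<not> S \<subseteq> H1 \<union> H2"
  proof
    assume "S \<subseteq> H1 \<union> H2"
    moreover have "finite (H1 \<union> H2)" using finS by (auto simp: H1_def H2_def)
    ultimately have "card S \<le> card (H1 \<union> H2)" by (intro card_mono)
    also have "\<dots> \<le> card H1 + card H2" by (rule card_Un_le)
    finally show False using c1 c2 card by simp
  qed
  then obtain t where t: "t \<in> S" "t \<notin> H1" "t \<notin> H2" by auto
  have tT: "t \<in> T" "t + b \<in> T" using t S by auto
  have tw: "t + b \<le> w" "t + b \<le> n" using T tT w by force+
  obtain lam where lam: "lam \<in> space (prob_algebra X)" and lamD: "\<And>x A. x \<in> C \<Longrightarrow> A \<in> sets X \<Longrightarrow>
      L b (\<lambda>i. z (i + t)) (indicator C) x * emeasure lam A \<le> rho * L b (\<lambda>i. z (i + t)) (indicator (A \<inter> C)) x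
      \<and> L b (\<lambda>i. z (i + t)) (indicator (A \<inter> C)) x \<le> rho * L b (\<lambda>i. z (i + t)) (indicator C) x * emeasure lam A"
    using D[OF t(1)] by blast
  define zt where "zt = (\<lambda>i. z (i + t))"
  have zt: "zt \<in> space Z" unfolding zt_def by (rule Z_shift[OF z])
  \<comment> \<open>\<open>A mu\<close> is the likelihood of the first \<open>t + b\<close>
    observations on the paths in \<open>C\<close> at both times, \<open>F k\<close> that of the
    observations from \<open>t + b\<close> to \<open>k - 1\<close> started from \<open>lam\<close>.
    Only \<open>A\<close> depends on the initial law.\<close>
  define G where "G = L t z (\<lambda>x. indicator C x * L b zt (indicator C) x)"
  define A where "A mu = (\<integral>\<^sup>+ x. G x \<partial>mu)" for mu
  define F where "F k = (\<integral>\<^sup>+ y. p (k - (t + b)) (\<lambda>i. z (i + (t + b))) y \<partial>lam)" for k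
  have inner: "(\<lambda>x. indicator C x * L b zt (indicator C) x) \<in> borel_measurable X"
  proof -
    have [measurable]: "L b zt (indicator C) \<in> borel_measurable X"
      by (intro L_measurable zt) measurable
    show ?thesis by measurable
  qed
  have Gm: "G \<in> borel_measurable X"
    unfolding G_def by (rule L_measurable[OF inner z])
  have pt: "p (k - (t + b)) (\<lambda>i. z (i + (t + b))) \<in> borel_measurable X" for k
    by (intro p_measurable Z_shift z)
  define I where "I k x = indicator C x * L b zt (\<lambda>y. indicator C y * p (k - (t + b)) (\<lambda>i. z (i + (t + b))) y) x" for k x
  have Im: "I k \<in> borel_measurable X" for k
  proof -
    have [measurable]: "p (k - (t + b)) (\<lambda>i. z (i + (t + b))) \<in> borel_measurable X" by (rule pt)
    have [measurable]: "L b zt (\<lambda>y. indicator C y * p (k - (t + b)) (\<lambda>i. z (i + (t + b))) y) \<in> borel_measurable X"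
      by (intro L_measurable zt) measurable
    show ?thesis unfolding I_def[abs_def] by measurable
  qed
  have goodI: "good C b k t z = L t z (I k)" for k
    unfolding good_def I_def[abs_def] zt_def ..
  have CX: "x \<in> space X" if "x \<in> C" for x using that C sets.sets_into_space by blast
  have IF: "I k x \<le> (rho * F k) * (indicator C x * L b zt (indicator C) x)"
    "(indicator C x * L b zt (indicator C) x) * F k \<le> rho * I k x" for k x
  proof -
    have "L b zt (indicator C) x * F k \<le> rho * L b zt (\<lambda>y. indicator C y * p (k - (t + b)) (\<lambda>i. z (i + (t + b))) y) x
      \<and> L b zt (\<lambda>y. indicator C y * p (k - (t + b)) (\<lambda>i. z (i + (t + b))) y) x \<le> rho * L b zt (indicator C) x * F k"
      if "x \<in> C" unfolding F_def
      using doeblin_fun[OF zt CX[OF that] C lam _ pt, of b rho k] lamD[OF that] by (simp add: zt_def)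
    then show "I k x \<le> (rho * F k) * (indicator C x * L b zt (indicator C) x)"
      "(indicator C x * L b zt (indicator C) x) * F k \<le> rho * I k x"
      by (auto simp: I_def indicator_def ac_simps)
  qed
  have up: "(\<integral>\<^sup>+ x. good C b k t z x \<partial>mu) \<le> rho * F k * A mu"
    if mu: "mu \<in> space (prob_algebra X)" for mu k
  proof -
    note mD = prob_algebra_D[OF mu]
    have "(\<integral>\<^sup>+ x. good C b k t z x \<partial>mu) \<le> (\<integral>\<^sup>+ x. (rho * F k) * G x \<partial>mu)"
    proof (rule nn_integral_mono)
      fix x assume "x \<in> space mu"
      then have x: "x \<in> space X" using mD by simp
      have "good C b k t z x \<le> L t z (\<lambda>x. (rho * F k) * (indicator C x * L b zt (indicator C) x)) x"
        unfolding goodI using x IF by (intro L_mono) auto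
      then show "good C b k t z x \<le> (rho * F k) * G x"
        unfolding G_def using L_cmult[OF inner x z] by simp
    qed
    also have "\<dots> = rho * F k * A mu"
      unfolding A_def using mD Gm by (intro nn_integral_cmult) auto
    finally show ?thesis .
  qed
  \<comment> \<open>This direction holds for every law, good or not, as it only discards
    paths.\<close>
  have low: "A mu * F k \<le> rho * pm mu k z"
    if mu: "mu \<in> space (prob_algebra X)" and k: "t + b \<le> k" for mu k
  proof -
    note mD = prob_algebra_D[OF mu]
    have "F k * A mu = (\<integral>\<^sup>+ x. F k * G x \<partial>mu)"
      unfolding A_def using mD Gm by (intro nn_integral_cmult[symmetric]) auto
    also have "\<dots> \<le> (\<integral>\<^sup>+ x. rho * p k z x \<partial>mu)"
    proof (rule nn_integral_mono)
      fix x assume "x \<in> space mu"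
      then have x: "x \<in> space X" using mD by simp
      have "F k * G x = L t z (\<lambda>x. F k * (indicator C x * L b zt (indicator C) x)) x"
        unfolding G_def using L_cmult[OF inner x z] by simp
      also have "\<dots> \<le> L t z (\<lambda>x. rho * I k x) x"
        using x IF(2)[of _ k] by (intro L_mono) (auto simp: ac_simps)
      also have "\<dots> = rho * L t z (I k) x" using L_cmult[OF Im x z] .
      also have "L t z (I k) x \<le> L t z (p (k - t) zt) x"
      proof (rule L_mono[OF _ x])
        fix y assume y: "y \<in> space X"
        have "I k y \<le> 1 * L b zt (p (k - (t + b)) (\<lambda>i. z (i + (t + b)))) y"
          unfolding I_def using y by (intro mult_mono L_mono) (auto simp: indicator_def)
        also have "\<dots> = p (k - t) zt y"
          using p_split[of b "k - t" zt y] k by (simp add: zt_def ac_simps)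
        finally show "I k y \<le> p (k - t) zt y" .
      qed
      also have "L t z (p (k - t) zt) x = p k z x"
        unfolding zt_def using p_split[of t k z x] k by simp
      finally show "F k * G x \<le> rho * p k z x" by (simp add: mult_left_mono)
    qed
    also have "\<dots> = rho * pm mu k z"
      using mD p_measurable[OF z] by (intro nn_integral_cmult) auto
    finally show ?thesis by (simp add: mult.commute)
  qed
  have half: "pm mu k z \<le> 2 * (\<integral>\<^sup>+ x. good C b k t z x \<partial>mu)"
    if mu: "mu \<in> space (prob_algebra X)" and k: "t + b \<le> k" "k \<le> n"
      and v: "\<not> pm mu k z < 2 * ((\<integral>\<^sup>+ x. vis C k t z x \<partial>mu) + (\<integral>\<^sup>+ x. vis C k (t + b) z x \<partial>mu))" for mu k
  proof (rule ennreal_half_le)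
    note mD = prob_algebra_D[OF mu]
    have "pm mu k z \<le> ennreal (exp (\<Sum>i<k. u i))"
      using k by (intro pm_le_const mu p_le_exp U) auto
    then show "pm mu k z < \<infinity>" using order_le_less_trans by fastforce
    have "pm mu k z \<le> (\<integral>\<^sup>+ x. good C b k t z x + (vis C k t z x + vis C k (t + b) z x) \<partial>mu)"
      using mD k z C by (intro nn_integral_mono p_le_good_vis) auto
    also have "\<dots> = (\<integral>\<^sup>+ x. good C b k t z x \<partial>mu) + ((\<integral>\<^sup>+ x. vis C k t z x \<partial>mu) + (\<integral>\<^sup>+ x. vis C k (t + b) z x \<partial>mu))"
      using mD(4)[OF good_measurable[OF C z, of b k t]] mD(4)[OF vis_measurable[OF C z]]
      by (simp add: nn_integral_add)
    finally show "pm mu k z \<le> \<dots>" .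
  qed (use v in \<open>simp add: not_less\<close>)
  have exp_le: "ennreal (exp (\<Sum>i\<in>J. u i)) \<le> E" if "J \<subseteq> {..<w}" for J
    unfolding E_def using that u0 by (auto intro!: sum_mono2)
  have A1E: "A mu1 \<le> E" unfolding A_def
  proof (rule pm_le_const[OF mu1])
    fix x assume x: "x \<in> space X"
    have "G x \<le> L t z (p b zt) x"
      unfolding G_def
    proof (rule L_mono[OF _ x])
      fix y assume y: "y \<in> space X"
      have "indicator C y * L b zt (indicator C) y \<le> 1 * L b zt (\<lambda>_. 1) y"
        using y by (intro mult_mono L_mono) (auto simp: indicator_def)
      then show "indicator C y * L b zt (indicator C) y \<le> p b zt y" by (simp add: plik_def)
    qed
    also have "\<dots> = p (t + b) z x" unfolding zt_def using p_split[of t "t + b" z x] by simp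
    also have "\<dots> \<le> ennreal (exp (\<Sum>i<t + b. u i))" using x tw U by (intro p_le_exp) auto
    also have "\<dots> \<le> E" using tw by (intro exp_le) auto
    finally show "G x \<le> E" .
  qed
  have FwE: "F w \<le> E"
    unfolding F_def
  proof (rule pm_le_const[OF lam])
    fix x assume x: "x \<in> space X"
    have "p (w - (t + b)) (\<lambda>i. z (i + (t + b))) x \<le> ennreal (exp (\<Sum>i<w - (t + b). u (i + (t + b))))"
      using x tw w U by (intro p_le_exp) auto
    also have "(\<Sum>i<w - (t + b). u (i + (t + b))) = (\<Sum>i\<in>{t + b..<w}. u i)"
      using sum.shift_bounds_nat_ivl[of u 0 "t + b" "w - (t + b)"] tw by (simp add: atLeast0LessThan)
    also have "ennreal (exp \<dots>) \<le> E" by (intro exp_le) auto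
    finally show "p (w - (t + b)) (\<lambda>i. z (i + (t + b))) x \<le> E" .
  qed
  \<comment> \<open>The common factor \<open>F n\<close> is kept here and traded for
    \<open>pm mu2 n z\<close> at the end; \<open>A mu1\<close> and \<open>F w\<close> are confined
    to the window and replaced by \<open>E\<close>.\<close>
  have "pm mu1 n z \<le> 2 * (rho * F n * A mu1)"
    by (rule order_trans[OF half[OF mu1 tw(2) order_refl] mult_left_mono[OF up[OF mu1]]])
      (use t in \<open>auto simp: H1_def\<close>)
  also have "\<dots> \<le> 2 * (rho * F n * E)" using A1E by (intro mult_left_mono) auto
  finally have a: "pm mu1 n z \<le> 2 * (rho * F n * E)" .
  have "pm mu2 w z \<le> 2 * (rho * F w * A mu2)"
    by (rule order_trans[OF half[OF mu2 tw(1) w] mult_left_mono[OF up[OF mu2]]])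
      (use t in \<open>auto simp: H2_def\<close>)
  also have "\<dots> \<le> 2 * (rho * E * A mu2)" using FwE by (intro mult_left_mono mult_right_mono) auto
  finally have "pm mu2 w z \<le> 2 * (rho * E * A mu2)" .
  with a have "pm mu1 n z * pm mu2 w z \<le> (2 * (rho * F n * E)) * (2 * (rho * E * A mu2))"
    by (rule mult_mono) auto
  also have "\<dots> = 4 * rho ^ 2 * E\<^sup>2 * (A mu2 * F n)"
    by (simp add: power2_eq_square ac_simps)
  also have "\<dots> \<le> 4 * rho ^ 2 * E\<^sup>2 * (rho * pm mu2 n z)"
    using low[OF mu2 tw(2)] by (intro mult_left_mono) auto
  also have "\<dots> = 4 * rho ^ 3 * E\<^sup>2 * pm mu2 n z"
    by (simp add: power2_eq_square power3_eq_cube ac_simps)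
  finally show ?thesis unfolding E_def .
qed

end

section \<open>Comparison along a stationary ergodic process\<close>

definition seg :: "(int \<Rightarrow> 'y) \<Rightarrow> nat \<Rightarrow> 'y" where
  "seg y = (\<lambda>i. y (int i))"

lemma shift_pow: "(shift ^^ n) y = (\<lambda>k. y (k + int n))"
  by (induction n arbitrary: y) (auto simp: shift_def ac_simps)

lemma seg_shift_pow: "seg ((shift ^^ t) y) = (\<lambda>i. seg y (i + t))"
  by (simp add: seg_def shift_pow)

definition doeblin_bounds ::
  "'x measure \<Rightarrow> ('x \<Rightarrow> 'x measure) \<Rightarrow> ('x \<Rightarrow> 'y \<Rightarrow> real) \<Rightarrow> nat \<Rightarrow> 'x set \<Rightarrow> real \<Rightarrow> real \<Rightarrow> (nat \<Rightarrow> 'y) \<Rightarrow> bool"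
where
  "doeblin_bounds X Q g r C q rho z \<longleftrightarrow>
     (\<forall>x\<in>space X - C. \<forall>B. (\<forall>x'\<in>space X. plik Q g r z x' \<le> B) \<longrightarrow> ennreal q * plik Q g r z x \<le> B) \<and>
     (\<exists>lam\<in>space (prob_algebra X). \<forall>x\<in>C. \<forall>A\<in>sets X.
        Lop Q g r z (indicator C) x * emeasure lam A \<le> ennreal rho * Lop Q g r z (indicator (A \<inter> C)) x \<and>
        Lop Q g r z (indicator (A \<inter> C)) x \<le> ennreal rho * Lop Q g r z (indicator C) x * emeasure lam A)"

text \<open>In the bounds, \<open>q\<close> is the inverse of the \<open>\<eta>\<close> of (A1), and \<open>L(x, C)\<close> replaces the function
  \<open>\<phi>\<close> of a local Doeblin set, which need not be measurable.\<close>

locale observed_hmm =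
  fixes \<Theta> :: "'t::metric_space set" and X :: "'x measure" and Y :: "'y measure"
    and Q :: "'t \<Rightarrow> 'x \<Rightarrow> 'x measure" and g :: "'t \<Rightarrow> 'x \<Rightarrow> 'y \<Rightarrow> real"
    and N :: "(int \<Rightarrow> 'y) measure" and r :: nat and D :: "'x set" and K :: "(nat \<Rightarrow> 'y) set"
    and u v :: "(int \<Rightarrow> 'y) \<Rightarrow> real"
  assumes kernel: "\<And>\<theta>. \<theta> \<in> \<Theta> \<Longrightarrow> hmm_kernel X Y (Q \<theta>) (g \<theta>)"
    and N_prob: "prob_space N"
    and N_sets: "sets N = sets (\<Pi>\<^sub>M k\<in>UNIV. Y)"
    and N_shift: "distr N N shift = N"
    and N_ergodic: "\<And>A. A \<in> sets N \<Longrightarrow> shift -` A \<inter> space N = A \<Longrightarrow> measure N A \<in> {0, 1}"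
    and r_pos: "0 < r"
    and D_sets: "D \<in> sets X"
    and K_sets: "{y \<in> space N. restrict (seg y) {..<r} \<in> K} \<in> sets N"
    and K_prob: "2 / 3 < measure N {y \<in> space N. restrict (seg y) {..<r} \<in> K}"
    and K_doeblin: "\<And>q. (2::real) \<le> q \<Longrightarrow> \<exists>C\<in>sets X. \<exists>rho::real. 0 \<le> rho \<and>
      (\<forall>\<theta>\<in>\<Theta>. \<forall>z\<in>space (\<Pi>\<^sub>M i\<in>UNIV. Y). restrict z {..<r} \<in> K \<longrightarrow>
        doeblin_bounds X (Q \<theta>) (g \<theta>) r C q rho z)"
    and u_int: "integrable N u" and u_nonneg: "\<And>y. 0 \<le> u y"
    and u_bound: "AE y in N. \<forall>\<theta>\<in>\<Theta>. \<forall>x\<in>space X. g \<theta> x (y 0) \<le> exp (u y)"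
    and v_int: "integrable N v" and v_nonneg: "\<And>y. 0 \<le> v y"
    and v_bound: "AE y in N. \<forall>\<theta>\<in>\<Theta>. \<forall>x\<in>D.
      ennreal (exp (- v y)) \<le> Lop (Q \<theta>) (g \<theta>) r (seg y) (indicator D) x"
begin

abbreviation p where "p \<theta> \<equiv> plik (Q \<theta>) (g \<theta>)"
abbreviation pm where "pm \<theta> mu n z \<equiv> \<integral>\<^sup>+ x. plik (Q \<theta>) (g \<theta>) n z x \<partial>mu"
abbreviation Z :: "(nat \<Rightarrow> 'y) measure" where "Z \<equiv> \<Pi>\<^sub>M i\<in>UNIV. Y"

lemma N_space: "y \<in> space N \<longleftrightarrow> (\<forall>k. y k \<in> space Y)"
  using sets_eq_imp_space_eq[OF N_sets] by (auto simp: space_PiM PiE_def Pi_def)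

lemma measurable_N: "measurable N M = measurable (\<Pi>\<^sub>M k\<in>UNIV. Y) M"
  by (rule measurable_cong_sets[OF N_sets refl])

lemma translate_measurable: "(\<lambda>y k. y (k + j)) \<in> N \<rightarrow>\<^sub>M N" for j :: int
proof -
  have "(\<lambda>y k. y (k + j)) \<in> (\<Pi>\<^sub>M k\<in>UNIV. Y) \<rightarrow>\<^sub>M (\<Pi>\<^sub>M k\<in>UNIV. Y)"
    by (intro measurable_PiM_single') (auto simp: space_PiM PiE_def Pi_def)
  then show ?thesis by (simp add: measurable_cong_sets[OF N_sets N_sets])
qed

sublocale ergodic_system N shift
proof (intro ergodic_system.intro N_prob ergodic_system_axioms.intro N_shift)
  show "shift \<in> N \<rightarrow>\<^sub>M N" using translate_measurable[of 1] by (simp add: shift_def[abs_def])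
qed (use N_ergodic in auto)

lemma seg_measurable: "seg \<in> N \<rightarrow>\<^sub>M Z"
proof -
  have "seg \<in> (\<Pi>\<^sub>M k\<in>UNIV. Y) \<rightarrow>\<^sub>M Z"
    unfolding seg_def[abs_def]
    by (intro measurable_PiM_single') (auto simp: space_PiM PiE_def Pi_def)
  then show ?thesis by (simp add: measurable_N)
qed

lemma seg_space: "y \<in> space N \<Longrightarrow> seg y \<in> space Z"
  using measurable_space[OF seg_measurable] .

lemma shift_pow_space: "y \<in> space N \<Longrightarrow> (shift ^^ n) y \<in> space N"
  by (rule T_pow_space)

text \<open>The majorants \<open>u\<close> and \<open>v\<close> are required at all times at once,
  which makes the property stable under the shift. It need not define an event and is only used
  pointwise.\<close>

definition nice :: "(int \<Rightarrow> 'y) \<Rightarrow> bool" where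
  "nice y \<longleftrightarrow> y \<in> space N \<and>
     (\<forall>t. \<forall>\<theta>\<in>\<Theta>. \<forall>x\<in>space X. g \<theta> x (seg y t) \<le> exp (u ((shift ^^ t) y))) \<and>
     (\<forall>t. \<forall>\<theta>\<in>\<Theta>. \<forall>x\<in>D. ennreal (exp (- v ((shift ^^ t) y)))
        \<le> Lop (Q \<theta>) (g \<theta>) r (seg ((shift ^^ t) y)) (indicator D) x)"

lemma AE_nice: "AE y in N. nice y"
proof -
  have "AE y in N. \<forall>t. \<forall>\<theta>\<in>\<Theta>. \<forall>x\<in>space X. g \<theta> x (seg y t) \<le> exp (u ((shift ^^ t) y))"
    unfolding AE_all_countable
  proof
    fix t
    show "AE y in N. \<forall>\<theta>\<in>\<Theta>. \<forall>x\<in>space X. g \<theta> x (seg y t) \<le> exp (u ((shift ^^ t) y))"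
      using AE_T_pow[OF u_bound, of t] by (simp add: shift_pow seg_def)
  qed
  moreover have "AE y in N. \<forall>t. \<forall>\<theta>\<in>\<Theta>. \<forall>x\<in>D. ennreal (exp (- v ((shift ^^ t) y)))
        \<le> Lop (Q \<theta>) (g \<theta>) r (seg ((shift ^^ t) y)) (indicator D) x"
    unfolding AE_all_countable by (intro allI AE_T_pow[OF v_bound])
  ultimately show ?thesis unfolding nice_def by (auto elim: AE_mp)
qed

lemma shift_shift_pow: "(shift ^^ a) ((shift ^^ b) y) = (shift ^^ (a + b)) y"
  by (simp add: funpow_add)

lemma nice_shift: "nice y \<Longrightarrow> nice ((shift ^^ t) y)"
  unfolding nice_def by (simp add: shift_pow_space shift_shift_pow) (simp add: seg_shift_pow)

lemma u_sum: "(\<Sum>i<n. u ((shift ^^ i) y)) = orbit_sum u n y"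
  by (simp add: orbit_sum_def)

lemma p_le_exp_orbit:
  assumes "nice y" "\<theta> \<in> \<Theta>" "x \<in> space X"
  shows "p \<theta> n (seg y) x \<le> ennreal (exp (orbit_sum u n y))"
  unfolding orbit_sum_def
  using assms by (intro hmm_kernel.p_le_exp[OF kernel]) (auto simp: nice_def)

text \<open>Expresses that the likelihood is not exponentially smaller than allowed:
  \<open>c\<close> is a fixed cost, and Birkhoff's theorem keeps the average of \<open>v\<close>
  bounded. A start in \<open>D\<close> is controlled at multiples of \<open>r\<close> only, hence
  the set \<open>J\<close> of lengths; the comparison window has such a length.\<close>

definition lower_bounded :: "'x measure \<Rightarrow> ((int \<Rightarrow> 'y) \<Rightarrow> real) \<Rightarrow> nat set \<Rightarrow> bool" where
  "lower_bounded mu c J \<longleftrightarrow> mu \<in> space (prob_algebra X) \<and> integrable N c \<and> (\<forall>y. 0 \<le> c y) \<and>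
     (\<forall>j\<ge>1. r * j \<in> J) \<and>
     (AE y in N. \<forall>\<theta>\<in>\<Theta>. \<forall>n\<in>J. ennreal (exp (- c y - orbit_sum v n y)) \<le> pm \<theta> mu n (seg y))"

text \<open>The role of 2/3 in (A1): by stationarity the next block misses \<open>K\<close> with
  probability below 1/3 as well, so both lie in \<open>K\<close> with probability above 1/3.\<close>

lemma K_pair_prob:
  "1 / 3 < measure N {y \<in> space N. restrict (seg y) {..<r} \<in> K \<and> restrict (seg ((shift ^^ r) y)) {..<r} \<in> K}"
proof -
  define A where "A = {y \<in> space N. restrict (seg y) {..<r} \<in> K}"
  define B where "B = (shift ^^ r) -` A \<inter> space N"
  have A: "A \<in> sets N" unfolding A_def by (rule K_sets)
  have B: "B \<in> sets N" unfolding B_def using A T_pow_measurable by (rule measurable_sets[rotated])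
  have "measure N B = measure (distr N N (shift ^^ r)) A"
    unfolding B_def using A by (simp add: measure_distr)
  then have pB: "measure N B = measure N A" by (simp add: T_pow_preserving)
  have "prob (A - B) \<le> prob (space N - B)"
    using A B sets.sets_into_space[OF A] by (intro finite_measure_mono) auto
  then have "1 / 3 < measure N (A \<inter> B)"
    using finite_measure_Diff'[OF A B] prob_compl[OF B] K_prob pB by (simp add: A_def)
  also have "A \<inter> B = {y \<in> space N. restrict (seg y) {..<r} \<in> K \<and> restrict (seg ((shift ^^ r) y)) {..<r} \<in> K}"
    unfolding A_def B_def using shift_pow_space by auto
  finally show ?thesis .
qed

text \<open>\<open>comparison\<close> for the point mass at \<open>x\<close> and for
  \<open>mu\<close>. A lower bound is assumed for \<open>mu\<close> alone: if the likelihood from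
  \<open>x\<close> is at most that of \<open>mu\<close> the claim is immediate, and otherwise it
  inherits the bound.\<close>

lemma compare_pointwise:
  assumes q: "2 \<le> (q::real)" and C: "C \<in> sets X" and rho: "0 \<le> (rho::real)"
    and K: "\<And>z. z \<in> space Z \<Longrightarrow> restrict z {..<r} \<in> K \<Longrightarrow>
        doeblin_bounds X (Q \<theta>) (g \<theta>) r C q rho z"
    and th: "\<theta> \<in> \<Theta>" and y: "nice y" and mu: "mu \<in> space (prob_algebra X)" and x: "x \<in> space X"
    and w: "w \<le> n"
    and c: "0 \<le> c" "c + orbit_sum u n y + orbit_sum v n y \<le> c0 * n"
      "c + orbit_sum u w y + orbit_sum v w y \<le> c0 * w"
    and low: "ennreal (exp (- c - orbit_sum v n y)) \<le> pm \<theta> mu n (seg y)"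
      "ennreal (exp (- c - orbit_sum v w y)) \<le> pm \<theta> mu w (seg y)"
    and m: "c0 * n \<le> m * ln q" and c0: "0 \<le> c0"
    and card: "r * (8 * (m + 1)) < card {t. t + 2 * r \<le> w \<and> restrict (seg ((shift ^^ t) y)) {..<r} \<in> K \<and>
       restrict (seg ((shift ^^ (t + r)) y)) {..<r} \<in> K}"
  shows "p \<theta> n (seg y) x \<le> ennreal (max 1 (4 * rho ^ 3 * exp (2 * c0 * w))) * pm \<theta> mu n (seg y)"
proof (cases "p \<theta> n (seg y) x \<le> pm \<theta> mu n (seg y)")
  case True
  also have "pm \<theta> mu n (seg y) = ennreal 1 * pm \<theta> mu n (seg y)" by simp
  also have "\<dots> \<le> ennreal (max 1 (4 * rho ^ 3 * exp (2 * c0 * w))) * pm \<theta> mu n (seg y)"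
    by (intro mult_right_mono ennreal_leI) auto
  finally show ?thesis .
next
  case False
  then have less: "pm \<theta> mu n (seg y) < p \<theta> n (seg y) x" by simp
  interpret H: hmm_kernel X Y "Q \<theta>" "g \<theta>" using th by (rule kernel)
  have yN: "y \<in> space N" using y by (simp add: nice_def)
  have segy: "seg y \<in> space Z" by (rule seg_space[OF yN])
  define R where "R t \<longleftrightarrow> restrict (seg ((shift ^^ t) y)) {..<r} \<in> K" for t
  define A where "A = {t. t + 2 * r \<le> w \<and> R t \<and> R (t + r)}"
  have finA: "finite A" by (rule finite_subset[of _ "{..w}"]) (auto simp: A_def)
  have cardA: "r * (8 * (m + 1)) < card A" using card by (simp add: A_def R_def)
  \<comment> \<open>Pigeonhole over the residues modulo \<open>r\<close>: start times in one class
    give blocks that do not overlap, and adding \<open>r\<close> stays in the class.\<close>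
  obtain j where j: "8 * (m + 1) < card {t \<in> A. t mod r = j}"
  proof (rule ccontr)
    assume "\<not> thesis"
    then have *: "card {t \<in> A. t mod r = j} \<le> 8 * (m + 1)" for j using that by (meson not_less)
    have "card A = card (\<Union>j<r. {t \<in> A. t mod r = j})"
      using r_pos by (intro arg_cong[where f = card]) auto
    also have "\<dots> \<le> (\<Sum>j<r. card {t \<in> A. t mod r = j})" by (rule card_UN_le) auto
    also have "\<dots> \<le> (\<Sum>j<r. 8 * (m + 1))" by (intro sum_mono *)
    finally show False using cardA by simp
  qed
  define S where "S = {t \<in> A. t mod r = j}"
  define T where "T = {t. t + r \<le> w \<and> R t \<and> t mod r = j}"
  have retx: "return X x \<in> space (prob_algebra X)"
    using x by (auto simp: space_prob_algebra prob_space_return)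
  have pmx: "pm \<theta> (return X x) n (seg y) = p \<theta> n (seg y) x"
    using x H.p_measurable[OF segy] by (rule nn_integral_return)
  \<comment> \<open>Hence \<open>q ^ m\<close> covers the ratio of the crude bound to the lower
    bound, over \<open>n\<close> observations and over the window; \<open>m\<close> becomes the
    excursion count \<open>N\<close> of \<open>comparison\<close>.\<close>
  have qm: "exp (c0 * n) \<le> q ^ m"
  proof -
    have "exp (c0 * n) \<le> exp (m * ln q)" using m by simp
    also have "\<dots> = q ^ m" using q by (simp add: exp_of_nat_mult)
    finally show ?thesis .
  qed
  have KT: "doeblin_bounds X (Q \<theta>) (g \<theta>) r C q rho (\<lambda>i. seg y (i + t))"
    if "R t" for t
  proof -
    have "(\<lambda>i. seg y (i + t)) \<in> space Z" by (rule H.Z_shift[OF segy])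
    then show ?thesis using K[of "\<lambda>i. seg y (i + t)"] that by (simp add: R_def seg_shift_pow)
  qed
  define E where "E = ennreal (exp (\<Sum>i<w. u ((shift ^^ i) y)))"
  have U: "g \<theta> x (seg y i) \<le> exp (u ((shift ^^ i) y))" if "x \<in> space X" for i x
    using y th that by (auto simp: nice_def)
  have step: "ennreal (exp (orbit_sum u k y)) \<le> ennreal (q ^ m) * P"
    if P: "ennreal (exp (- c - orbit_sum v k y)) \<le> P" and k: "k \<le> n"
      "c + orbit_sum u k y + orbit_sum v k y \<le> c0 * k" for k P
  proof -
    have "c0 * k \<le> c0 * n" using k c0 by (intro mult_left_mono) auto
    then have "exp (orbit_sum u k y) \<le> exp (c0 * n) * exp (- c - orbit_sum v k y)"
      using k by (simp add: exp_add[symmetric])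
    also have "\<dots> \<le> q ^ m * exp (- c - orbit_sum v k y)" using qm by (intro mult_right_mono) auto
    finally have "ennreal (exp (orbit_sum u k y)) \<le> ennreal (q ^ m) * ennreal (exp (- c - orbit_sum v k y))"
      using q by (simp add: ennreal_mult[symmetric] ennreal_leI)
    also have "\<dots> \<le> ennreal (q ^ m) * P" using P by (rule mult_left_mono) simp
    finally show ?thesis .
  qed
  have "pm \<theta> (return X x) n (seg y) * pm \<theta> mu w (seg y) \<le> 4 * ennreal rho ^ 3 * E\<^sup>2 * pm \<theta> mu n (seg y)"
    unfolding E_def
  proof (rule H.comparison[OF segy retx mu C r_pos w, where T = T and S = S and q = q and N = m])
    show "t + i \<notin> T" if "t \<in> T" "0 < i" "i < r" for t i
    proof
      assume "t + i \<in> T"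
      then have "(t + i) mod r = t mod r" using that by (simp add: T_def)
      then show False using that mod_eq_dvd_iff_nat[of t "t + i" r] dvd_imp_le[of r i] by auto
    qed
    show "S \<subseteq> T" "t \<in> S \<Longrightarrow> t + r \<in> T" for t by (auto simp: S_def T_def A_def)
    show "ennreal (exp (\<Sum>i<n. u ((shift ^^ i) y))) \<le> ennreal (q ^ m) * pm \<theta> (return X x) n (seg y)"
      unfolding pmx u_sum using low(1) less c w by (intro step) (auto simp: add.assoc)
    show "ennreal (exp (\<Sum>i<w. u ((shift ^^ i) y))) \<le> ennreal (q ^ m) * pm \<theta> mu w (seg y)"
      unfolding u_sum using low(2) c w by (intro step) auto
    show "ennreal q * p \<theta> r (\<lambda>i. seg y (i + t)) x \<le> ennreal (exp (\<Sum>i<r. u ((shift ^^ (i + t)) y)))"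
      if "t \<in> T" "x \<in> space X - C" for t x
    proof -
      have "p \<theta> r (\<lambda>i. seg y (i + t)) x' \<le> ennreal (exp (\<Sum>i<r. u ((shift ^^ (i + t)) y)))"
        if "x' \<in> space X" for x' using that U by (intro H.p_le_exp) auto
      then show ?thesis using KT[of t] that by (auto simp: T_def doeblin_bounds_def)
    qed
    show "\<exists>lam\<in>space (prob_algebra X). \<forall>x\<in>C. \<forall>A\<in>sets X.
          Lop (Q \<theta>) (g \<theta>) r (\<lambda>i. seg y (i + t)) (indicator C) x * emeasure lam A
            \<le> ennreal rho * Lop (Q \<theta>) (g \<theta>) r (\<lambda>i. seg y (i + t)) (indicator (A \<inter> C)) x \<and>
          Lop (Q \<theta>) (g \<theta>) r (\<lambda>i. seg y (i + t)) (indicator (A \<inter> C)) x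
            \<le> ennreal rho * Lop (Q \<theta>) (g \<theta>) r (\<lambda>i. seg y (i + t)) (indicator C) x * emeasure lam A"
      if "t \<in> S" for t using KT[of t] that by (simp add: S_def A_def doeblin_bounds_def)
  qed (use j q U u_nonneg in \<open>auto simp: S_def T_def\<close>)
  then have main: "p \<theta> n (seg y) x * pm \<theta> mu w (seg y) \<le> 4 * ennreal rho ^ 3 * E\<^sup>2 * pm \<theta> mu n (seg y)"
    by (simp only: pmx)
  \<comment> \<open>Division by the lower bound for \<open>mu\<close> over the window. As
    \<open>c\<close> and the sum of \<open>v\<close> are nonnegative, the squared crude bound
    divided by \<open>l\<close> is at most \<open>exp (2 * c0 * w)\<close>.\<close>
  define l where "l = exp (- c - orbit_sum v w y)"
  have l: "0 < l" by (simp add: l_def)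
  have "ennreal l * p \<theta> n (seg y) x \<le> p \<theta> n (seg y) x * pm \<theta> mu w (seg y)"
    using low(2) unfolding l_def by (simp add: mult.commute mult_left_mono)
  also note main
  also have "4 * ennreal rho ^ 3 * E\<^sup>2 = ennreal (4 * rho ^ 3 * (exp (orbit_sum u w y))\<^sup>2)"
    unfolding E_def u_sum using rho by (simp add: ennreal_mult ennreal_power)
  also have "\<dots> \<le> ennreal (l * (4 * rho ^ 3 * exp (2 * c0 * w)))"
  proof (intro ennreal_leI)
    have ov: "0 \<le> orbit_sum v w y" unfolding orbit_sum_def by (intro sum_nonneg v_nonneg)
    have "(exp (orbit_sum u w y))\<^sup>2 = exp (2 * orbit_sum u w y)" by (simp add: exp_double)
    also have "\<dots> \<le> exp (- c - orbit_sum v w y + 2 * c0 * w)"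
      using c ov by (simp add: algebra_simps)
    also have "\<dots> = l * exp (2 * c0 * w)" by (simp add: l_def exp_add)
    finally have "(exp (orbit_sum u w y))\<^sup>2 \<le> l * exp (2 * c0 * w)" .
    from mult_left_mono[OF this, of "4 * rho ^ 3"] rho
    show "4 * rho ^ 3 * (exp (orbit_sum u w y))\<^sup>2 \<le> l * (4 * rho ^ 3 * exp (2 * c0 * w))"
      by (simp add: ac_simps)
  qed
  finally have "ennreal l * p \<theta> n (seg y) x \<le> ennreal (l * (4 * rho ^ 3 * exp (2 * c0 * w))) * pm \<theta> mu n (seg y)"
    by (simp add: mult_right_mono)
  also have "\<dots> = ennreal l * (ennreal (4 * rho ^ 3 * exp (2 * c0 * w)) * pm \<theta> mu n (seg y))"
    using l rho by (simp add: ennreal_mult mult.assoc)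
  finally have "p \<theta> n (seg y) x \<le> ennreal (4 * rho ^ 3 * exp (2 * c0 * w)) * pm \<theta> mu n (seg y)"
    using l by (subst (asm) ennreal_mult_le_mult_iff) auto
  also have "\<dots> \<le> ennreal (max 1 (4 * rho ^ 3 * exp (2 * c0 * w))) * pm \<theta> mu n (seg y)"
    by (intro mult_right_mono ennreal_leI) auto
  finally show ?thesis .
qed

lemma orbit_count: "orbit_sum (indicator A) n y = card {t. t < n \<and> (shift ^^ t) y \<in> A}"
proof -
  have "orbit_sum (indicator A) n y = (\<Sum>t<n. if (shift ^^ t) y \<in> A then 1 else 0)"
    unfolding orbit_sum_def by (intro sum.cong) (auto simp: indicator_def)
  also have "\<dots> = card {t. t < n \<and> (shift ^^ t) y \<in> A}"
    by (subst sum.If_cases) (auto simp: Int_def lessThan_def)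
  finally show ?thesis .
qed

text \<open>\<open>G n\<close> records what \<open>compare_pointwise\<close> asks of the
  observations and depends neither on the parameter nor on the starting point. Being measurable, it
  serves both almost surely and, through its complement, as an exceptional set in integrals.\<close>

lemma compare_event:
  assumes low: "lower_bounded mu c J" and d: "0 < (\<delta>::real)"
  obtains G where "\<And>n::nat. G n \<in> sets N" "AE y in N. \<forall>\<^sub>F n in sequentially. y \<in> G n"
    "AE y in N. \<forall>n\<in>J. y \<in> G n \<longrightarrow> (\<forall>\<theta>\<in>\<Theta>. \<forall>x\<in>space X.
       p \<theta> n (seg y) x \<le> ennreal (exp (\<delta> * n)) * pm \<theta> mu n (seg y))"
proof -
  have mu: "mu \<in> space (prob_algebra X)" and cint: "integrable N c" and c0: "\<And>y. 0 \<le> c y"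
    and rJ: "\<And>j. 1 \<le> j \<Longrightarrow> r * j \<in> J"
    and lowb: "AE y in N. \<forall>\<theta>\<in>\<Theta>. \<forall>n\<in>J. ennreal (exp (- c y - orbit_sum v n y)) \<le> pm \<theta> mu n (seg y)"
    using low by (auto simp: lower_bounded_def)
  have [measurable]: "c \<in> borel_measurable N" "u \<in> borel_measurable N" "v \<in> borel_measurable N"
    using cint u_int v_int by auto
  define a where "a = (\<lambda>y. u y + v y)"
  have aint: "integrable N a" unfolding a_def using u_int v_int by auto
  have [measurable]: "a \<in> borel_measurable N" using aint by auto
  have asum: "orbit_sum a n y = orbit_sum u n y + orbit_sum v n y" for n y
    by (simp add: orbit_sum_def a_def sum.distrib)
  \<comment> \<open>One more than the mean of \<open>u + v\<close>, so that the growth bounds hold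
    eventually, with room for \<open>c\<close>.\<close>
  define c0 where "c0 = (\<integral>y. a y \<partial>N) + 1"
  have Ea: "0 \<le> (\<integral>y. a y \<partial>N)"
    unfolding a_def using u_nonneg v_nonneg by (intro integral_nonneg_AE) auto
  then have c0_ge: "1 \<le> c0" by (simp add: c0_def)
  \<comment> \<open>The first entry keeps the window inside the \<open>n\<close> observations; the
    second makes \<open>2 * c0 * w n\<close> at most \<open>\<delta> * n / 3\<close>.\<close>
  define \<kappa> where "\<kappa> = min (1 / r) (\<delta> / (6 * c0 * r))"
  have \<kappa>: "0 < \<kappa>" "r * \<kappa> \<le> 1" "4 * c0 * r * \<kappa> \<le> \<delta> * (2 / 3)" "\<kappa> \<le> 1"
  proof -
    show "0 < \<kappa>" using d c0_ge r_pos by (simp add: \<kappa>_def)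
    have "r * \<kappa> \<le> r * (1 / r)" unfolding \<kappa>_def by (intro mult_left_mono) auto
    then show 1: "r * \<kappa> \<le> 1" using r_pos by simp
    have "4 * c0 * r * \<kappa> \<le> 4 * c0 * r * (\<delta> / (6 * c0 * r))"
      unfolding \<kappa>_def using c0_ge by (intro mult_left_mono) auto
    also have "\<dots> = \<delta> * (2 / 3)" using c0_ge r_pos by (simp add: field_simps)
    finally show "4 * c0 * r * \<kappa> \<le> \<delta> * (2 / 3)" .
    have "1 / real r \<le> 1" using r_pos by simp
    then show "\<kappa> \<le> 1" by (simp add: \<kappa>_def)
  qed
  \<comment> \<open>The excursion count \<open>m\<close> becomes about
    \<open>\<kappa> * n / 128\<close>. The \<open>8 * (m + 1)\<close> times to be exceeded per
    residue are then about \<open>\<kappa> * n / 16\<close>, against at least about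
    \<open>\<kappa> * n / 3\<close> times, on average over residues, at which two consecutive blocks
    lie in \<open>K\<close>.\<close>
  define q where "q = exp (128 * c0 / \<kappa>)"
  have lnq: "ln q = 128 * c0 / \<kappa>" by (simp add: q_def)
  have q2: "2 \<le> q"
  proof -
    have "1 \<le> 128 * c0 / \<kappa>" using c0_ge \<kappa> by (simp add: field_simps)
    moreover have "1 + 128 * c0 / \<kappa> \<le> q" unfolding q_def by (rule exp_ge_add_one_self)
    ultimately show ?thesis by linarith
  qed
  obtain C rho where C: "C \<in> sets X" and rho: "0 \<le> (rho::real)" and
    Cd: "\<And>\<theta> z. \<theta> \<in> \<Theta> \<Longrightarrow> z \<in> space Z \<Longrightarrow> restrict z {..<r} \<in> K \<Longrightarrow>
        doeblin_bounds X (Q \<theta>) (g \<theta>) r C q rho z"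
    using K_doeblin[OF q2] by metis
  define w where "w n = r * nat \<lfloor>\<kappa> * real n\<rfloor>" for n :: nat
  have w_real: "real (w n) = real r * real_of_int \<lfloor>\<kappa> * n\<rfloor>" for n using \<kappa> by (simp add: w_def)
  have w_le: "w n \<le> r * \<kappa> * n" for n
    unfolding w_real using mult_left_mono[OF of_int_floor_le[of "\<kappa> * n"], of "real r"] by (simp add: mult.assoc)
  have wn: "w n \<le> n" for n
  proof -
    have "real (w n) \<le> r * \<kappa> * n" by (rule w_le)
    also have "\<dots> \<le> 1 * real n" using \<kappa> by (intro mult_right_mono) auto
    finally show ?thesis by simp
  qed
  have w_ge: "r * (\<kappa> * n - 1) \<le> w n" for n
    unfolding w_real using r_pos by (intro mult_left_mono) linarith+
  define B where "B = {y \<in> space N. restrict (seg y) {..<r} \<in> K \<and> restrict (seg ((shift ^^ r) y)) {..<r} \<in> K}"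
  have B[measurable]: "B \<in> sets N"
  proof -
    define A where "A = {y \<in> space N. restrict (seg y) {..<r} \<in> K}"
    have "A \<in> sets N" unfolding A_def by (rule K_sets)
    moreover have "B = A \<inter> ((shift ^^ r) -` A \<inter> space N)"
      unfolding A_def B_def using shift_pow_space by auto
    ultimately show ?thesis using measurable_sets[OF T_pow_measurable] by auto
  qed
  have EB: "1 / 3 < (\<integral>y. indicat_real B y \<partial>N)" using K_pair_prob by (simp add: B_def[symmetric])
  define k1 where "k1 = (indicator B :: _ \<Rightarrow> real)"
  have [measurable]: "k1 \<in> borel_measurable N" unfolding k1_def by measurable
  have k1int: "integrable N k1" unfolding k1_def by (simp add: emeasure_eq_measure)
  \<comment> \<open>The first term absorbs rounding and the blocks cut off at the end of the window,
    the second the constant \<open>4 * rho ^ 3\<close>.\<close>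
  obtain n0 :: nat where n0: "200 / \<kappa> + 3 * ln (max 1 (4 * rho ^ 3)) / \<delta> < n0"
    using reals_Archimedean2 by blast
  define M where "M = max 1 (4 * rho ^ 3)"
  have M1: "1 \<le> M" by (simp add: M_def)
  have n0': "200 < \<kappa> * n" "3 * ln M \<le> \<delta> * n" if "n0 \<le> n" for n
  proof -
    have 1: "0 \<le> ln M" using M1 by simp
    have nn: "real n0 \<le> n" using that by simp
    have k0: "0 < 1 / \<kappa>" using \<kappa> by simp
    have k1: "0 \<le> 3 * ln M / \<delta>" using 1 d by simp
    have *: "200 * (1 / \<kappa>) + 3 * ln M / \<delta> < n0" using n0 by (simp add: M_def)
    then have "200 * (1 / \<kappa>) < n" using nn k0 k1 by linarith
    then show "200 < \<kappa> * n" using \<kappa> by (simp add: field_simps)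
    have "3 * ln M / \<delta> < n" using * nn k0 k1 by linarith
    then show "3 * ln M \<le> \<delta> * n" using d by (simp add: field_simps)
  qed
  define G where "G n = {y \<in> space N. n0 \<le> n \<and> c y + orbit_sum a n y \<le> c0 * n \<and>
      c y + orbit_sum a (w n) y \<le> c0 * w n \<and> w n / 3 \<le> orbit_sum k1 (w n) y}" for n
  show ?thesis
  proof (rule that)
    show "G n \<in> sets N" for n unfolding G_def by measurable
  next
    have "filterlim (\<lambda>n. nat \<lfloor>\<kappa> * real n\<rfloor>) at_top sequentially"
    proof -
      have "filterlim (\<lambda>n. \<kappa> * real n) at_top sequentially"
        using \<kappa> by (intro filterlim_tendsto_pos_mult_at_top[OF tendsto_const] filterlim_real_sequentially) auto
      then show ?thesis
        by (intro filterlim_compose[OF filterlim_nat_sequentially] filterlim_compose[OF filterlim_floor_sequentially])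
    qed
    then have wlim: "filterlim w at_top sequentially"
    proof (rule filterlim_at_top_mono)
      show "\<forall>\<^sub>F n in sequentially. nat \<lfloor>\<kappa> * real n\<rfloor> \<le> w n"
        using r_pos by (auto simp: w_def)
    qed
    have "AE y in N. (\<lambda>n. orbit_sum a n y / n) \<longlonglongrightarrow> (\<integral>y. a y \<partial>N)" by (rule birkhoff[OF aint])
    moreover have "AE y in N. (\<lambda>n. orbit_sum k1 n y / n) \<longlonglongrightarrow> (\<integral>y. k1 y \<partial>N)" by (rule birkhoff[OF k1int])
    ultimately show "AE y in N. \<forall>\<^sub>F n in sequentially. y \<in> G n"
      using AE_space
    proof eventually_elim
      case (elim y)
      have "(\<lambda>n. c y / n + orbit_sum a n y / n) \<longlonglongrightarrow> 0 + (\<integral>y. a y \<partial>N)"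
        by (intro tendsto_add lim_const_over_n elim)
      then have "\<forall>\<^sub>F n in sequentially. c y / n + orbit_sum a n y / n < c0"
        by (rule order_tendstoD(2)) (simp add: c0_def)
      with eventually_gt_at_top[of 0]
      have e1: "\<forall>\<^sub>F n in sequentially. c y + orbit_sum a n y \<le> c0 * n"
        by eventually_elim (simp add: field_simps)
      have "\<forall>\<^sub>F n in sequentially. 1 / 3 < orbit_sum k1 n y / n"
        by (rule order_tendstoD(1)[OF elim(2)]) (use EB in \<open>simp add: k1_def\<close>)
      with eventually_gt_at_top[of 0]
      have e2: "\<forall>\<^sub>F n in sequentially. n / 3 \<le> orbit_sum k1 n y"
        by eventually_elim (simp add: field_simps)
      from e1 eventually_compose_filterlim[OF e1 wlim] eventually_compose_filterlim[OF e2 wlim]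
        eventually_ge_at_top[of n0]
      show ?case by eventually_elim (use elim(3) in \<open>simp add: G_def\<close>)
    qed
  next
    show "AE y in N. \<forall>n\<in>J. y \<in> G n \<longrightarrow> (\<forall>\<theta>\<in>\<Theta>. \<forall>x\<in>space X.
       p \<theta> n (seg y) x \<le> ennreal (exp (\<delta> * n)) * pm \<theta> mu n (seg y))"
      using lowb AE_nice
    proof eventually_elim
      case (elim y)
      show ?case
      proof (intro ballI impI)
        fix n \<theta> x assume n: "n \<in> J" and y: "y \<in> G n" and th: "\<theta> \<in> \<Theta>" and x: "x \<in> space X"
        have yG: "y \<in> space N" "n0 \<le> n" "c y + orbit_sum a n y \<le> c0 * n"
          "c y + orbit_sum a (w n) y \<le> c0 * w n" "w n / 3 \<le> orbit_sum k1 (w n) y"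
          using y by (auto simp: G_def)
        have kn: "200 < \<kappa> * n" by (rule n0'[OF yG(2)])
        have wJ: "w n \<in> J"
          unfolding w_def using kn by (intro rJ) linarith
        define m where "m = nat \<lceil>c0 * n / ln q\<rceil>"
        have lnq0: "0 < ln q" using lnq \<kappa> c0_ge by simp
        have m_ge: "c0 * n \<le> m * ln q"
        proof -
          have "c0 * n / ln q \<le> m" unfolding m_def by linarith
          then show ?thesis using lnq0 by (simp add: field_simps)
        qed
        have "0 \<le> c0 * n / ln q" using c0_ge lnq0 by simp
        then have "m \<le> c0 * n / ln q + 1" unfolding m_def by linarith
        also have "c0 * n / ln q = \<kappa> * n / 128" using c0_ge \<kappa> by (simp add: lnq)
        finally have m_le: "m \<le> \<kappa> * n / 128 + 1" .
        have card: "r * (8 * (m + 1)) < card {t. t + 2 * r \<le> w n \<and> restrict (seg ((shift ^^ t) y)) {..<r} \<in> K \<and>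
           restrict (seg ((shift ^^ (t + r)) y)) {..<r} \<in> K}" (is "_ < card ?A")
        proof -
          \<comment> \<open>Pairs of blocks that reach beyond the window start at one of its last
            \<open>2 * r\<close> times.\<close>
          have A: "{t. t < w n \<and> (shift ^^ t) y \<in> B} \<subseteq> ?A \<union> {w n - 2 * r..<w n}"
            by (auto simp: B_def shift_shift_pow add.commute)
          have finA: "finite ?A" by (rule finite_subset[of _ "{..w n}"]) auto
          have "card {t. t < w n \<and> (shift ^^ t) y \<in> B} \<le> card (?A \<union> {w n - 2 * r..<w n})"
            by (rule card_mono[OF _ A]) (use finA in simp)
          also have "\<dots> \<le> card ?A + card {w n - 2 * r..<w n}" by (rule card_Un_le)
          also have "\<dots> \<le> card ?A + 2 * r" by simp
          finally have "orbit_sum k1 (w n) y \<le> card ?A + 2 * real r"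
            unfolding k1_def orbit_count by linarith
          with yG have cA: "w n / 3 - 2 * real r \<le> card ?A" by linarith
          have "8 * (real m + 1) < (s - 1) / 3 - 2" if "real m \<le> s / 128 + 1" "200 < s" for s :: real
            using that by (simp add: field_simps)
          from this[OF m_le kn] have "8 * (real m + 1) < (\<kappa> * n - 1) / 3 - 2" .
          then have "r * (8 * (real m + 1)) < r * ((\<kappa> * n - 1) / 3 - 2)"
            using r_pos by (intro mult_strict_left_mono) auto
          also have "\<dots> = r * (\<kappa> * n - 1) / 3 - 2 * r" by (simp add: field_simps)
          also have "\<dots> \<le> w n / 3 - 2 * r" using w_ge[of n] by simp
          finally have "real r * (8 * (real m + 1)) < real (w n) / 3 - 2 * real r" by simp
          with cA have "real r * (8 * (real m + 1)) < real (card ?A)" by linarith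
          then have "real (r * (8 * (m + 1))) < real (card ?A)" by (simp add: add.commute)
          then show ?thesis by (simp only: of_nat_less_iff)
        qed
        have "p \<theta> n (seg y) x \<le> ennreal (max 1 (4 * rho ^ 3 * exp (2 * c0 * w n))) * pm \<theta> mu n (seg y)"
        proof (rule compare_pointwise[OF q2 C rho _ th elim(2) mu x wn, where c = "c y" and m = m])
          show "c y + orbit_sum u n y + orbit_sum v n y \<le> c0 * n"
            "c y + orbit_sum u (w n) y + orbit_sum v (w n) y \<le> c0 * w n"
            using yG by (simp_all add: asum)
          show "ennreal (exp (- c y - orbit_sum v n y)) \<le> pm \<theta> mu n (seg y)"
            "ennreal (exp (- c y - orbit_sum v (w n) y)) \<le> pm \<theta> mu (w n) (seg y)"
            using elim(1) th n wJ by auto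
        qed (use Cd[OF th] c0 c0_ge card m_ge in auto)
        also have "\<dots> \<le> ennreal (exp (\<delta> * n)) * pm \<theta> mu n (seg y)"
        proof (intro mult_right_mono ennreal_leI)
          have "2 * c0 * w n \<le> 2 * c0 * (r * \<kappa> * n)"
            using c0_ge w_le by (intro mult_left_mono) auto
          also have "\<dots> = (4 * c0 * r * \<kappa>) * n / 2" by simp
          also have "\<dots> \<le> (\<delta> * (2 / 3)) * n / 2" using \<kappa> by (intro divide_right_mono mult_right_mono) auto
          finally have e: "2 * c0 * w n \<le> \<delta> * n / 3" by simp
          have "max 1 (4 * rho ^ 3 * exp (2 * c0 * w n)) \<le> M * exp (2 * c0 * w n)"
          proof (rule max.boundedI)
            have "1 * 1 \<le> M * exp (2 * c0 * w n)" using M1 c0_ge by (intro mult_mono) auto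
            then show "1 \<le> M * exp (2 * c0 * w n)" by simp
          qed (auto simp: M_def)
          also have "\<dots> = exp (ln M + 2 * c0 * w n)" using M1 by (simp add: exp_add)
          also have "\<dots> \<le> exp (\<delta> * n)"
          proof -
            have "0 \<le> \<delta> * n" using d by simp
            then show ?thesis using e n0'(2)[OF yG(2)] by simp
          qed
          finally show "max 1 (4 * rho ^ 3 * exp (2 * c0 * w n)) \<le> exp (\<delta> * n)" .
        qed simp
        finally show "p \<theta> n (seg y) x \<le> ennreal (exp (\<delta> * n)) * pm \<theta> mu n (seg y)" .
      qed
    qed
  qed
qed

end

section \<open>Lower bound for the normalised log-likelihood\<close>

context hmm_kernel
begin

lemma pm_add_le:
  assumes mu: "mu \<in> space (prob_algebra X)" and z: "z \<in> space Z"
    and B: "\<And>x. x \<in> space X \<Longrightarrow> p n (\<lambda>i. z (i + k)) x \<le> B"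
  shows "pm mu (k + n) z \<le> B * pm mu k z"
proof -
  note mD = prob_algebra_D[OF mu]
  have "pm mu (k + n) z \<le> (\<integral>\<^sup>+ x. B * p k z x \<partial>mu)"
  proof (rule nn_integral_mono)
    fix x assume "x \<in> space mu"
    then have x: "x \<in> space X" using mD by simp
    have "p (k + n) z x = L k z (p n (\<lambda>i. z (i + k))) x" using p_split[of k "k + n" z x] by simp
    also have "\<dots> \<le> B * p k z x" using B x z by (rule L_le_sup)
    finally show "p (k + n) z x \<le> B * p k z x" .
  qed
  also have "\<dots> = B * pm mu k z"
    using mD p_measurable[OF z] by (intro nn_integral_cmult) auto
  finally show ?thesis .
qed

lemma pm_0: "mu \<in> space (prob_algebra X) \<Longrightarrow> pm mu 0 z = 1"
  using prob_algebra_D[of mu] prob_space.emeasure_space_1[of mu] by simp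

end

text \<open>\<open>f\<close> stands for the limit density as a function of two-sided sequences. In
  \<open>f_lim\<close> the \<open>Suc m\<close> observations run from time \<open>- m\<close> to 0,
  and the \<open>m\<close> observations stop at time -1.\<close>

locale hmm_contrast = observed_hmm +
  fixes chi :: "'b measure" and c :: "(int \<Rightarrow> 'c) \<Rightarrow> real" and f :: "'a \<Rightarrow> (int \<Rightarrow> 'c) \<Rightarrow> real"
  assumes chi_low: "lower_bounded chi c {1..}"
    and f_measurable: "\<And>\<theta>. \<theta> \<in> \<Theta> \<Longrightarrow> f \<theta> \<in> borel_measurable N"
    and f_pos: "\<And>\<theta>. \<theta> \<in> \<Theta> \<Longrightarrow> AE y in N. 0 < f \<theta> y"
    and f_int: "\<And>\<theta>. \<theta> \<in> \<Theta> \<Longrightarrow> integrable N (\<lambda>y. ln (f \<theta> y))"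
    and f_lim: "\<And>\<theta>. \<theta> \<in> \<Theta> \<Longrightarrow> AE y in N.
      (\<lambda>m. pm \<theta> chi (Suc m) (\<lambda>i. y (int i - int m)) / pm \<theta> chi m (\<lambda>i. y (int i - int m)))
        \<longlonglongrightarrow> ennreal (f \<theta> y)"
begin

text \<open>Unlike powers of \<open>shift\<close>, translations by negative integers move the first
  observation into the past.\<close>

definition tr :: "int \<Rightarrow> (int \<Rightarrow> 'c) \<Rightarrow> int \<Rightarrow> 'c" where
  "tr j y = (\<lambda>k. y (k + j))"

definition ll :: "'a \<Rightarrow> nat \<Rightarrow> (int \<Rightarrow> 'c) \<Rightarrow> real" where
  "ll \<theta> n y = ln (enn2real (pm \<theta> chi n (seg y)))"

definition ell :: "'a \<Rightarrow> real" where
  "ell \<theta> = (\<integral>y. ln (f \<theta> y) \<partial>N)"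

lemma tr_measurable: "tr j \<in> N \<rightarrow>\<^sub>M N"
  using translate_measurable[of j] by (simp add: tr_def[abs_def])

lemma tr_pow: "tr (int n) = shift ^^ n"
  by (rule ext) (simp add: shift_pow tr_def)

lemma tr_preserving: "distr N N (tr j) = N"
proof (cases "0 \<le> j")
  case True
  then show ?thesis using T_pow_preserving[of "nat j"] tr_pow[of "nat j"] by simp
next
  case False
  define n where "n = nat (- j)"
  have j: "j = - int n" using False by (simp add: n_def)
  \<comment> \<open>The law is rewritten as its own image under \<open>shift ^^ n\<close>, which
    \<open>tr j\<close> undoes.\<close>
  have "distr N N (tr j) = distr (distr N N (shift ^^ n)) N (tr j)" by (simp add: T_pow_preserving)
  also have "\<dots> = distr N N (tr j \<circ> (shift ^^ n))"
    by (rule distr_distr[OF tr_measurable T_pow_measurable])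
  also have "tr j \<circ> (shift ^^ n) = (\<lambda>y. y)"
    by (simp add: fun_eq_iff tr_def shift_pow j)
  finally show ?thesis by (simp add: distr_id)
qed

lemma AE_tr:
  assumes "AE y in N. R y"
  shows "AE y in N. R (tr j y)"
  by (rule AE_distrD[OF tr_measurable[of j]]) (subst tr_preserving, rule assms)

lemma integral_tr:
  fixes h :: "(int \<Rightarrow> 'c) \<Rightarrow> real"
  assumes "h \<in> borel_measurable N"
  shows "(\<integral>y. h (tr j y) \<partial>N) = (\<integral>y. h y \<partial>N)"
  using integral_distr[OF tr_measurable[of j], of h] assms by (simp add: tr_preserving)

lemma integrable_tr:
  fixes h :: "(int \<Rightarrow> 'c) \<Rightarrow> real"
  assumes "integrable N h"
  shows "integrable N (\<lambda>y. h (tr j y))"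
  using assms integrable_distr[OF tr_measurable[of j], of h] by (simp add: tr_preserving)

lemma chi: "chi \<in> space (prob_algebra X)"
  and c_int: "integrable N c" and c_nonneg: "0 \<le> c y"
  using chi_low by (auto simp: lower_bounded_def)

definition low_nice :: "(int \<Rightarrow> 'c) \<Rightarrow> bool" where
  "low_nice y \<longleftrightarrow> nice y \<and>
    (\<forall>\<theta>\<in>\<Theta>. \<forall>n\<ge>1. ennreal (exp (- c y - orbit_sum v n y)) \<le> pm \<theta> chi n (seg y))"

lemma AE_low_nice: "AE y in N. low_nice y"
proof -
  have "AE y in N. \<forall>\<theta>\<in>\<Theta>. \<forall>n\<in>{1..}. ennreal (exp (- c y - orbit_sum v n y)) \<le> pm \<theta> chi n (seg y)"
    using chi_low by (simp add: lower_bounded_def)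
  then show ?thesis using AE_nice by eventually_elim (auto simp: low_nice_def)
qed

lemma AE_low_nice_tr: "AE y in N. \<forall>j. low_nice (tr j y)"
  unfolding AE_all_countable by (intro allI AE_tr AE_low_nice)

lemma ll_measurable:
  assumes "\<theta> \<in> \<Theta>"
  shows "ll \<theta> n \<in> borel_measurable N"
proof -
  interpret H: hmm_kernel X Y "Q \<theta>" "g \<theta>" using assms by (rule kernel)
  have "(\<lambda>z. pm \<theta> chi n z) \<in> borel_measurable Z"
    unfolding plik_def by (rule H.p_integral_measurable[OF chi]) auto
  from measurable_compose[OF seg_measurable this]
  have [measurable]: "(\<lambda>y. pm \<theta> chi n (seg y)) \<in> borel_measurable N" .
  show ?thesis unfolding ll_def[abs_def] by measurable
qed

lemma ll_bounds:
  assumes y: "low_nice y" and th: "\<theta> \<in> \<Theta>"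
  shows "pm \<theta> chi n (seg y) = ennreal (exp (ll \<theta> n y))"
    and "ll \<theta> n y \<le> orbit_sum u n y"
    and "- c y - orbit_sum v n y \<le> ll \<theta> n y"
proof -
  interpret H: hmm_kernel X Y "Q \<theta>" "g \<theta>" using th by (rule kernel)
  have up: "pm \<theta> chi n (seg y) \<le> ennreal (exp (orbit_sum u n y))"
    using y th by (intro H.pm_le_const chi p_le_exp_orbit) (auto simp: low_nice_def)
  have low: "ennreal (exp (- c y - orbit_sum v n y)) \<le> pm \<theta> chi n (seg y)"
  \<comment> \<open>The bounds for \<open>chi\<close> begin with one observation; the empty
    likelihood is 1.\<close>
  proof (cases "n = 0")
    case True
    then show ?thesis using H.pm_0[OF chi] c_nonneg[of y] by (simp add: orbit_sum_def)
  next
    case False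
    then show ?thesis using y th by (auto simp: low_nice_def)
  qed
  obtain l where l: "pm \<theta> chi n (seg y) = ennreal l" "0 \<le> l"
    using up by (cases "pm \<theta> chi n (seg y)") (auto simp: top_unique)
  have lb: "exp (- c y - orbit_sum v n y) \<le> l" "l \<le> exp (orbit_sum u n y)"
    using low up unfolding l(1) using l(2) by auto
  have lpos: "0 < l" by (rule less_le_trans[OF exp_gt_zero lb(1)])
  have lll: "ll \<theta> n y = ln l" using l by (simp add: ll_def)
  show "pm \<theta> chi n (seg y) = ennreal (exp (ll \<theta> n y))" using l lpos by (simp add: lll)
  show "ll \<theta> n y \<le> orbit_sum u n y" "- c y - orbit_sum v n y \<le> ll \<theta> n y"
    unfolding lll using lb lpos ln_le_cancel_iff[of l "exp (orbit_sum u n y)"]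
      ln_le_cancel_iff[of "exp (- c y - orbit_sum v n y)" l] by simp_all
qed

lemma ll_integrable:
  assumes "\<theta> \<in> \<Theta>"
  shows "integrable N (ll \<theta> n)"
proof (rule Bochner_Integration.integrable_bound)
  show "integrable N (\<lambda>y. c y + orbit_sum u n y + orbit_sum v n y)"
    using c_int u_int v_int by (intro Bochner_Integration.integrable_add orbit_sum_integrable)
  show "AE y in N. norm (ll \<theta> n y) \<le> norm (c y + orbit_sum u n y + orbit_sum v n y)"
    using AE_low_nice
  proof eventually_elim
    case (elim y)
    have "0 \<le> orbit_sum u n y" "0 \<le> orbit_sum v n y"
      by (auto simp: orbit_sum_def u_nonneg v_nonneg intro: sum_nonneg)
    then show ?case using ll_bounds(2,3)[OF elim assms, of n] c_nonneg[of y] by auto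
  qed
qed (rule ll_measurable[OF assms])

text \<open>This is the logarithm of the conditional likelihood of the observation at time 0 given
  those at times \<open>- k\<close> to -1, with \<open>chi\<close> as the law at time
  \<open>- k\<close>.\<close>

definition incr :: "'a \<Rightarrow> nat \<Rightarrow> (int \<Rightarrow> 'c) \<Rightarrow> real" where
  "incr \<theta> k y = ll \<theta> (Suc k) (tr (- int k) y) - ll \<theta> k (tr (- int k) y)"

lemma incr_lim:
  assumes th: "\<theta> \<in> \<Theta>"
  shows "AE y in N. (\<lambda>k. incr \<theta> k y) \<longlonglongrightarrow> ln (f \<theta> y)"
  using f_lim[OF th] AE_low_nice_tr f_pos[OF th]
proof eventually_elim
  case (elim y)
  have "pm \<theta> chi (Suc m) (\<lambda>i. y (int i - int m)) / pm \<theta> chi m (\<lambda>i. y (int i - int m))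
      = ennreal (exp (incr \<theta> m y))" for m
  proof -
    have s: "(\<lambda>i. y (int i - int m)) = seg (tr (- int m) y)" by (simp add: seg_def tr_def)
    have "low_nice (tr (- int m) y)" using elim by blast
    from ll_bounds(1)[OF this th] show ?thesis
      unfolding s incr_def by (simp add: divide_ennreal exp_diff)
  qed
  then have "(\<lambda>m. ennreal (exp (incr \<theta> m y))) \<longlonglongrightarrow> ennreal (f \<theta> y)" using elim by simp
  then have "(\<lambda>m. exp (incr \<theta> m y)) \<longlonglongrightarrow> f \<theta> y"
    using elim by (subst (asm) tendsto_ennreal_iff) auto
  then have "(\<lambda>m. ln (exp (incr \<theta> m y))) \<longlonglongrightarrow> ln (f \<theta> y)"
    using elim by (intro tendsto_ln) auto
  then show ?case by simp
qed

text \<open>The filter at time 0 is a probability measure on the hidden states, so the product of the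
  one-step conditional densities never exceeds the supremum of the likelihood over starting points.\<close>

lemma orbit_sum_ln_f_le:
  assumes th: "\<theta> \<in> \<Theta>"
  shows "AE y in N. \<forall>n b. (\<forall>x\<in>space X. p \<theta> n (seg y) x \<le> ennreal (exp b)) \<longrightarrow>
    orbit_sum (\<lambda>y. ln (f \<theta> y)) n y \<le> b"
proof -
  interpret H: hmm_kernel X Y "Q \<theta>" "g \<theta>" using th by (rule kernel)
  have "AE y in N. \<forall>j::nat. (\<lambda>k. incr \<theta> k ((shift ^^ j) y)) \<longlonglongrightarrow> ln (f \<theta> ((shift ^^ j) y))"
    unfolding AE_all_countable by (intro allI AE_T_pow incr_lim th)
  then show ?thesis using AE_low_nice_tr
  proof eventually_elim
    case (elim y)
    show ?case
    proof (intro allI impI)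
      fix n b assume B: "\<forall>x\<in>space X. p \<theta> n (seg y) x \<le> ennreal (exp b)"
      \<comment> \<open>The past of length \<open>k + j\<close> seen from time \<open>j\<close>
        always begins at time \<open>- k\<close>, so the conditional densities telescope to a ratio
        of likelihoods.\<close>
      have tele: "(\<Sum>j<m. incr \<theta> (k + j) ((shift ^^ j) y))
          = ll \<theta> (k + m) (tr (- int k) y) - ll \<theta> k (tr (- int k) y)" for m k
      proof -
        have "incr \<theta> (k + j) ((shift ^^ j) y) =
            ll \<theta> (Suc (k + j)) (tr (- int k) y) - ll \<theta> (k + j) (tr (- int k) y)" for j
        proof -
          have "tr (- int (k + j)) ((shift ^^ j) y) = tr (- int k) y"
            by (simp add: tr_def shift_pow)
          then show ?thesis by (simp add: incr_def)
        qed
        then show ?thesis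
          using sum_lessThan_telescope[of "\<lambda>j. ll \<theta> (k + j) (tr (- int k) y)" m] by simp
      qed
      have "(\<Sum>j<n. incr \<theta> (k + j) ((shift ^^ j) y)) \<le> b" for k
      proof -
        define s where "s = tr (- int k) y"
        have s: "low_nice s" using elim unfolding s_def by blast
        then have sN: "seg s \<in> space Z" by (auto simp: low_nice_def nice_def seg_space)
        have ss: "(\<lambda>i. seg s (i + k)) = seg y" by (simp add: s_def seg_def tr_def)
        have "pm \<theta> chi (k + n) (seg s) \<le> ennreal (exp b) * pm \<theta> chi k (seg s)"
          by (rule H.pm_add_le[OF chi sN]) (use B ss in auto)
        then have "exp (ll \<theta> (k + n) s) \<le> exp b * exp (ll \<theta> k s)"
          by (simp add: ll_bounds(1)[OF s th] ennreal_mult[symmetric])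
        then have "exp (ll \<theta> (k + n) s) \<le> exp (b + ll \<theta> k s)" by (simp add: exp_add)
        then show ?thesis unfolding tele s_def by simp
      qed
      moreover have "(\<lambda>k. \<Sum>j<n. incr \<theta> (k + j) ((shift ^^ j) y)) \<longlonglongrightarrow> (\<Sum>j<n. ln (f \<theta> ((shift ^^ j) y)))"
        using elim(1) by (intro tendsto_sum LIMSEQ_ignore_initial_segment) blast
      ultimately show "orbit_sum (\<lambda>y. ln (f \<theta> y)) n y \<le> b"
        unfolding orbit_sum_def by (intro LIMSEQ_le_const2) auto
    qed
  qed
qed

text \<open>Half of \<delta> pays for passing from the supremum over starting points to
  \<open>chi\<close>, the other half for Birkhoff's theorem.\<close>

lemma lower_rate:
  assumes th: "\<theta> \<in> \<Theta>" and d: "0 < \<delta>"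
  shows "AE y in N. \<forall>\<^sub>F n in sequentially. n * (ell \<theta> - \<delta>) \<le> ll \<theta> n y"
proof -
  obtain G where G: "\<And>n::nat. G n \<in> sets N" "AE y in N. \<forall>\<^sub>F n in sequentially. y \<in> G n"
    "AE y in N. \<forall>n\<in>{1..}. y \<in> G n \<longrightarrow> (\<forall>\<theta>\<in>\<Theta>. \<forall>x\<in>space X.
       p \<theta> n (seg y) x \<le> ennreal (exp (\<delta> / 2 * n)) * pm \<theta> chi n (seg y))"
    using compare_event[OF chi_low, of "\<delta> / 2"] d by auto
  have "AE y in N. (\<lambda>n. orbit_sum (\<lambda>y. ln (f \<theta> y)) n y / n) \<longlonglongrightarrow> ell \<theta>"
    unfolding ell_def by (rule birkhoff[OF f_int[OF th]])
  then show ?thesis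
    using G(2,3) AE_low_nice orbit_sum_ln_f_le[OF th]
  proof eventually_elim
    case (elim y)
    have "\<forall>\<^sub>F n in sequentially. ell \<theta> - \<delta> / 2 < orbit_sum (\<lambda>y. ln (f \<theta> y)) n y / n"
      using elim(1) d by (intro order_tendstoD(1)) auto
    then show ?case using elim(2) eventually_gt_at_top[of 0]
    proof eventually_elim
      case (elim n)
      have "p \<theta> n (seg y) x \<le> ennreal (exp (\<delta> / 2 * n + ll \<theta> n y))" if "x \<in> space X" for x
      proof -
        have "p \<theta> n (seg y) x \<le> ennreal (exp (\<delta> / 2 * n)) * pm \<theta> chi n (seg y)"
          using \<open>\<forall>n\<in>{1..}. _ n\<close> elim th that by auto
        also have "\<dots> = ennreal (exp (\<delta> / 2 * n + ll \<theta> n y))"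
          using ll_bounds(1)[OF \<open>low_nice y\<close> th] by (simp add: exp_add ennreal_mult)
        finally show ?thesis .
      qed
      then have "orbit_sum (\<lambda>y. ln (f \<theta> y)) n y \<le> \<delta> / 2 * n + ll \<theta> n y"
        using \<open>\<forall>n b. _ n b\<close> by blast
      then show ?case using elim by (simp add: field_simps)
    qed
  qed
qed

text \<open>An integrable upper bound uniform in \<open>k\<close>, which makes Fatou's lemma
  applicable to \<open>u - incr\<close>.\<close>

lemma incr_le_u:
  assumes th: "\<theta> \<in> \<Theta>" and y: "\<forall>j. low_nice (tr j y)"
  shows "incr \<theta> k y \<le> u y"
proof -
  interpret H: hmm_kernel X Y "Q \<theta>" "g \<theta>" using th by (rule kernel)
  define s where "s = tr (- int k) y"
  have s: "low_nice s" using y unfolding s_def by blast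
  then have sN: "seg s \<in> space Z" by (auto simp: low_nice_def nice_def seg_space)
  have ss: "(\<lambda>i. seg s (i + k)) = seg y" by (simp add: s_def seg_def tr_def)
  have "low_nice (tr 0 y)" using y by blast
  then have "nice y" by (simp add: low_nice_def tr_def)
  then have "p \<theta> 1 (seg y) x \<le> ennreal (exp (u y))" if "x \<in> space X" for x
    using p_le_exp_orbit[of y \<theta> x 1] th that by (simp add: orbit_sum_def)
  then have "pm \<theta> chi (k + 1) (seg s) \<le> ennreal (exp (u y)) * pm \<theta> chi k (seg s)"
    by (intro H.pm_add_le[OF chi sN]) (use ss in auto)
  then have "exp (ll \<theta> (Suc k) s) \<le> exp (u y) * exp (ll \<theta> k s)"
    by (simp add: ll_bounds(1)[OF s th] ennreal_mult[symmetric])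
  then have "exp (ll \<theta> (Suc k) s) \<le> exp (u y + ll \<theta> k s)" by (simp add: exp_add)
  then show ?thesis by (simp add: incr_def s_def)
qed

section \<open>Growth rate of the mean log-likelihood\<close>

definition mean_ll :: "'a \<Rightarrow> nat \<Rightarrow> real" where
  "mean_ll \<theta> n = (\<integral>y. ll \<theta> n y \<partial>N)"

text \<open>By stationarity the increment of the mean log-likelihood is the mean of
  \<open>incr\<close>. With the upper bound \<open>u\<close> alone, Fatou's lemma takes the place of
  dominated convergence and gives one inequality.\<close>

lemma mean_ll_increment:
  assumes th: "\<theta> \<in> \<Theta>" and d: "0 < \<delta>"
  shows "\<forall>\<^sub>F k in sequentially. mean_ll \<theta> (Suc k) - mean_ll \<theta> k \<le> ell \<theta> + \<delta>"
proof -
  have iint: "integrable N (incr \<theta> k)" for k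
    unfolding incr_def[abs_def] using th
    by (intro Bochner_Integration.integrable_diff integrable_tr ll_integrable)
  have mean: "(\<integral>y. incr \<theta> k y \<partial>N) = mean_ll \<theta> (Suc k) - mean_ll \<theta> k" for k
    unfolding incr_def mean_ll_def using th
    by (subst Bochner_Integration.integral_diff)
      (auto intro!: integrable_tr ll_integrable simp: integral_tr ll_measurable)
  have le: "AE y in N. \<forall>k. incr \<theta> k y \<le> u y"
    using AE_low_nice_tr by eventually_elim (use th incr_le_u in blast)
  have [measurable]: "incr \<theta> k \<in> borel_measurable N" for k using iint by auto
  have [measurable]: "u \<in> borel_measurable N" using u_int by auto
  have fm[measurable]: "f \<theta> \<in> borel_measurable N" using th by (rule f_measurable)
  have lefu: "AE y in N. ln (f \<theta> y) \<le> u y"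
    using le incr_lim[OF th] by eventually_elim (rule LIMSEQ_le_const2, auto)
  have "ennreal ((\<integral>y. u y \<partial>N) - ell \<theta>) = (\<integral>\<^sup>+ y. ennreal (u y - ln (f \<theta> y)) \<partial>N)"
    unfolding ell_def using u_int f_int[OF th] lefu
    by (subst nn_integral_eq_integral) auto
  also have "\<dots> = (\<integral>\<^sup>+ y. liminf (\<lambda>k. ennreal (u y - incr \<theta> k y)) \<partial>N)"
  proof (rule nn_integral_cong_AE)
    show "AE y in N. ennreal (u y - ln (f \<theta> y)) = liminf (\<lambda>k. ennreal (u y - incr \<theta> k y))"
      using incr_lim[OF th]
    proof eventually_elim
      case (elim y)
      have "(\<lambda>k. ennreal (u y - incr \<theta> k y)) \<longlonglongrightarrow> ennreal (u y - ln (f \<theta> y))"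
        by (intro tendsto_ennrealI tendsto_diff tendsto_const elim)
      then show ?case by (simp add: lim_imp_Liminf)
    qed
  qed
  also have "\<dots> \<le> liminf (\<lambda>k. \<integral>\<^sup>+ y. ennreal (u y - incr \<theta> k y) \<partial>N)"
    by (rule nn_integral_liminf) measurable
  also have "(\<lambda>k. \<integral>\<^sup>+ y. ennreal (u y - incr \<theta> k y) \<partial>N) = (\<lambda>k. ennreal ((\<integral>y. u y \<partial>N) - (mean_ll \<theta> (Suc k) - mean_ll \<theta> k)))"
  proof
    fix k
    show "(\<integral>\<^sup>+ y. ennreal (u y - incr \<theta> k y) \<partial>N) = ennreal ((\<integral>y. u y \<partial>N) - (mean_ll \<theta> (Suc k) - mean_ll \<theta> k))"
      using u_int iint[of k] le mean[of k] by (subst nn_integral_eq_integral) auto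
  qed
  finally have li: "ennreal ((\<integral>y. u y \<partial>N) - ell \<theta>) \<le> liminf (\<lambda>k. ennreal ((\<integral>y. u y \<partial>N) - (mean_ll \<theta> (Suc k) - mean_ll \<theta> k)))" .
  show ?thesis
  \<comment> \<open>\<open>ennreal\<close> sends negative numbers to 0, so the lower limit is
    informative only for a nonnegative bound; in the other case \<open>incr \<le> u\<close>
    suffices.\<close>
  proof (cases "(\<integral>y. u y \<partial>N) - ell \<theta> - \<delta> < 0")
    case True
    have "mean_ll \<theta> (Suc k) - mean_ll \<theta> k \<le> (\<integral>y. u y \<partial>N)" for k
      unfolding mean[symmetric] using iint u_int le by (intro integral_mono_AE) auto
    then show ?thesis using True by (intro always_eventually allI) (smt (verit))
  next
    case False
    then have "ennreal ((\<integral>y. u y \<partial>N) - ell \<theta> - \<delta>) < ennreal ((\<integral>y. u y \<partial>N) - ell \<theta>)"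
      using d by (intro ennreal_lessI) auto
    also note li
    finally have "\<forall>\<^sub>F k in sequentially. ennreal ((\<integral>y. u y \<partial>N) - ell \<theta> - \<delta>)
        < ennreal ((\<integral>y. u y \<partial>N) - (mean_ll \<theta> (Suc k) - mean_ll \<theta> k))" by (rule less_LiminfD)
    then show ?thesis
      by eventually_elim (use False in \<open>simp add: ennreal_less_iff\<close>)
  qed
qed

lemma mean_ll_rate:
  assumes th: "\<theta> \<in> \<Theta>" and d: "0 < \<delta>"
  shows "\<forall>\<^sub>F n in sequentially. mean_ll \<theta> n \<le> n * (ell \<theta> + \<delta>)"
proof -
  have d2: "0 < \<delta> / 2" using d by simp
  obtain k0 where k0: "\<And>k. k0 \<le> k \<Longrightarrow> mean_ll \<theta> (Suc k) - mean_ll \<theta> k \<le> ell \<theta> + \<delta> / 2"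
    using mean_ll_increment[OF th d2] unfolding eventually_sequentially by blast
  have lin: "mean_ll \<theta> (k0 + j) \<le> mean_ll \<theta> k0 + j * (ell \<theta> + \<delta> / 2)" for j
  proof (induction j)
    case (Suc j)
    have "real (Suc j) * (ell \<theta> + \<delta> / 2) = j * (ell \<theta> + \<delta> / 2) + (ell \<theta> + \<delta> / 2)"
      by (simp add: distrib_right)
    then show ?case using Suc k0[of "k0 + j"] by simp
  qed simp
  have "\<forall>\<^sub>F n in sequentially. (mean_ll \<theta> k0 - k0 * (ell \<theta> + \<delta> / 2)) / real n < \<delta> / 2"
    by (rule order_tendstoD(2)[OF lim_const_over_n]) (use d in simp)
  then show ?thesis using eventually_gt_at_top[of 0] eventually_ge_at_top[of k0]
  proof eventually_elim
    case (elim n)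
    have "mean_ll \<theta> n \<le> mean_ll \<theta> k0 + (real n - real k0) * (ell \<theta> + \<delta> / 2)"
      using lin[of "n - k0"] elim by (simp add: of_nat_diff)
    moreover have "mean_ll \<theta> k0 - k0 * (ell \<theta> + \<delta> / 2) < n * (\<delta> / 2)" using elim by (simp add: field_simps)
    ultimately show ?case by (simp add: algebra_simps add_divide_distrib diff_divide_distrib)
  qed
qed

end

section \<open>Upper bound for the normalised log-likelihood\<close>

lemma mean_limit_shifted:
  fixes S :: "nat \<Rightarrow> real"
  assumes S: "(\<lambda>n. S n / n) \<longlonglongrightarrow> e" and h: "\<And>n. n \<le> h n + C" "\<And>n. h n \<le> n + C"
  shows "(\<lambda>n. S (h n) / n) \<longlonglongrightarrow> e"
proof -
  have hlim: "filterlim h at_top sequentially"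
  proof -
    have "filterlim (\<lambda>n. n - C) at_top sequentially" by (rule filterlim_minus_const_nat_at_top)
    then show ?thesis by (rule filterlim_at_top_mono) (use h in \<open>auto simp: le_diff_conv\<close>)
  qed
  have ratio: "(\<lambda>n. real (h n) / n) \<longlonglongrightarrow> 1"
  proof (rule real_tendsto_sandwich)
    show "(\<lambda>n. 1 - C / real n) \<longlonglongrightarrow> 1" "(\<lambda>n. 1 + C / real n) \<longlonglongrightarrow> 1"
      using tendsto_diff[OF tendsto_const[of 1] lim_const_over_n[of C]]
        tendsto_add[OF tendsto_const[of 1] lim_const_over_n[of C]] by simp_all
    show "\<forall>\<^sub>F n in sequentially. 1 - C / real n \<le> real (h n) / n"
      using eventually_gt_at_top[of 0]
    proof eventually_elim
      case (elim n)
      have "real n \<le> real (h n) + C" using h(1)[of n] by linarith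
      then have "(real n - real C) / n \<le> real (h n) / n" by (intro divide_right_mono) auto
      then show ?case using elim by (simp add: diff_divide_distrib)
    qed
    show "\<forall>\<^sub>F n in sequentially. real (h n) / n \<le> 1 + C / real n"
      using eventually_gt_at_top[of 0]
    proof eventually_elim
      case (elim n)
      have "real (h n) \<le> real n + C" using h(2)[of n] by linarith
      then have "real (h n) / n \<le> (real n + real C) / n" by (intro divide_right_mono) auto
      then show ?case using elim by (simp add: add_divide_distrib)
    qed
  qed
  have "(\<lambda>n. S (h n) / h n * (h n / n)) \<longlonglongrightarrow> e * 1"
    by (intro tendsto_mult ratio filterlim_compose[OF S hlim])
  moreover have "\<forall>\<^sub>F n in sequentially. S (h n) / h n * (h n / n) = S (h n) / n"
    using filterlim_at_top[THEN iffD1, OF hlim, rule_format, of 1] by eventually_elim simp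
  ultimately have "(\<lambda>n. S (h n) / n) \<longlonglongrightarrow> e * 1" by (rule Lim_transform_eventually)
  then show ?thesis by simp
qed

text \<open>The union of finite nets at the scales \<open>1 / Suc n\<close>. Suprema over a
  countable set of parameters are measurable, and continuity extends bounds from a dense
  set.\<close>

lemma compact_countable_dense:
  fixes S :: "'a::metric_space set"
  assumes "compact S"
  obtains D where "countable D" "D \<subseteq> S" "\<And>x e. x \<in> S \<Longrightarrow> 0 < e \<Longrightarrow> \<exists>d\<in>D. dist d x < e"
proof -
  have "\<exists>k. finite k \<and> k \<subseteq> S \<and> S \<subseteq> (\<Union>x\<in>k. ball x (1 / Suc n))" for n :: nat
  proof -
    have "S \<subseteq> (\<Union>x\<in>S. ball x (1 / Suc n))" by auto
    then obtain k where "k \<subseteq> S" "finite k" "S \<subseteq> (\<Union>x\<in>k. ball x (1 / Suc n))"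
      using compactE_image[OF assms, of S "\<lambda>x. ball x (1 / Suc n)"] by auto
    then show ?thesis by blast
  qed
  then obtain k where k: "\<And>n. finite (k n)" "\<And>n. k n \<subseteq> S" "\<And>n. S \<subseteq> (\<Union>x\<in>k n. ball x (1 / Suc n))"
    by metis
  show ?thesis
  proof (rule that[of "\<Union>n. k n"])
    show "countable (\<Union>n. k n)" by (rule countable_UN) (simp_all add: countable_finite k(1))
    show "(\<Union>n. k n) \<subseteq> S" using k(2) by blast
    fix x e assume x: "x \<in> S" "0 < (e::real)"
    obtain n where n: "1 / Suc n < e" using nat_approx_posE[OF x(2)] by blast
    have "x \<in> (\<Union>d\<in>k n. ball d (1 / Suc n))" using k(3) x(1) by blast
    then obtain d where "d \<in> k n" "dist d x < 1 / Suc n" by auto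
    then show "\<exists>d\<in>\<Union>n. k n. dist d x < e" using n by (intro bexI[of _ d]) auto
  qed
qed

context hmm_kernel
begin

text \<open>Among the \<open>m\<close> ways of cutting \<open>n\<close> observations into blocks of length \<open>m\<close>, some offset has a
  block sum not above the average over all offsets.\<close>

lemma p_le_average:
  assumes z: "z \<in> space Z" and m: "0 < m" "m \<le> n"
    and U: "\<And>i x. i < n \<Longrightarrow> x \<in> space X \<Longrightarrow> g x (z i) \<le> exp (u i)" and u0: "\<And>i. 0 \<le> u i"
    and B: "\<And>t x. x \<in> space X \<Longrightarrow> p m (\<lambda>i. z (i + t)) x \<le> ennreal (exp (B t))"
    and x: "x \<in> space X"
  shows "p n z x \<le> ennreal (exp ((\<Sum>t<n - m + 1. B t) / m + (\<Sum>i<m. u i) + (\<Sum>i\<in>{n - m..<n}. u i)))"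
proof -
  define T where "T j = {t. t < n - m + 1 \<and> t mod m = j}" for j
  have finT: "finite (T j)" for j by (simp add: T_def)
  have "(\<Sum>j<m. \<Sum>t\<in>T j. B t) = (\<Sum>t<n - m + 1. B t)"
  proof -
    have "(\<Sum>j<m. \<Sum>t\<in>{t \<in> {..<n - m + 1}. t mod m = j}. B t) = (\<Sum>t<n - m + 1. B t)"
      using m by (intro sum.group) auto
    then show ?thesis by (simp add: T_def)
  qed
  moreover have "\<exists>j<m. (\<Sum>t\<in>T j. B t) \<le> (\<Sum>j<m. \<Sum>t\<in>T j. B t) / m"
  proof (rule ccontr)
    assume "\<not> ?thesis"
    then have "(\<Sum>i<m. (\<Sum>j<m. \<Sum>t\<in>T j. B t) / m) < (\<Sum>j<m. \<Sum>t\<in>T j. B t)"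
      using m by (intro sum_strict_mono) (auto simp: not_le)
    then show False using m by simp
  qed
  ultimately obtain j where j: "j < m" "(\<Sum>t\<in>T j. B t) \<le> (\<Sum>t<n - m + 1. B t) / m" by auto
  have "p n z x \<le> ennreal (exp ((\<Sum>t\<in>T j. B t) + (\<Sum>i\<in>uncovered (T j) m 0 n. u i)))"
  proof (rule p_le_block_exp[OF z m(1) _ _ U B x])
    show "t + m \<le> n" if "t \<in> T j" for t using that m by (auto simp: T_def)
    show "t + i \<notin> T j" if "t \<in> T j" "0 < i" "i < m" for t i
    proof
      assume "t + i \<in> T j"
      then have "(t + i) mod m = t mod m" using that by (simp add: T_def)
      then show False using that mod_eq_dvd_iff_nat[of t "t + i" m] dvd_imp_le[of m i] by auto
    qed
  qed
  also have "\<dots> \<le> ennreal (exp ((\<Sum>t<n - m + 1. B t) / m + (\<Sum>i<m. u i) + (\<Sum>i\<in>{n - m..<n}. u i)))"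
  proof -
    \<comment> \<open>Whatever the offset, only times among the first \<open>m\<close> and the last
      \<open>m\<close> can escape the blocks.\<close>
    have unc: "uncovered (T j) m 0 n \<subseteq> {..<m} \<union> {n - m..<n}"
    proof
      fix i assume i: "i \<in> uncovered (T j) m 0 n"
      show "i \<in> {..<m} \<union> {n - m..<n}"
      proof (rule ccontr)
        assume ni: "i \<notin> {..<m} \<union> {n - m..<n}"
        have "i < n" using i by (auto simp: uncovered_def)
        then have im: "m \<le> i" "i < n - m" using ni by auto
        \<comment> \<open>The last time up to \<open>i\<close> congruent to \<open>j\<close> modulo
          \<open>m\<close>, that is, the start of the block containing \<open>i\<close>.\<close>
        define t where "t = i - ((i - j) mod m)"
        have jm: "(i - j) mod m < m" "(i - j) mod m \<le> i - j" using m by auto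
        then have ti: "t \<le> i" "i < t + m" using im by (auto simp: t_def)
        have "t = j + (i - j) div m * m"
          unfolding t_def using im j jm div_mult_mod_eq[of "i - j" m] by linarith
        then have "t mod m = j" using j by simp
        then have "t \<in> T j" using ti im by (simp add: T_def)
        then show False using i ti by (auto simp: uncovered_def)
      qed
    qed
    have "(\<Sum>i\<in>uncovered (T j) m 0 n. u i) \<le> (\<Sum>i\<in>{..<m} \<union> {n - m..<n}. u i)"
      using unc u0 by (intro sum_mono2) auto
    also have "\<dots> \<le> (\<Sum>i<m. u i) + (\<Sum>i\<in>{n - m..<n}. u i)"
      using u0 by (subst sum_Un) (auto intro!: sum_nonneg)
    finally show ?thesis using j by (intro ennreal_leI) simp
  qed
  finally show ?thesis .
qed

end

section \<open>Lower bounds for likelihoods through \<open>D\<close>\<close>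

context observed_hmm
begin

text \<open>Only paths in \<open>D\<close> at all multiples of \<open>r\<close> are retained, and
  each block contributes \<open>exp (- v)\<close> at its start. Summing \<open>v\<close> over all
  times weakens the bound but turns it into an orbit sum of the shift.\<close>

lemma L_D_lower:
  assumes y: "nice y" and th: "\<theta> \<in> \<Theta>" and x: "x \<in> D"
  shows "ennreal (exp (- orbit_sum v (r * j) y)) \<le> Lop (Q \<theta>) (g \<theta>) (r * j) (seg y) (indicator D) x"
  using y x
proof (induction j arbitrary: y x)
  case 0
  then show ?case by (simp add: orbit_sum_def)
next
  case (Suc j)
  interpret H: hmm_kernel X Y "Q \<theta>" "g \<theta>" using th by (rule kernel)
  have DX: "x \<in> space X" if "x \<in> D" for x using that D_sets sets.sets_into_space by blast
  have segy: "seg y \<in> space Z" using Suc by (auto simp: nice_def seg_space)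
  define b where "b = exp (- orbit_sum v (r * j) ((shift ^^ r) y))"
  have "v y \<le> orbit_sum v r y"
    using r_pos unfolding orbit_sum_def
    by (subst sum.remove[of _ 0]) (auto intro!: sum_nonneg v_nonneg)
  then have "ennreal (exp (- orbit_sum v (r * Suc j) y)) \<le> ennreal b * ennreal (exp (- v y))"
    by (simp add: orbit_sum_add[of v r "r * j"] b_def ennreal_mult[symmetric] exp_add[symmetric])
  also have "\<dots> \<le> ennreal b * Lop (Q \<theta>) (g \<theta>) r (seg y) (indicator D) x"
  proof (rule mult_left_mono)
    have "ennreal (exp (- v ((shift ^^ 0) y))) \<le> Lop (Q \<theta>) (g \<theta>) r (seg ((shift ^^ 0) y)) (indicator D) x"
      using Suc.prems th unfolding nice_def by blast
    then show "ennreal (exp (- v y)) \<le> Lop (Q \<theta>) (g \<theta>) r (seg y) (indicator D) x" by simp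
  qed simp
  also have "\<dots> = Lop (Q \<theta>) (g \<theta>) r (seg y) (\<lambda>x. ennreal b * indicator D x) x"
    using Suc DX segy D_sets by (intro H.L_cmult[symmetric]) auto
  also have "\<dots> \<le> Lop (Q \<theta>) (g \<theta>) r (seg y)
      (Lop (Q \<theta>) (g \<theta>) (r * j) (\<lambda>i. seg y (i + r)) (indicator D)) x"
  proof (rule H.L_mono)
    fix x' assume "x' \<in> space X"
    show "ennreal b * indicator D x' \<le> Lop (Q \<theta>) (g \<theta>) (r * j) (\<lambda>i. seg y (i + r)) (indicator D) x'"
      using Suc.IH[OF nice_shift[OF Suc.prems(1), of r], of x']
      by (cases "x' \<in> D") (auto simp: b_def seg_shift_pow)
  qed (use Suc DX in auto)
  also have "\<dots> = Lop (Q \<theta>) (g \<theta>) (r * Suc j) (seg y) (indicator D) x"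
    by (simp add: H.L_comp)
  finally show ?case .
qed

lemma p_D_lower:
  assumes "nice y" "\<theta> \<in> \<Theta>" "x \<in> D"
  shows "ennreal (exp (- orbit_sum v (r * j) y)) \<le> p \<theta> (r * j) (seg y) x"
proof -
  interpret H: hmm_kernel X Y "Q \<theta>" "g \<theta>" using assms(2) by (rule kernel)
  have "x \<in> space X" using assms D_sets sets.sets_into_space by blast
  then have "Lop (Q \<theta>) (g \<theta>) (r * j) (seg y) (indicator D) x \<le> p \<theta> (r * j) (seg y) x"
    unfolding plik_def by (intro H.L_mono) (auto simp: indicator_def)
  then show ?thesis using L_D_lower[OF assms, of j] by simp
qed

lemma lower_bounded_return:
  assumes x: "x \<in> D"
  shows "lower_bounded (return X x) (\<lambda>_. 0) {r * j |j. 1 \<le> j}"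
proof -
  have xX: "x \<in> space X" using assms D_sets sets.sets_into_space by blast
  have "AE y in N. \<forall>\<theta>\<in>\<Theta>. \<forall>n\<in>{r * j |j. 1 \<le> j}.
      ennreal (exp (- 0 - orbit_sum v n y)) \<le> pm \<theta> (return X x) n (seg y)"
    using AE_nice
  proof eventually_elim
    case (elim y)
    show ?case
    proof (intro ballI)
      fix \<theta> n assume th: "\<theta> \<in> \<Theta>" and "n \<in> {r * j |j. 1 \<le> j}"
      then obtain j where n: "n = r * j" by auto
      interpret H: hmm_kernel X Y "Q \<theta>" "g \<theta>" using th by (rule kernel)
      have "seg y \<in> space Z" using elim by (simp add: nice_def seg_space)
      then have "pm \<theta> (return X x) n (seg y) = p \<theta> n (seg y) x"
        by (intro nn_integral_return xX H.p_measurable)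
      then show "ennreal (exp (- 0 - orbit_sum v n y)) \<le> pm \<theta> (return X x) n (seg y)"
        using p_D_lower[OF elim th x, of j] by (simp add: n)
    qed
  qed
  then show ?thesis
    using xX by (auto simp: lower_bounded_def space_prob_algebra prob_space_return)
qed

text \<open>Any number of observations exceeds one of \<open>1, \<dots>, r\<close> by a multiple of \<open>r\<close>.\<close>

lemma lower_bounded_reaching:
  assumes mu: "mu \<in> space (prob_algebra X)" and c: "integrable N c" "\<And>y. 0 \<le> c y"
    and low: "AE y in N. \<forall>\<theta>\<in>\<Theta>. \<forall>s\<in>{1..r}.
      ennreal (exp (- c y)) \<le> (\<integral>\<^sup>+ x. Lop (Q \<theta>) (g \<theta>) s (seg y) (indicator D) x \<partial>mu)"
  shows "lower_bounded mu c {1..}"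
proof -
  have "AE y in N. \<forall>\<theta>\<in>\<Theta>. \<forall>n\<in>{1..}. ennreal (exp (- c y - orbit_sum v n y)) \<le> pm \<theta> mu n (seg y)"
    using low AE_nice
  proof eventually_elim
    case (elim y)
    show ?case
    proof (intro ballI)
      fix \<theta> n assume th: "\<theta> \<in> \<Theta>" and n: "n \<in> {1::nat..}"
      interpret H: hmm_kernel X Y "Q \<theta>" "g \<theta>" using th by (rule kernel)
      have segy: "seg y \<in> space Z" using elim by (simp add: nice_def seg_space)
      \<comment> \<open>The remainder is taken from 1 to \<open>r\<close>, not from 0 to
        \<open>r - 1\<close>, since the bounds for \<open>mu\<close> begin with one
        observation.\<close>
      define s where "s = (n - 1) mod r + 1"
      define j where "j = (n - 1) div r"
      have s: "s \<in> {1..r}" using r_pos mod_less_divisor[of r "n - 1"] by (auto simp: s_def Suc_le_eq)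
      have nsj: "n = s + r * j"
        using n mult_div_mod_eq[of r "n - 1"] unfolding s_def j_def by auto
      define b where "b = exp (- orbit_sum v (r * j) ((shift ^^ s) y))"
      have "0 \<le> orbit_sum v s y" by (simp add: orbit_sum_def sum_nonneg v_nonneg)
      then have "ennreal (exp (- c y - orbit_sum v n y)) \<le> ennreal b * ennreal (exp (- c y))"
        by (simp add: nsj orbit_sum_add b_def ennreal_mult[symmetric] exp_add[symmetric])
      also have "\<dots> \<le> ennreal b * (\<integral>\<^sup>+ x. Lop (Q \<theta>) (g \<theta>) s (seg y) (indicator D) x \<partial>mu)"
        using elim(1) th s by (intro mult_left_mono) auto
      also have "\<dots> = (\<integral>\<^sup>+ x. ennreal b * Lop (Q \<theta>) (g \<theta>) s (seg y) (indicator D) x \<partial>mu)"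
        using D_sets segy
        by (intro nn_integral_cmult[symmetric] H.prob_algebra_D(4)[OF mu] H.L_measurable) auto
      also have "\<dots> \<le> pm \<theta> mu n (seg y)"
      proof (rule nn_integral_mono)
        fix x assume "x \<in> space mu"
        then have x: "x \<in> space X" using H.prob_algebra_D[OF mu] by simp
        have "ennreal b * Lop (Q \<theta>) (g \<theta>) s (seg y) (indicator D) x =
            Lop (Q \<theta>) (g \<theta>) s (seg y) (\<lambda>x. ennreal b * indicator D x) x"
          using x segy D_sets by (intro H.L_cmult[symmetric]) auto
        also have "\<dots> \<le> Lop (Q \<theta>) (g \<theta>) s (seg y) (p \<theta> (r * j) (\<lambda>i. seg y (i + s))) x"
        proof (rule H.L_mono[OF _ x])
          fix x' assume "x' \<in> space X"
          show "ennreal b * indicator D x' \<le> p \<theta> (r * j) (\<lambda>i. seg y (i + s)) x'"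
            using p_D_lower[OF nice_shift[OF elim(2), of s] th, of x' j]
            by (cases "x' \<in> D") (auto simp: b_def seg_shift_pow)
        qed
        also have "\<dots> = p \<theta> n (seg y) x" using H.p_split[of s n "seg y" x] by (simp add: nsj)
        finally show "ennreal b * Lop (Q \<theta>) (g \<theta>) s (seg y) (indicator D) x \<le> p \<theta> n (seg y) x" .
      qed
      finally show "ennreal (exp (- c y - orbit_sum v n y)) \<le> pm \<theta> mu n (seg y)" .
    qed
  qed
  moreover have "1 \<le> r * j" if "1 \<le> j" for j using that r_pos by (simp add: Suc_le_eq)
  ultimately show ?thesis using mu c by (auto simp: lower_bounded_def)
qed

end

section \<open>Upper rate in a neighbourhood of a fixed parameter\<close>

lemma ln_enn2real_bounds:
  assumes "ennreal (exp a) \<le> P" "P \<le> ennreal (exp b)"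
  shows "P = ennreal (exp (ln (enn2real P)))" "a \<le> ln (enn2real P)" "ln (enn2real P) \<le> b"
proof -
  obtain l where l: "P = ennreal l" "0 \<le> l"
    using assms(2) by (cases P) (auto simp: top_unique)
  have lb: "exp a \<le> l" "l \<le> exp b" using assms l by auto
  have lpos: "0 < l" by (rule less_le_trans[OF exp_gt_zero lb(1)])
  show "P = ennreal (exp (ln (enn2real P)))" using l lpos by simp
  show "a \<le> ln (enn2real P)" "ln (enn2real P) \<le> b"
    using l lpos lb ln_le_cancel_iff[of "exp a" l] ln_le_cancel_iff[of l "exp b"] by simp_all
qed

locale hmm_consistency = hmm_contrast +
  fixes P :: "'w measure" and W :: "'w \<Rightarrow> int \<Rightarrow> 'c" and x0 :: 'b and n0 :: nat
  assumes P_prob: "prob_space P"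
    and W_measurable: "W \<in> P \<rightarrow>\<^sub>M N" and W_law: "distr P N W = N"
    and \<Theta>_compact: "compact \<Theta>"
    and x0_D: "x0 \<in> D"
    and likelihood_continuous: "AE \<omega> in P. \<forall>n\<ge>n0. continuous_on \<Theta> (\<lambda>\<theta>. p \<theta> n (seg (W \<omega>)) x0)"
begin

lemma AE_W:
  assumes "AE y in N. R y"
  shows "AE \<omega> in P. R (W \<omega>)"
  by (rule AE_distrD[OF W_measurable]) (subst W_law, rule assms)

lemma integral_W:
  fixes h :: "(int \<Rightarrow> 'c) \<Rightarrow> real"
  assumes "h \<in> borel_measurable N"
  shows "(\<integral>\<omega>. h (W \<omega>) \<partial>P) = (\<integral>y. h y \<partial>N)"
  using integral_distr[OF W_measurable, of h] assms by (simp add: W_law)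

lemma integrable_W:
  fixes h :: "(int \<Rightarrow> 'c) \<Rightarrow> real"
  assumes "integrable N h"
  shows "integrable P (\<lambda>\<omega>. h (W \<omega>))"
  using assms integrable_distr[OF W_measurable, of h] by (simp add: W_law)

text \<open>The lengths at which the likelihood from \<open>x0\<close> has a lower bound, so that
  its logarithm is integrable.\<close>

definition J0 :: "nat set" where
  "J0 = {r * j |j. 1 \<le> j}"

definition lx :: "'a \<Rightarrow> nat \<Rightarrow> (int \<Rightarrow> 'c) \<Rightarrow> real" where
  "lx \<theta> n y = ln (enn2real (p \<theta> n (seg y) x0))"

lemma J0_pos: "m \<in> J0 \<Longrightarrow> 0 < m"
  using r_pos by (auto simp: J0_def)

lemma J0_unbounded: "\<exists>m\<in>J0. k \<le> m"
proof
  show "r * Suc k \<in> J0" unfolding J0_def by force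
  have "1 * k \<le> r * Suc k" using r_pos by (intro mult_le_mono) auto
  then show "k \<le> r * Suc k" by simp
qed

lemma x0_X: "x0 \<in> space X"
  using x0_D D_sets sets.sets_into_space by blast

lemma px0_measurable:
  assumes "\<theta> \<in> \<Theta>"
  shows "(\<lambda>y. p \<theta> n (seg y) x0) \<in> borel_measurable N"
proof -
  interpret H: hmm_kernel X Y "Q \<theta>" "g \<theta>" using assms by (rule kernel)
  have 1: "(\<lambda>w. p \<theta> n (fst w) (snd w)) \<in> borel_measurable (Z \<Otimes>\<^sub>M X)"
    unfolding plik_def by (rule H.L_measurable_pair) simp
  have 2: "(\<lambda>z. p \<theta> n z x0) \<in> borel_measurable Z"
    using measurable_compose[OF measurable_Pair2'[OF x0_X] 1] by simp
  show ?thesis by (rule measurable_compose[OF seg_measurable 2])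
qed

lemma orbit_u_nonneg: "0 \<le> orbit_sum u n y" and orbit_v_nonneg: "0 \<le> orbit_sum v n y"
  by (auto simp: orbit_sum_def intro!: sum_nonneg u_nonneg v_nonneg)

lemma px0_bounds:
  assumes y: "nice y" and th: "\<theta> \<in> \<Theta>" and n: "n \<in> J0"
  shows "ennreal (exp (- orbit_sum v n y)) \<le> p \<theta> n (seg y) x0"
    and "p \<theta> n (seg y) x0 \<le> ennreal (exp (orbit_sum u n y))"
  using n p_D_lower[OF y th x0_D] p_le_exp_orbit[OF y th x0_X] by (auto simp: J0_def)

lemma lx_bounds:
  assumes y: "nice y" and th: "\<theta> \<in> \<Theta>" and n: "n \<in> J0"
  shows "p \<theta> n (seg y) x0 = ennreal (exp (lx \<theta> n y))"
    "- orbit_sum v n y \<le> lx \<theta> n y" "lx \<theta> n y \<le> orbit_sum u n y"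
  unfolding lx_def using ln_enn2real_bounds[OF px0_bounds[OF assms]] by auto

lemma integrable_between:
  assumes "h \<in> borel_measurable N" "AE y in N. - orbit_sum v n y \<le> h y \<and> h y \<le> orbit_sum u n y"
  shows "integrable N h"
proof (rule Bochner_Integration.integrable_bound)
  show "integrable N (\<lambda>y. orbit_sum u n y + orbit_sum v n y)"
    using u_int v_int by (intro Bochner_Integration.integrable_add orbit_sum_integrable)
  show "AE y in N. norm (h y) \<le> norm (orbit_sum u n y + orbit_sum v n y)"
    using assms(2)
  proof eventually_elim
    case (elim y)
    then show ?case using orbit_u_nonneg[of n y] orbit_v_nonneg[of n y] by auto
  qed
qed fact

lemma lx_measurable: "\<theta> \<in> \<Theta> \<Longrightarrow> lx \<theta> n \<in> borel_measurable N"
  unfolding lx_def[abs_def] using px0_measurable by measurable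

lemma lx_integrable:
  assumes "\<theta> \<in> \<Theta>" "n \<in> J0"
  shows "integrable N (lx \<theta> n)"
proof (rule integrable_between[of _ n])
  show "AE y in N. - orbit_sum v n y \<le> lx \<theta> n y \<and> lx \<theta> n y \<le> orbit_sum u n y"
    using AE_nice by eventually_elim (use lx_bounds assms in blast)
qed (rule lx_measurable[OF assms(1)])

text \<open>Outside \<open>G n\<close> only the crude bounds by orbit sums remain; by uniform
  integrability their mean there is of smaller order than \<open>n\<close>.\<close>

lemma bad_event_mean:
  assumes G: "\<And>n::nat. G n \<in> sets N" "AE y in N. \<forall>\<^sub>F n in sequentially. y \<in> G n" and d: "0 < (\<delta>::real)"
  shows "\<forall>\<^sub>F n in sequentially.
    (\<integral>y. indicator (space N - G n) y * orbit_sum (\<lambda>y. u y + v y) n y \<partial>N) \<le> \<delta> * n"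
proof -
  have "(\<lambda>n. (\<integral>y. indicator (space N - G n) y * orbit_sum (\<lambda>y. u y + v y) n y \<partial>N) / n) \<longlonglongrightarrow> 0"
  proof (rule orbit_sum_vanishing_events)
    show "AE y in N. \<forall>\<^sub>F n in sequentially. y \<notin> space N - G n"
      using G(2) by eventually_elim (auto elim: eventually_mono)
  qed (use u_int v_int u_nonneg v_nonneg G(1) in auto)
  then have "\<forall>\<^sub>F n in sequentially.
      (\<integral>y. indicator (space N - G n) y * orbit_sum (\<lambda>y. u y + v y) n y \<partial>N) / n < \<delta>"
    using d by (intro order_tendstoD(2)) auto
  then show ?thesis using eventually_gt_at_top[of 0]
    by eventually_elim (simp add: field_simps)
qed

lemma orbit_sum_uv: "orbit_sum (\<lambda>y. u y + v y) n y = orbit_sum u n y + orbit_sum v n y"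
  by (simp add: orbit_sum_def sum.distrib)

lemma bad_integrable:
  assumes "A \<in> sets N"
  shows "integrable N (\<lambda>y. indicator A y * orbit_sum (\<lambda>y. u y + v y) n y)"
  using orbit_sum_integrable[of "\<lambda>y. u y + v y" n] assms u_int v_int
  by (auto intro!: integrable_mult_indicator[where 'b = real, simplified])

text \<open>Transfers the mean rate from \<open>chi\<close> to the point \<open>x0\<close>: on
  \<open>G n\<close> by comparison, elsewhere by the crude bounds, where \<open>c\<close> enters
  through the lower bound for \<open>ll\<close>.\<close>

lemma mean_lx_rate:
  assumes th: "\<theta> \<in> \<Theta>" and d: "0 < \<delta>"
  shows "\<forall>\<^sub>F n in sequentially. n \<in> J0 \<longrightarrow> (\<integral>y. lx \<theta> n y \<partial>N) \<le> n * (ell \<theta> + \<delta>)"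
proof -
  have d4: "0 < \<delta> / 4" using d by simp
  obtain G where G: "\<And>n::nat. G n \<in> sets N" "AE y in N. \<forall>\<^sub>F n in sequentially. y \<in> G n"
    "AE y in N. \<forall>n\<in>{1..}. y \<in> G n \<longrightarrow> (\<forall>\<theta>\<in>\<Theta>. \<forall>x\<in>space X.
       p \<theta> n (seg y) x \<le> ennreal (exp (\<delta> / 4 * n)) * pm \<theta> chi n (seg y))"
    using compare_event[OF chi_low d4] by auto
  have "\<forall>\<^sub>F n in sequentially. (\<integral>y. c y \<partial>N) / real n < \<delta> / 4"
    by (rule order_tendstoD(2)[OF lim_const_over_n d4])
  then show ?thesis
    using bad_event_mean[OF G(1,2) d4] mean_ll_rate[OF th d4] eventually_gt_at_top[of 0]
  proof eventually_elim
    case (elim n)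
    let ?A = "space N - G n"
    have A: "?A \<in> sets N" using G(1) by auto
    show ?case
    proof
      assume n: "n \<in> J0"
      have "AE y in N. lx \<theta> n y \<le> ll \<theta> n y + \<delta> / 4 * n +
          indicator ?A y * orbit_sum (\<lambda>y. u y + v y) n y + c y"
        using AE_low_nice G(3) AE_space
      proof eventually_elim
        case (elim y)
        then have ny: "nice y" by (simp add: low_nice_def)
        show ?case
        proof (cases "y \<in> G n")
          case True
          have "p \<theta> n (seg y) x0 \<le> ennreal (exp (\<delta> / 4 * n)) * pm \<theta> chi n (seg y)"
            using elim(2) True th x0_X J0_pos[OF n] by auto
          then have "exp (lx \<theta> n y) \<le> exp (\<delta> / 4 * n + ll \<theta> n y)"
            unfolding lx_bounds(1)[OF ny th n] ll_bounds(1)[OF elim(1) th]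
            by (simp add: ennreal_mult[symmetric] exp_add)
          then show ?thesis using True c_nonneg[of y] by simp
        next
          case False
          then have "indicator ?A y = (1::real)" using elim by simp
          moreover have "0 \<le> \<delta> / 4 * n" using d by simp
          ultimately show ?thesis
            using lx_bounds(3)[OF ny th n] ll_bounds(3)[OF elim(1) th, of n]
            unfolding orbit_sum_uv by simp
        qed
      qed
      then have "(\<integral>y. lx \<theta> n y \<partial>N) \<le> (\<integral>y. ll \<theta> n y + \<delta> / 4 * n +
          indicator ?A y * orbit_sum (\<lambda>y. u y + v y) n y + c y \<partial>N)"
        using lx_integrable[OF th n] ll_integrable[OF th] bad_integrable[OF A] c_int
        by (intro integral_mono_AE) auto
      also have "\<dots> = mean_ll \<theta> n + \<delta> / 4 * n +
          (\<integral>y. indicator ?A y * orbit_sum (\<lambda>y. u y + v y) n y \<partial>N) + (\<integral>y. c y \<partial>N)"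
        unfolding mean_ll_def using ll_integrable[OF th, of n] bad_integrable[OF A, of n] c_int
        by (simp add: prob_space)
      also have "\<dots> \<le> n * (ell \<theta> + \<delta> / 4) + \<delta> / 4 * n + \<delta> / 4 * n + \<delta> / 4 * n"
        using elim by (intro add_mono) (auto simp: field_simps)
      also have "\<dots> = n * (ell \<theta> + \<delta>)" by (simp add: field_simps)
      finally show "(\<integral>y. lx \<theta> n y \<partial>N) \<le> n * (ell \<theta> + \<delta>)" .
    qed
  qed
qed

text \<open>Continuity of the likelihood is only available along \<open>\<omega>\<close>, for observations starting at time
  0, and the set on which it holds need not be an event of the observation process; it is therefore
  used under \<open>P\<close> and never for shifted observations.\<close>

lemma sup_shrink:
  assumes th0: "\<theta>0 \<in> \<Theta>" and m: "m \<in> J0" "n0 \<le> m" and d: "0 < \<delta>"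
    and D0: "countable D0" "D0 \<subseteq> \<Theta>" "\<theta>0 \<in> D0"
  obtains e h where "0 < e" "h \<in> borel_measurable N"
    "(\<integral>y. h y \<partial>N) \<le> (\<integral>y. lx \<theta>0 m y \<partial>N) + \<delta>"
    "AE y in N. (\<forall>\<theta>\<in>D0 \<inter> ball \<theta>0 e. p \<theta> m (seg y) x0 \<le> ennreal (exp (h y))) \<and>
      - orbit_sum v m y \<le> h y \<and> h y \<le> orbit_sum u m y"
proof -
  \<comment> \<open>Countability of \<open>D0\<close> makes the supremum measurable, and its element
    \<open>\<theta>0\<close> supplies the lower bound for the supremum.\<close>
  define B where "B k = D0 \<inter> ball \<theta>0 (1 / Suc k)" for k
  have B: "\<theta>0 \<in> B k" "B k \<subseteq> \<Theta>" "countable (B k)" for k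
    using D0 by (auto simp: B_def countable_Int1)
  define SB where "SB k y = (SUP \<theta>\<in>B k. p \<theta> m (seg y) x0)" for k y
  define h where "h k y = ln (enn2real (SB k y))" for k y
  have SBm[measurable]: "SB k \<in> borel_measurable N" for k
    unfolding SB_def[abs_def] using B by (intro borel_measurable_SUP px0_measurable) auto
  have hm: "h k \<in> borel_measurable N" for k
    unfolding h_def[abs_def] by measurable
  have le: "p \<theta> m (seg y) x0 \<le> SB k y" if "\<theta> \<in> B k" for \<theta> y k
    unfolding SB_def using that by (rule SUP_upper)
  have SBb: "ennreal (exp (- orbit_sum v m y)) \<le> SB k y" "SB k y \<le> ennreal (exp (orbit_sum u m y))"
    if "nice y" for y k
  proof -
    show "ennreal (exp (- orbit_sum v m y)) \<le> SB k y"
      by (rule order_trans[OF px0_bounds(1)[OF that th0 m(1)] le[OF B(1)]])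
    show "SB k y \<le> ennreal (exp (orbit_sum u m y))"
      unfolding SB_def using px0_bounds(2)[OF that _ m(1)] B(2) by (intro SUP_least) blast
  qed
  have hb: "SB k y = ennreal (exp (h k y))" "- orbit_sum v m y \<le> h k y" "h k y \<le> orbit_sum u m y"
    if "nice y" for y k
    unfolding h_def using ln_enn2real_bounds[OF SBb[OF that]] by auto
  have hint: "integrable N (h k)" for k
  proof (rule integrable_between[OF hm])
    show "AE y in N. - orbit_sum v m y \<le> h k y \<and> h k y \<le> orbit_sum u m y"
      using AE_nice by eventually_elim (intro conjI hb)
  qed
  have "(\<lambda>k. \<integral>\<omega>. h k (W \<omega>) \<partial>P) \<longlonglongrightarrow> (\<integral>\<omega>. lx \<theta>0 m (W \<omega>) \<partial>P)"
  proof (rule integral_dominated_convergence[where w = "\<lambda>\<omega>. orbit_sum u m (W \<omega>) + orbit_sum v m (W \<omega>)"])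
    show "(\<lambda>\<omega>. lx \<theta>0 m (W \<omega>)) \<in> borel_measurable P"
      using measurable_compose[OF W_measurable lx_measurable[OF th0]] .
    show "(\<lambda>\<omega>. h k (W \<omega>)) \<in> borel_measurable P" for k
      using measurable_compose[OF W_measurable hm] .
    show "integrable P (\<lambda>\<omega>. orbit_sum u m (W \<omega>) + orbit_sum v m (W \<omega>))"
      using u_int v_int by (intro Bochner_Integration.integrable_add integrable_W orbit_sum_integrable)
    show "AE \<omega> in P. norm (h k (W \<omega>)) \<le> orbit_sum u m (W \<omega>) + orbit_sum v m (W \<omega>)" for k
      using AE_W[OF AE_nice]
    proof eventually_elim
      case (elim \<omega>)
      show ?case using hb(2,3)[OF elim, of k] orbit_u_nonneg[of m "W \<omega>"] orbit_v_nonneg[of m "W \<omega>"]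
        by auto
    qed
    show "AE \<omega> in P. (\<lambda>k. h k (W \<omega>)) \<longlonglongrightarrow> lx \<theta>0 m (W \<omega>)"
      using AE_W[OF AE_nice] likelihood_continuous
    proof eventually_elim
      case (elim \<omega>)
      define q where "q \<theta> = p \<theta> m (seg (W \<omega>)) x0" for \<theta>
      have cont: "continuous_on \<Theta> q" unfolding q_def using elim(2) m by blast
      have q0: "q \<theta>0 = ennreal (exp (lx \<theta>0 m (W \<omega>)))"
        unfolding q_def by (rule lx_bounds(1)[OF elim(1) th0 m(1)])
      have "(\<lambda>k. SB k (W \<omega>)) \<longlonglongrightarrow> q \<theta>0"
      proof (rule order_tendstoI)
        fix a assume a: "a < q \<theta>0"
        have "a < SB k (W \<omega>)" for k
          using a le[OF B(1), of "W \<omega>" k] unfolding q_def by (rule less_le_trans)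
        then show "\<forall>\<^sub>F k in sequentially. a < SB k (W \<omega>)" by simp
      next
        fix a assume "q \<theta>0 < a"
        then obtain b where b: "q \<theta>0 < b" "b < a" using dense by blast
        have "(q \<longlongrightarrow> q \<theta>0) (at \<theta>0 within \<Theta>)" using cont th0 by (simp add: continuous_on_def)
        then have "\<forall>\<^sub>F \<theta> in at \<theta>0 within \<Theta>. q \<theta> < b" using b by (intro order_tendstoD(2)) auto
        then obtain e where e: "0 < e" "\<And>\<theta>. \<theta> \<in> \<Theta> \<Longrightarrow> \<theta> \<noteq> \<theta>0 \<Longrightarrow> dist \<theta> \<theta>0 < e \<Longrightarrow> q \<theta> < b"
          by (auto simp: eventually_at)
        obtain k0 where k0: "1 / Suc k0 < e" using nat_approx_posE[OF e(1)] by blast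
        show "\<forall>\<^sub>F k in sequentially. SB k (W \<omega>) < a"
          using eventually_ge_at_top[of k0]
        proof eventually_elim
          case (elim k)
          have "1 / Suc k \<le> 1 / Suc k0" using elim by (simp add: frac_le)
          then have "q \<theta> \<le> b" if "\<theta> \<in> B k" for \<theta>
            using that e(2)[of \<theta>] k0 b D0 by (cases "\<theta> = \<theta>0") (auto simp: B_def dist_commute)
          then have "SB k (W \<omega>) \<le> b" unfolding SB_def q_def by (intro SUP_least) auto
          then show ?case using b by simp
        qed
      qed
      then have "(\<lambda>k. enn2real (SB k (W \<omega>))) \<longlonglongrightarrow> exp (lx \<theta>0 m (W \<omega>))"
        unfolding q0 by (intro tendsto_enn2real) auto
      then have "(\<lambda>k. ln (enn2real (SB k (W \<omega>)))) \<longlonglongrightarrow> ln (exp (lx \<theta>0 m (W \<omega>)))"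
        by (intro tendsto_ln) auto
      then show ?case by (simp add: h_def)
    qed
  qed
  \<comment> \<open>The integrands are measurable functions of \<open>W\<close>, so their integrals
    pass from \<open>P\<close> to \<open>N\<close> while the set of continuity does not have
    to.\<close>
  then have "(\<lambda>k. \<integral>y. h k y \<partial>N) \<longlonglongrightarrow> (\<integral>y. lx \<theta>0 m y \<partial>N)"
    using hm lx_measurable[OF th0] by (simp add: integral_W)
  then have "\<forall>\<^sub>F k in sequentially. (\<integral>y. h k y \<partial>N) < (\<integral>y. lx \<theta>0 m y \<partial>N) + \<delta>"
    using d by (intro order_tendstoD(2)) auto
  then obtain k where k: "(\<integral>y. h k y \<partial>N) < (\<integral>y. lx \<theta>0 m y \<partial>N) + \<delta>"
    by (meson eventually_happens' sequentially_bot)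
  show ?thesis
  proof (rule that[of "1 / Suc k" "h k"])
    show "AE y in N. (\<forall>\<theta>\<in>D0 \<inter> ball \<theta>0 (1 / Suc k). p \<theta> m (seg y) x0 \<le> ennreal (exp (h k y))) \<and>
      - orbit_sum v m y \<le> h k y \<and> h k y \<le> orbit_sum u m y"
      using AE_nice
    proof eventually_elim
      case (elim y)
      then show ?case using hb(2,3)[OF elim, of k] le[of _ k y] hb(1)[OF elim, of k]
        by (auto simp: B_def)
    qed
  qed (use k hm in auto)
qed

text \<open>A block length \<open>m\<close> at which the mean of \<open>lx\<close> is at most about
  \<open>m * ell \<theta>0\<close> is fixed first, and the neighbourhood is shrunk for this
  \<open>m\<close>. \<open>H\<close> then bounds the likelihood of an \<open>m\<close>-block over
  \<open>D0\<close> in the neighbourhood and over all starting points; \<open>p_le_average\<close>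
  and Birkhoff's theorem for \<open>H\<close> carry the rate to all large \<open>n\<close>.\<close>

lemma upper_rate_countable:
  assumes th0: "\<theta>0 \<in> \<Theta>" and d: "0 < \<delta>"
    and D0: "countable D0" "D0 \<subseteq> \<Theta>" "\<theta>0 \<in> D0"
  obtains e where "0 < e" "AE y in N. \<forall>\<^sub>F n in sequentially. \<forall>\<theta>\<in>D0 \<inter> ball \<theta>0 e. \<forall>x\<in>space X.
    p \<theta> n (seg y) x \<le> ennreal (exp (n * (ell \<theta>0 + \<delta>)))"
proof -
  \<comment> \<open>Six losses: the mean rate, the shrinking, the comparison, the exceptional event,
    Birkhoff's theorem for \<open>H\<close>, and the two ends in
    \<open>p_le_average\<close>.\<close>
  define d' where "d' = \<delta> / 6"
  have d': "0 < d'" using d by (simp add: d'_def)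
  obtain G where G: "\<And>n::nat. G n \<in> sets N" "AE y in N. \<forall>\<^sub>F n in sequentially. y \<in> G n"
    "AE y in N. \<forall>n\<in>J0. y \<in> G n \<longrightarrow> (\<forall>\<theta>\<in>\<Theta>. \<forall>x\<in>space X.
       p \<theta> n (seg y) x \<le> ennreal (exp (d' * n)) * pm \<theta> (return X x0) n (seg y))"
    using compare_event[OF lower_bounded_return[OF x0_D] d'] unfolding J0_def by auto
  have "\<forall>\<^sub>F n in sequentially. n0 \<le> n \<and> (n \<in> J0 \<longrightarrow> (\<integral>y. lx \<theta>0 n y \<partial>N) \<le> n * (ell \<theta>0 + d')) \<and>
      (\<integral>y. indicator (space N - G n) y * orbit_sum (\<lambda>y. u y + v y) n y \<partial>N) \<le> d' * n"
    using mean_lx_rate[OF th0 d'] bad_event_mean[OF G(1,2) d'] eventually_ge_at_top[of n0]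
    by eventually_elim auto
  then obtain k where k: "\<And>n. k \<le> n \<Longrightarrow> n0 \<le> n \<and> (n \<in> J0 \<longrightarrow> (\<integral>y. lx \<theta>0 n y \<partial>N) \<le> n * (ell \<theta>0 + d')) \<and>
      (\<integral>y. indicator (space N - G n) y * orbit_sum (\<lambda>y. u y + v y) n y \<partial>N) \<le> d' * n"
    unfolding eventually_sequentially by blast
  obtain m where m: "m \<in> J0" "k \<le> m" using J0_unbounded by blast
  have m0: "0 < m" using m J0_pos by blast
  define A where "A = space N - G m"
  have A[measurable]: "A \<in> sets N" using G(1) by (auto simp: A_def)
  have [measurable]: "G m \<in> sets N" by (rule G(1))
  have dm: "0 < d' * m" using d' m0 by simp
  obtain e h where e: "0 < e" and hm[measurable]: "h \<in> borel_measurable N"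
    and hint: "(\<integral>y. h y \<partial>N) \<le> (\<integral>y. lx \<theta>0 m y \<partial>N) + d' * m"
    and h: "AE y in N. (\<forall>\<theta>\<in>D0 \<inter> ball \<theta>0 e. p \<theta> m (seg y) x0 \<le> ennreal (exp (h y))) \<and>
      - orbit_sum v m y \<le> h y \<and> h y \<le> orbit_sum u m y"
    using sup_shrink[OF th0 m(1) _ dm D0] k[OF m(2)] by blast
  \<comment> \<open>The crude bound on the exceptional event, the comparison with \<open>x0\<close>
    elsewhere.\<close>
  define H where "H y = (if y \<in> A then orbit_sum u m y else h y + d' * m)" for y
  have [measurable]: "u \<in> borel_measurable N" using u_int by auto
  have Hm[measurable]: "H \<in> borel_measurable N" unfolding H_def[abs_def] by measurable
  have hi: "integrable N h"
  proof (rule integrable_between[OF hm])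
    show "AE y in N. - orbit_sum v m y \<le> h y \<and> h y \<le> orbit_sum u m y"
      using h by eventually_elim simp
  qed
  have Hb: "AE y in N. H y \<le> h y + d' * m + indicator A y * orbit_sum (\<lambda>y. u y + v y) m y \<and>
      h y \<le> H y"
    using h
  proof eventually_elim
    case (elim y)
    show ?case
    proof (cases "y \<in> A")
      case True
      then have "H y = orbit_sum u m y" "indicator A y = (1::real)" by (simp_all add: H_def)
      then show ?thesis using elim dm unfolding orbit_sum_uv by simp
    next
      case False
      then show ?thesis using dm by (simp add: H_def)
    qed
  qed
  have bi: "integrable N (\<lambda>y. indicator A y * orbit_sum (\<lambda>y. u y + v y) m y)"
    by (rule bad_integrable[OF A])
  have Hi: "integrable N H"
  proof (rule Bochner_Integration.integrable_bound)
    show "integrable N (\<lambda>y. \<bar>h y\<bar> + (d' * m + indicator A y * orbit_sum (\<lambda>y. u y + v y) m y))"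
      using hi bi by (intro Bochner_Integration.integrable_add integrable_abs) auto
    show "AE y in N. norm (H y) \<le> norm (\<bar>h y\<bar> + (d' * m + indicator A y * orbit_sum (\<lambda>y. u y + v y) m y))"
      using Hb
    proof eventually_elim
      case (elim y)
      have "0 \<le> indicator A y * orbit_sum (\<lambda>y. u y + v y) m y"
        using orbit_u_nonneg[of m y] orbit_v_nonneg[of m y] unfolding orbit_sum_uv by simp
      then show ?case using elim dm by auto
    qed
  qed simp
  have EH: "(\<integral>y. H y \<partial>N) \<le> m * (ell \<theta>0 + 4 * d')"
  proof -
    have "(\<integral>y. H y \<partial>N) \<le> (\<integral>y. h y + d' * m + indicator A y * orbit_sum (\<lambda>y. u y + v y) m y \<partial>N)"
      using Hi hi bi Hb by (intro integral_mono_AE) auto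
    also have "\<dots> = (\<integral>y. h y \<partial>N) + d' * m + (\<integral>y. indicator A y * orbit_sum (\<lambda>y. u y + v y) m y \<partial>N)"
      using hi bi by (simp add: prob_space)
    also have "\<dots> \<le> (m * (ell \<theta>0 + d') + d' * m) + d' * m + d' * m"
      using hint k[OF m(2)] m(1) unfolding A_def by (intro add_mono) auto
    finally show ?thesis by (simp add: algebra_simps)
  qed
  have blk: "AE y in N. \<forall>\<theta>\<in>D0 \<inter> ball \<theta>0 e. \<forall>x\<in>space X. p \<theta> m (seg y) x \<le> ennreal (exp (H y))"
    using h G(3) AE_nice
  proof eventually_elim
    case (elim y)
    show ?case
    proof (intro ballI)
      fix \<theta> x assume th: "\<theta> \<in> D0 \<inter> ball \<theta>0 e" and x: "x \<in> space X"
      have tT: "\<theta> \<in> \<Theta>" using th D0 by auto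
      interpret K: hmm_kernel X Y "Q \<theta>" "g \<theta>" using tT by (rule kernel)
      show "p \<theta> m (seg y) x \<le> ennreal (exp (H y))"
      proof (cases "y \<in> A")
        case True
        then show ?thesis using p_le_exp_orbit[OF elim(3) tT x, of m] by (simp add: H_def)
      next
        case False
        have yN: "y \<in> space N" using elim(3) by (simp add: nice_def)
        then have "y \<in> G m" using False by (simp add: A_def)
        then have "p \<theta> m (seg y) x \<le> ennreal (exp (d' * m)) * pm \<theta> (return X x0) m (seg y)"
          using elim(2) m(1) tT x by blast
        also have "pm \<theta> (return X x0) m (seg y) = p \<theta> m (seg y) x0"
          by (intro nn_integral_return x0_X K.p_measurable seg_space yN)
        also have "ennreal (exp (d' * m)) * p \<theta> m (seg y) x0 \<le> ennreal (exp (d' * m)) * ennreal (exp (h y))"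
          using elim(1) th by (intro mult_left_mono) auto
        also have "\<dots> = ennreal (exp (H y))"
          using False by (simp add: H_def ennreal_mult[symmetric] exp_add mult.commute)
        finally show ?thesis .
      qed
    qed
  qed
  have "AE y in N. \<forall>t. \<forall>\<theta>\<in>D0 \<inter> ball \<theta>0 e. \<forall>x\<in>space X.
      p \<theta> m (seg ((shift ^^ t) y)) x \<le> ennreal (exp (H ((shift ^^ t) y)))"
    unfolding AE_all_countable by (intro allI AE_T_pow[OF blk])
  then have "AE y in N. \<forall>\<^sub>F n in sequentially. \<forall>\<theta>\<in>D0 \<inter> ball \<theta>0 e. \<forall>x\<in>space X.
    p \<theta> n (seg y) x \<le> ennreal (exp (n * (ell \<theta>0 + \<delta>)))"
    using birkhoff[OF Hi] birkhoff[OF u_int] AE_nice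
  proof eventually_elim
    case (elim y)
    have "(\<lambda>n. orbit_sum H (n - m + 1) y / n) \<longlonglongrightarrow> (\<integral>y. H y \<partial>N)"
      by (rule mean_limit_shifted[OF elim(2), of _ m]) (use m0 in auto)
    then have "(\<lambda>n. orbit_sum H (n - m + 1) y / n / m) \<longlonglongrightarrow> (\<integral>y. H y \<partial>N) / m"
      by (intro tendsto_divide tendsto_const) (use m0 in auto)
    moreover have "(\<integral>y. H y \<partial>N) / m \<le> ell \<theta>0 + 4 * d'" using EH m0 by (simp add: field_simps)
    ultimately have e1: "\<forall>\<^sub>F n in sequentially. orbit_sum H (n - m + 1) y / n / m < ell \<theta>0 + 5 * d'"
      using d' by (intro order_tendstoD(2)) auto
    \<comment> \<open>The first and the last \<open>m\<close> observations contribute nothing to the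
      rate.\<close>
    have "(\<lambda>n. orbit_sum u m y / n + (orbit_sum u n y / n - orbit_sum u (n - m) y / n)) \<longlonglongrightarrow>
        0 + ((\<integral>y. u y \<partial>N) - (\<integral>y. u y \<partial>N))"
      by (intro tendsto_add tendsto_diff lim_const_over_n elim(3) mean_limit_shifted[OF elim(3), of _ m]) auto
    then have e2: "\<forall>\<^sub>F n in sequentially.
        orbit_sum u m y / n + (orbit_sum u n y / n - orbit_sum u (n - m) y / n) < d'"
      using d' by (intro order_tendstoD(2)) auto
    show ?case using e1 e2 eventually_ge_at_top[of m]
    proof eventually_elim
      case (elim n)
      show ?case
      proof (intro ballI)
        fix \<theta> x assume th: "\<theta> \<in> D0 \<inter> ball \<theta>0 e" and x: "x \<in> space X"
        have tT: "\<theta> \<in> \<Theta>" using th D0 by auto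
        interpret K: hmm_kernel X Y "Q \<theta>" "g \<theta>" using tT by (rule kernel)
        have ny: "nice y" by fact
        have n0': "0 < n" using elim m0 by simp
        have "p \<theta> n (seg y) x \<le> ennreal (exp ((\<Sum>t<n - m + 1. H ((shift ^^ t) y)) / m +
            (\<Sum>i<m. u ((shift ^^ i) y)) + (\<Sum>i\<in>{n - m..<n}. u ((shift ^^ i) y))))"
        proof (rule K.p_le_average[OF _ m0 elim(3) _ u_nonneg _ x])
          show "seg y \<in> space Z" using ny by (simp add: nice_def seg_space)
          show "g \<theta> x (seg y i) \<le> exp (u ((shift ^^ i) y))" if "x \<in> space X" for i x
            using ny tT that by (auto simp: nice_def)
          show "p \<theta> m (\<lambda>i. seg y (i + t)) x \<le> ennreal (exp (H ((shift ^^ t) y)))"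
            if "x \<in> space X" for t x
            using \<open>\<forall>t. \<forall>\<theta>\<in>D0 \<inter> ball \<theta>0 e. _ t \<theta>\<close> th that by (simp add: seg_shift_pow)
        qed
        also have "(\<Sum>t<n - m + 1. H ((shift ^^ t) y)) / m +
            (\<Sum>i<m. u ((shift ^^ i) y)) + (\<Sum>i\<in>{n - m..<n}. u ((shift ^^ i) y)) =
            orbit_sum H (n - m + 1) y / m + orbit_sum u m y + (orbit_sum u n y - orbit_sum u (n - m) y)"
        proof -
          have "(\<Sum>i<n. u ((shift ^^ i) y)) = (\<Sum>i<n - m. u ((shift ^^ i) y)) + (\<Sum>i\<in>{n - m..<n}. u ((shift ^^ i) y))"
            by (subst sum.union_disjoint[symmetric]) (auto intro!: sum.cong)
          then show ?thesis by (simp add: orbit_sum_def)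
        qed
        also have "\<dots> \<le> n * (ell \<theta>0 + \<delta>)"
        proof -
          have "orbit_sum H (n - m + 1) y / m = n * (orbit_sum H (n - m + 1) y / n / m)" using n0' by simp
          also have "\<dots> \<le> n * (ell \<theta>0 + 5 * d')" using elim by (intro mult_left_mono) auto
          finally have 1: "orbit_sum H (n - m + 1) y / m \<le> n * (ell \<theta>0 + 5 * d')" .
          have "orbit_sum u m y + (orbit_sum u n y - orbit_sum u (n - m) y) =
              n * (orbit_sum u m y / n + (orbit_sum u n y / n - orbit_sum u (n - m) y / n))"
            using n0' by (simp add: distrib_left right_diff_distrib)
          also have "\<dots> \<le> n * d'" using elim by (intro mult_left_mono) auto
          finally show ?thesis using 1 by (simp add: d'_def algebra_simps)
        qed
        finally show "p \<theta> n (seg y) x \<le> ennreal (exp (n * (ell \<theta>0 + \<delta>)))"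
          by (simp add: ennreal_leI)
      qed
    qed
  qed
  with e show ?thesis by (rule that)
qed

text \<open>Continuity is available for the start \<open>x0\<close> only. At the lengths
  \<open>h n\<close>, multiples of \<open>r\<close>, it extends the bound from the dense set to the
  whole ball; the comparison then covers all starting points, and the crude bound the fewer than
  \<open>r\<close> remaining observations.\<close>

theorem upper_rate:
  assumes th0: "\<theta>0 \<in> \<Theta>" and d: "0 < \<delta>"
  obtains e where "0 < e" "AE \<omega> in P. \<forall>\<^sub>F n in sequentially. \<forall>\<theta>\<in>\<Theta> \<inter> ball \<theta>0 e. \<forall>x\<in>space X.
    p \<theta> n (seg (W \<omega>)) x \<le> ennreal (exp (n * (ell \<theta>0 + \<delta>)))"
proof -
  \<comment> \<open>Four shares: the rate on the dense set, the comparison, the remaining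
    observations, and the change from \<open>h n\<close> to \<open>n\<close>.\<close>
  define d' where "d' = \<delta> / 4"
  have d': "0 < d'" using d by (simp add: d'_def)
  obtain D1 where D1: "countable D1" "D1 \<subseteq> \<Theta>" "\<And>x e. x \<in> \<Theta> \<Longrightarrow> 0 < e \<Longrightarrow> \<exists>d\<in>D1. dist d x < e"
    using compact_countable_dense[OF \<Theta>_compact] by blast
  define D0 where "D0 = insert \<theta>0 D1"
  have D0: "countable D0" "D0 \<subseteq> \<Theta>" "\<theta>0 \<in> D0" using D1 th0 by (auto simp: D0_def)
  obtain e where e: "0 < e" and ce: "AE y in N. \<forall>\<^sub>F n in sequentially. \<forall>\<theta>\<in>D0 \<inter> ball \<theta>0 e. \<forall>x\<in>space X.
    p \<theta> n (seg y) x \<le> ennreal (exp (n * (ell \<theta>0 + d')))"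
    using upper_rate_countable[OF th0 d' D0] by blast
  obtain G where G: "\<And>n::nat. G n \<in> sets N" "AE y in N. \<forall>\<^sub>F n in sequentially. y \<in> G n"
    "AE y in N. \<forall>n\<in>J0. y \<in> G n \<longrightarrow> (\<forall>\<theta>\<in>\<Theta>. \<forall>x\<in>space X.
       p \<theta> n (seg y) x \<le> ennreal (exp (d' * n)) * pm \<theta> (return X x0) n (seg y))"
    using compare_event[OF lower_bounded_return[OF x0_D] d'] unfolding J0_def by auto
  define h where "h n = r * (n div r)" for n
  have h: "n \<le> h n + r" "h n \<le> n" "h n \<le> n + r" for n
  proof -
    have "h n + n mod r = n" unfolding h_def by simp
    moreover have "n mod r < r" using r_pos by simp
    ultimately show "n \<le> h n + r" "h n \<le> n" "h n \<le> n + r" by linarith+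
  qed
  have hlim: "filterlim h at_top sequentially"
  proof -
    have "filterlim (\<lambda>n. n - r) at_top sequentially" by (rule filterlim_minus_const_nat_at_top)
    then show ?thesis by (rule filterlim_at_top_mono) (use h in \<open>auto simp: le_diff_conv\<close>)
  qed
  have hJ: "h n \<in> J0" if "r \<le> n" for n
    using that r_pos div_le_mono[of r n r] by (auto simp: J0_def h_def)
  have "AE \<omega> in P. \<forall>\<^sub>F n in sequentially. \<forall>\<theta>\<in>\<Theta> \<inter> ball \<theta>0 e. \<forall>x\<in>space X.
    p \<theta> n (seg (W \<omega>)) x \<le> ennreal (exp (n * (ell \<theta>0 + \<delta>)))"
    using AE_W[OF ce] AE_W[OF G(2)] AE_W[OF G(3)] AE_W[OF AE_nice] AE_W[OF birkhoff[OF u_int]]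
      likelihood_continuous
  proof eventually_elim
    case (elim \<omega>)
    note cont = elim(6)
    define y where "y = W \<omega>"
    have ny: "nice y" using elim by (simp add: y_def)
    have yN: "y \<in> space N" using ny by (simp add: nice_def)
    have "(\<lambda>n. orbit_sum u n y / n - orbit_sum u (h n) y / n) \<longlonglongrightarrow> (\<integral>y. u y \<partial>N) - (\<integral>y. u y \<partial>N)"
      unfolding y_def by (intro tendsto_diff elim(5) mean_limit_shifted[OF elim(5), of _ r] h)
    then have e1: "\<forall>\<^sub>F n in sequentially. orbit_sum u n y / n - orbit_sum u (h n) y / n < d'"
      using d' by (intro order_tendstoD(2)) auto
    have "\<forall>\<^sub>F n in sequentially. r * \<bar>ell \<theta>0 + 2 * d'\<bar> / n < d'"
      by (rule order_tendstoD(2)[OF lim_const_over_n d'])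
    then show ?case
      using e1 eventually_compose_filterlim[OF elim(1) hlim] eventually_compose_filterlim[OF elim(2) hlim]
        eventually_ge_at_top[of "n0 + r"] eventually_gt_at_top[of 0]
    proof eventually_elim
      case (elim n)
      have nJ: "h n \<in> J0" using elim by (intro hJ) auto
      have hn0: "n0 \<le> h n" using elim h(1)[of n] by linarith
      show ?case
      proof (intro ballI)
        fix \<theta> x assume th: "\<theta> \<in> \<Theta> \<inter> ball \<theta>0 e" and x: "x \<in> space X"
        have tT: "\<theta> \<in> \<Theta>" using th by auto
        interpret K: hmm_kernel X Y "Q \<theta>" "g \<theta>" using tT by (rule kernel)
        define q where "q \<theta> = p \<theta> (h n) (seg y) x0" for \<theta>
        define b where "b = ennreal (exp (h n * (ell \<theta>0 + d')))"
        have "q \<theta> \<le> b"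
        \<comment> \<open>A strict violation would persist near \<open>\<theta>\<close> by
          continuity and hence occur at a parameter of the dense set.\<close>
        proof (rule ccontr)
          assume "\<not> q \<theta> \<le> b"
          then have "b < q \<theta>" by simp
          moreover have "(q \<longlongrightarrow> q \<theta>) (at \<theta> within \<Theta>)"
            using cont hn0 tT unfolding q_def y_def continuous_on_def by blast
          ultimately have "\<forall>\<^sub>F \<theta>' in at \<theta> within \<Theta>. b < q \<theta>'" by (intro order_tendstoD(1))
          then obtain s where s: "0 < s" "\<And>\<theta>'. \<theta>' \<in> \<Theta> \<Longrightarrow> \<theta>' \<noteq> \<theta> \<Longrightarrow> dist \<theta>' \<theta> < s \<Longrightarrow> b < q \<theta>'"
            by (auto simp: eventually_at)
          \<comment> \<open>The second entry keeps the approximating parameter inside the open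
            ball.\<close>
          define s' where "s' = min s (e - dist \<theta>0 \<theta>)"
          have "0 < s'" using s th by (simp add: s'_def)
          then obtain \<theta>' where t': "\<theta>' \<in> D1" "dist \<theta>' \<theta> < s'" using D1(3)[OF tT] by blast
          have "dist \<theta>0 \<theta>' \<le> dist \<theta>0 \<theta> + dist \<theta> \<theta>'" by (rule dist_triangle)
          then have "\<theta>' \<in> D0 \<inter> ball \<theta>0 e" using t' by (simp add: D0_def s'_def dist_commute)
          then have "q \<theta>' \<le> b" using elim x0_X unfolding q_def b_def y_def by blast
          moreover have "b < q \<theta>'"
            using s(2)[of \<theta>'] t' \<open>b < q \<theta>\<close> D1(2) by (cases "\<theta>' = \<theta>") (auto simp: s'_def)
          ultimately show False by simp
        qed
        have step: "p \<theta> (h n) (seg y) x' \<le> ennreal (exp (d' * h n)) * b" if x': "x' \<in> space X" for x'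
        proof -
          have "p \<theta> (h n) (seg y) x' \<le> ennreal (exp (d' * h n)) * pm \<theta> (return X x0) (h n) (seg y)"
            using \<open>\<forall>n\<in>J0. _ n\<close> elim nJ tT x' unfolding y_def by blast
          also have "pm \<theta> (return X x0) (h n) (seg y) = q \<theta>"
            unfolding q_def by (intro nn_integral_return x0_X K.p_measurable seg_space yN)
          also have "ennreal (exp (d' * h n)) * q \<theta> \<le> ennreal (exp (d' * h n)) * b"
            using \<open>q \<theta> \<le> b\<close> by (rule mult_left_mono) simp
          finally show ?thesis .
        qed
        define w where "w = orbit_sum u n y - orbit_sum u (h n) y"
        have "p \<theta> n (seg y) x = Lop (Q \<theta>) (g \<theta>) (h n) (seg y) (p \<theta> (n - h n) (\<lambda>i. seg y (i + h n))) x"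
          by (rule K.p_split[OF h(2)])
        also have "\<dots> \<le> ennreal (exp w) * p \<theta> (h n) (seg y) x"
        proof (rule K.L_le_sup)
          fix x' assume "x' \<in> space X"
          then have "p \<theta> (n - h n) (seg ((shift ^^ h n) y)) x' \<le> ennreal (exp (orbit_sum u (n - h n) ((shift ^^ h n) y)))"
            by (intro p_le_exp_orbit nice_shift ny tT)
          also have "orbit_sum u (n - h n) ((shift ^^ h n) y) = w"
            using orbit_sum_add[of u "h n" "n - h n" y] h(2)[of n] by (simp add: w_def)
          finally show "p \<theta> (n - h n) (\<lambda>i. seg y (i + h n)) x' \<le> ennreal (exp w)"
            by (simp add: seg_shift_pow)
        qed (use x yN seg_space in auto)
        also have "\<dots> \<le> ennreal (exp w) * (ennreal (exp (d' * h n)) * b)"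
          by (intro mult_left_mono step x) simp
        also have "\<dots> = ennreal (exp (w + h n * (ell \<theta>0 + 2 * d')))"
          unfolding b_def by (simp add: ennreal_mult[symmetric] exp_add[symmetric] algebra_simps)
        also have "\<dots> \<le> ennreal (exp (n * (ell \<theta>0 + \<delta>)))"
        proof -
          have n: "0 < n" using elim by simp
          have 1: "w \<le> n * d'"
            using elim n unfolding w_def by (simp add: diff_divide_distrib[symmetric] field_simps)
          have "h n * (ell \<theta>0 + 2 * d') \<le> n * (ell \<theta>0 + 2 * d') + r * \<bar>ell \<theta>0 + 2 * d'\<bar>"
          proof -
            have "\<bar>(real n - real (h n)) * (ell \<theta>0 + 2 * d')\<bar> \<le> r * \<bar>ell \<theta>0 + 2 * d'\<bar>"
              unfolding abs_mult using h(1)[of n] h(2)[of n] by (intro mult_right_mono) auto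
            then show ?thesis by (simp add: left_diff_distrib abs_le_iff)
          qed
          moreover have "r * \<bar>ell \<theta>0 + 2 * d'\<bar> \<le> n * d'"
            using elim(1) n by (simp add: field_simps)
          ultimately have "w + h n * (ell \<theta>0 + 2 * d') \<le> n * d' + (n * (ell \<theta>0 + 2 * d') + n * d')"
            using 1 by linarith
          also have "\<dots> = n * (ell \<theta>0 + \<delta>)" by (simp add: d'_def algebra_simps)
          finally show ?thesis by (simp add: ennreal_leI)
        qed
        finally show "p \<theta> n (seg (W \<omega>)) x \<le> ennreal (exp (n * (ell \<theta>0 + \<delta>)))" by (simp add: y_def)
      qed
    qed
  qed
  with e show ?thesis by (rule that)
qed

end

section \<open>Consistency\<close>

context hmm_consistency
begin

lemma ll_upper_rate:
  assumes th0: "\<theta>0 \<in> \<Theta>" and d: "0 < \<delta>"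
  obtains e where "0 < e" "AE \<omega> in P. \<forall>\<^sub>F n in sequentially. \<forall>\<theta>\<in>\<Theta> \<inter> ball \<theta>0 e.
    ll \<theta> n (W \<omega>) \<le> n * (ell \<theta>0 + \<delta>)"
proof -
  obtain e where e: "0 < e" and up: "AE \<omega> in P. \<forall>\<^sub>F n in sequentially. \<forall>\<theta>\<in>\<Theta> \<inter> ball \<theta>0 e. \<forall>x\<in>space X.
    p \<theta> n (seg (W \<omega>)) x \<le> ennreal (exp (n * (ell \<theta>0 + \<delta>)))"
    using upper_rate[OF th0 d] by blast
  have "AE \<omega> in P. \<forall>\<^sub>F n in sequentially. \<forall>\<theta>\<in>\<Theta> \<inter> ball \<theta>0 e. ll \<theta> n (W \<omega>) \<le> n * (ell \<theta>0 + \<delta>)"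
    using up AE_W[OF AE_low_nice]
  proof eventually_elim
    case (elim \<omega>)
    from elim(1) show ?case
    proof eventually_elim
      case (elim n)
      show ?case
      proof
        fix \<theta> assume th: "\<theta> \<in> \<Theta> \<inter> ball \<theta>0 e"
        interpret K: hmm_kernel X Y "Q \<theta>" "g \<theta>" using th by (intro kernel) auto
        have "pm \<theta> chi n (seg (W \<omega>)) \<le> ennreal (exp (n * (ell \<theta>0 + \<delta>)))"
          using elim th by (intro K.pm_le_const chi) auto
        then show "ll \<theta> n (W \<omega>) \<le> n * (ell \<theta>0 + \<delta>)"
          using ll_bounds(1)[OF \<open>low_nice (W \<omega>)\<close>, of \<theta> n] th by simp
      qed
    qed
  qed
  with e show ?thesis by (rule that)
qed

text \<open>Both rates hold along a common observation sequence, so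
  \<open>ell \<theta> - d \<le> ell \<theta>0 + d\<close> for every \<open>\<theta>\<close> in the
  ball. Semicontinuity thus comes from the likelihoods, not from regularity of \<open>f\<close> in
  the parameter.\<close>

lemma ell_upper_semicontinuous: "upper_semicontinuous_on \<Theta> ell"
  unfolding upper_semicontinuous_on_def
proof (intro ballI allI impI)
  fix \<theta>0 a assume th0: "\<theta>0 \<in> \<Theta>" and a: "ell \<theta>0 < a"
  define d where "d = (a - ell \<theta>0) / 3"
  have d: "0 < d" using a by (simp add: d_def)
  obtain e where e: "0 < e" and up: "AE \<omega> in P. \<forall>\<^sub>F n in sequentially. \<forall>\<theta>\<in>\<Theta> \<inter> ball \<theta>0 e.
    ll \<theta> n (W \<omega>) \<le> n * (ell \<theta>0 + d)"
    using ll_upper_rate[OF th0 d] by blast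
  have "ell \<theta> < a" if th: "\<theta> \<in> \<Theta>" "dist \<theta> \<theta>0 < e" for \<theta>
  proof -
    interpret PP: prob_space P by (rule P_prob)
    \<comment> \<open>The claim is deterministic; it is read off at one \<open>\<omega>\<close> and
      one large \<open>n\<close>, and such an \<open>\<omega>\<close> exists because
      \<open>P\<close> is a probability.\<close>
    have "AE \<omega> in P. ell \<theta> < a"
      using up AE_W[OF lower_rate[OF th(1) d]]
    proof eventually_elim
      case (elim \<omega>)
      have "\<forall>\<^sub>F n in sequentially. ell \<theta> < a"
        using elim(1) elim(2) eventually_gt_at_top[of 0]
      proof eventually_elim
        case (elim n)
        have "ll \<theta> n (W \<omega>) \<le> n * (ell \<theta>0 + d)" using elim(1) th by (auto simp: dist_commute)
        with elim(2) have "n * (ell \<theta> - d) \<le> n * (ell \<theta>0 + d)" by linarith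
        then have "ell \<theta> - d \<le> ell \<theta>0 + d" using elim(3) by simp
        then show ?case using a by (simp add: d_def field_simps)
      qed
      then show ?case by simp
    qed
    then show ?thesis by simp
  qed
  then show "\<forall>\<^sub>F \<theta> in at \<theta>0 within \<Theta>. ell \<theta> < a"
    using e by (auto simp: eventually_at)
qed

text \<open>Wald's argument: the parameters at distance at least \<epsilon> from the maximisers form
  a compact set, covered by finitely many balls on which the upper rate is below the lower rate of
  one maximiser \<open>ts\<close>.\<close>

lemma maximizers_close:
  assumes eps: "0 < \<epsilon>"
  shows "AE \<omega> in P. \<forall>\<^sub>F n in sequentially. \<forall>\<theta>\<in>\<Theta>. (\<forall>\<theta>'\<in>\<Theta>. ll \<theta>' n (W \<omega>) \<le> ll \<theta> n (W \<omega>)) \<longrightarrow>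
    infdist \<theta> {\<theta>\<in>\<Theta>. \<forall>\<theta>'\<in>\<Theta>. ell \<theta>' \<le> ell \<theta>} < \<epsilon>"
proof -
  define M where "M = {\<theta>\<in>\<Theta>. \<forall>\<theta>'\<in>\<Theta>. ell \<theta>' \<le> ell \<theta>}"
  show ?thesis
  proof (cases "M = {}")
    \<comment> \<open>\<open>infdist\<close> to the empty set is 0.\<close>
    case True
    then show ?thesis using eps unfolding M_def[symmetric] by (simp add: infdist_def)
  next
    case False
    then obtain ts where ts: "ts \<in> M" by blast
    then have tsT: "ts \<in> \<Theta>" by (simp add: M_def)
    define S where "S = {\<theta>\<in>\<Theta>. \<epsilon> \<le> infdist \<theta> M}"
    have "S = \<Theta> \<inter> {\<theta>. \<epsilon> \<le> infdist \<theta> M}" by (auto simp: S_def)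
    moreover have "closed {\<theta>. \<epsilon> \<le> infdist \<theta> M}"
      by (intro closed_Collect_le continuous_intros)
    ultimately have Sc: "compact S" using \<Theta>_compact by (simp add: compact_Int_closed)
    \<comment> \<open>A third of the gap leaves the upper rate at \<theta> strictly below the lower
      rate at \<open>ts\<close>.\<close>
    define d where "d \<theta> = (ell ts - ell \<theta>) / 3" for \<theta>
    have dpos: "0 < d \<theta>" if "\<theta> \<in> S" for \<theta>
    proof -
      have "\<theta> \<notin> M" "\<theta> \<in> \<Theta>" using that eps by (auto simp: S_def)
      then obtain \<theta>' where "\<theta>' \<in> \<Theta>" "ell \<theta> < ell \<theta>'" unfolding M_def by (auto simp: not_le)
      moreover have "ell \<theta>' \<le> ell ts" using ts \<open>\<theta>' \<in> \<Theta>\<close> by (simp add: M_def)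
      ultimately show ?thesis by (simp add: d_def)
    qed
    have "\<exists>e. 0 < e \<and> (AE \<omega> in P. \<forall>\<^sub>F n in sequentially. \<forall>\<theta>'\<in>\<Theta> \<inter> ball \<theta> e.
        ll \<theta>' n (W \<omega>) \<le> n * (ell \<theta> + d \<theta>))" if th: "\<theta> \<in> S" for \<theta>
    proof -
      have "\<theta> \<in> \<Theta>" using th by (simp add: S_def)
      from ll_upper_rate[OF this dpos[OF th]] show ?thesis by blast
    qed
    then have "\<forall>\<theta>\<in>S. \<exists>e. 0 < e \<and> (AE \<omega> in P. \<forall>\<^sub>F n in sequentially. \<forall>\<theta>'\<in>\<Theta> \<inter> ball \<theta> e.
        ll \<theta>' n (W \<omega>) \<le> n * (ell \<theta> + d \<theta>))" by blast
    from bchoice[OF this] obtain e where e: "\<And>\<theta>. \<theta> \<in> S \<Longrightarrow> 0 < e \<theta>"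
      "\<And>\<theta>. \<theta> \<in> S \<Longrightarrow> AE \<omega> in P. \<forall>\<^sub>F n in sequentially. \<forall>\<theta>'\<in>\<Theta> \<inter> ball \<theta> (e \<theta>).
        ll \<theta>' n (W \<omega>) \<le> n * (ell \<theta> + d \<theta>)" by blast
    have "S \<subseteq> (\<Union>\<theta>\<in>S. ball \<theta> (e \<theta>))" using e(1) by auto
    then obtain F where F: "F \<subseteq> S" "finite F" "S \<subseteq> (\<Union>\<theta>\<in>F. ball \<theta> (e \<theta>))"
      using compactE_image[OF Sc, of S "\<lambda>\<theta>. ball \<theta> (e \<theta>)"] by auto
    have "AE \<omega> in P. \<forall>\<theta>\<in>F. \<forall>\<^sub>F n in sequentially. \<forall>\<theta>'\<in>\<Theta> \<inter> ball \<theta> (e \<theta>).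
        ll \<theta>' n (W \<omega>) < ll ts n (W \<omega>)"
    proof (rule AE_finite_allI[OF F(2)])
      fix \<theta> assume "\<theta> \<in> F"
      then have th: "\<theta> \<in> S" using F by blast
      show "AE \<omega> in P. \<forall>\<^sub>F n in sequentially. \<forall>\<theta>'\<in>\<Theta> \<inter> ball \<theta> (e \<theta>).
        ll \<theta>' n (W \<omega>) < ll ts n (W \<omega>)"
        using e(2)[OF th] AE_W[OF lower_rate[OF tsT dpos[OF th]]]
      proof eventually_elim
        case (elim \<omega>)
        then show ?case using eventually_gt_at_top[of 0]
        proof eventually_elim
          case (elim n)
          have "ell ts = ell \<theta> + 3 * d \<theta>" by (simp add: d_def field_simps)
          then have "ell \<theta> + d \<theta> < ell ts - d \<theta>" using dpos[OF th] by simp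
          then have less: "n * (ell \<theta> + d \<theta>) < n * (ell ts - d \<theta>)" using elim by simp
          show ?case
          proof
            fix \<theta>' assume "\<theta>' \<in> \<Theta> \<inter> ball \<theta> (e \<theta>)"
            then have "ll \<theta>' n (W \<omega>) \<le> n * (ell \<theta> + d \<theta>)" using elim by blast
            then show "ll \<theta>' n (W \<omega>) < ll ts n (W \<omega>)" using elim less by linarith
          qed
        qed
      qed
    qed
    then show ?thesis
      unfolding M_def[symmetric]
    proof eventually_elim
      case (elim \<omega>)
      then have "\<forall>\<^sub>F n in sequentially. \<forall>\<theta>\<in>F. \<forall>\<theta>'\<in>\<Theta> \<inter> ball \<theta> (e \<theta>). ll \<theta>' n (W \<omega>) < ll ts n (W \<omega>)"
        using F(2) by (simp add: eventually_ball_finite_distrib)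
      then show ?case
      proof eventually_elim
        case (elim n)
        show ?case
        proof (intro ballI impI)
          fix \<theta> assume th: "\<theta> \<in> \<Theta>" "\<forall>\<theta>'\<in>\<Theta>. ll \<theta>' n (W \<omega>) \<le> ll \<theta> n (W \<omega>)"
          show "infdist \<theta> M < \<epsilon>"
          proof (rule ccontr)
            assume "\<not> infdist \<theta> M < \<epsilon>"
            then have "\<theta> \<in> S" using th by (simp add: S_def)
            then obtain \<theta>1 where "\<theta>1 \<in> F" "\<theta> \<in> ball \<theta>1 (e \<theta>1)" using F(3) by blast
            then have "ll \<theta> n (W \<omega>) < ll ts n (W \<omega>)" using elim th by blast
            moreover have "ll ts n (W \<omega>) \<le> ll \<theta> n (W \<omega>)" using th tsT by blast
            ultimately show False by simp
          qed
        qed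
      qed
    qed
  qed
qed

end

section \<open>From the stated assumptions to real majorants and Doeblin bounds\<close>

lemma finite_expectation_majorant:
  assumes "finite_expectation M f"
  obtains h :: "'a \<Rightarrow> real" where "h \<in> borel_measurable M" "\<And>z. 0 \<le> h z" "integrable M h"
    "AE z in M. f z \<le> ennreal (h z)"
proof -
  obtain h where h: "h \<in> borel_measurable M" "\<And>z. z \<in> space M \<Longrightarrow> f z \<le> h z" "(\<integral>\<^sup>+ z. h z \<partial>M) < \<infinity>"
    using assms by (auto simp: finite_expectation_def)
  \<comment> \<open>The given majorant may be infinite on a null set, so its real version dominates
    only almost everywhere.\<close>
  have fin: "AE z in M. h z \<noteq> \<infinity>" using h by (intro nn_integral_PInf_AE) auto
  show ?thesis
  proof (rule that[of "\<lambda>z. enn2real (h z)"])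
    show m: "(\<lambda>z. enn2real (h z)) \<in> borel_measurable M" using h(1) by measurable
    have "(\<integral>\<^sup>+ z. ennreal (enn2real (h z)) \<partial>M) \<le> (\<integral>\<^sup>+ z. h z \<partial>M)"
      by (intro nn_integral_mono) (simp add: ennreal_enn2real_if)
    then show "integrable M (\<lambda>z. enn2real (h z))"
      using h(3) m by (intro integrableI_bounded) (auto intro: le_less_trans)
    show "AE z in M. f z \<le> ennreal (enn2real (h z))"
      using fin AE_space
    proof eventually_elim
      case (elim z)
      then have "ennreal (enn2real (h z)) = h z" by (simp add: less_top)
      then show ?case using h(2)[of z] elim by simp
    qed
  qed simp
qed

lemma ln_pos_le_imp:
  assumes "ln_pos s \<le> ennreal c" "0 \<le> c"
  shows "s \<le> ennreal (exp c)"
proof (cases s)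
  case (real t)
  show ?thesis
  proof (cases "t = 0")
    case False
    then have "ln_pos s = ennreal (max 0 (ln t))"
      using real by (simp add: ln_pos_def eln_def max_def)
    then have "ln t \<le> c" using assms by (simp add: ennreal_le_iff)
    moreover have "0 < t" using real False by simp
    ultimately have "t \<le> exp c" using exp_le_cancel_iff[of "ln t" c] by simp
    then show ?thesis using real by (simp add: ennreal_leI)
  qed (use real in simp)
next
  case top
  then have "ln_pos s = \<infinity>" by (simp add: ln_pos_def eln_def)
  then show ?thesis using assms by (simp add: top_unique)
qed

lemma ln_neg_le_imp:
  assumes "ln_neg s \<le> ennreal c" "0 \<le> c"
  shows "ennreal (exp (- c)) \<le> s"
proof (cases s)
  case (real t)
  show ?thesis
  proof (cases "t = 0")
    case True
    then have "ln_neg s = \<infinity>" using real by (simp add: ln_neg_def eln_def)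
    then show ?thesis using assms by (simp add: top_unique)
  next
    case False
    then have "ln_neg s = ennreal (max 0 (- ln t))"
      using real by (simp add: ln_neg_def eln_def max_def)
    then have "- c \<le> ln t" using assms by (simp add: ennreal_le_iff)
    moreover have "0 < t" using real False by simp
    ultimately have "exp (- c) \<le> t" using exp_le_cancel_iff[of "- c" "ln t"] by simp
    then show ?thesis using real by (simp add: ennreal_leI)
  qed
qed simp

lemma restrict_seg_measurable:
  "(\<lambda>y. restrict (seg y) {..<n}) \<in> (\<Pi>\<^sub>M k\<in>UNIV. Y) \<rightarrow>\<^sub>M (\<Pi>\<^sub>M i\<in>{..<n}. Y)"
  unfolding seg_def by (rule measurable_restrict) simp

text \<open>\<open>1 / q\<close> is the \<eta> of (A1), and \<open>rho\<close> the inverse of a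
  positive lower bound for \<open>em / ep\<close>. Taking \<open>A = C\<close> places
  \<open>L(x, C)\<close> between \<open>em * phi\<close> and \<open>ep * phi\<close>, so it can
  replace \<open>phi\<close> at a cost of at most \<open>rho\<close>.\<close>

lemma A1_doeblin:
  assumes ker: "\<And>\<theta>. \<theta> \<in> \<Theta> \<Longrightarrow> hmm_kernel X Y (Q \<theta>) (g \<theta>)" and r: "1 \<le> r"
    and K: "K \<in> sets (\<Pi>\<^sub>M i\<in>{..<r}. Y)" and q: "2 \<le> (q::real)"
    and D: "local_doeblin_with \<Theta> X Y Q g r C em ep"
    and sup: "\<And>\<theta> z. \<theta> \<in> \<Theta> \<Longrightarrow> z \<in> K \<Longrightarrow>
        (SUP x\<in>space X - C. lik Q g (return X x) \<theta> (r - 1) z)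
          \<le> ennreal (1 / q) * (SUP x\<in>space X. lik Q g (return X x) \<theta> (r - 1) z)"
    and inf: "0 < (INF z\<in>K. ennreal (em z / ep z))"
  shows "\<exists>rho::real. 0 \<le> rho \<and>
      (\<forall>\<theta>\<in>\<Theta>. \<forall>z\<in>space (\<Pi>\<^sub>M i\<in>UNIV. Y). restrict z {..<r} \<in> K \<longrightarrow>
        doeblin_bounds X (Q \<theta>) (g \<theta>) r C q rho z)"
proof -
  obtain i where i: "0 < i" "ennreal i \<le> (INF z\<in>K. ennreal (em z / ep z))"
  proof (cases "INF z\<in>K. ennreal (em z / ep z)")
    case (real t)
    then show ?thesis using inf that[of t] by auto
  next
    \<comment> \<open>The infimum is infinite only when \<open>K\<close> is empty; any positive
      number then serves.\<close>
    case top
    then show ?thesis using that[of 1] by auto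
  qed
  have CX: "C \<in> sets X" using D by (simp add: local_doeblin_with_def)
  have KS: "z \<in> space (\<Pi>\<^sub>M i\<in>{..<r}. Y)" if "z \<in> K" for z
    using that sets.sets_into_space[OF K] by blast
  have pos: "0 < em z" "0 < ep z" if "z \<in> K" for z
    using D KS[OF that] by (auto simp: local_doeblin_with_def)
  have ep_le: "ep z \<le> 1 / i * em z" if "z \<in> K" for z
  proof -
    have "ennreal i \<le> ennreal (em z / ep z)" using i(2) that by (auto simp: le_INF_iff)
    then have "i \<le> em z / ep z" using pos[OF that] by (simp add: ennreal_le_iff)
    then show ?thesis using i pos[OF that] by (simp add: field_simps)
  qed
  obtain lam phi where lp: "\<And>\<theta> z. \<theta> \<in> \<Theta> \<Longrightarrow> z \<in> space (\<Pi>\<^sub>M i\<in>{..<r}. Y) \<Longrightarrow>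
          lam \<theta> z \<in> space (prob_algebra X) \<and>
          emeasure (lam \<theta> z) C = 1 \<and>
          (\<forall>x\<in>space X. 0 < phi \<theta> z x) \<and>
          (\<forall>A\<in>sets X. \<forall>x\<in>C.
             ennreal (em z * phi \<theta> z x) * emeasure (lam \<theta> z) A \<le> Lker Q g \<theta> r z x (A \<inter> C) \<and>
             Lker Q g \<theta> r z x (A \<inter> C) \<le> ennreal (ep z * phi \<theta> z x) * emeasure (lam \<theta> z) A)"
    using D unfolding local_doeblin_with_def by metis
  show ?thesis
    unfolding doeblin_bounds_def
  proof (intro exI[of _ "1 / i"] conjI ballI impI)
    show "0 \<le> 1 / i" using i by simp
  next
    fix \<theta> z x assume th: "\<theta> \<in> \<Theta>" and zK: "restrict z {..<r} \<in> K" and z: "z \<in> space (\<Pi>\<^sub>M i\<in>UNIV. Y)"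
      and x: "x \<in> space X - C"
    interpret H: hmm_kernel X Y "Q \<theta>" "g \<theta>" using th by (rule ker)
    have lik: "lik Q g (return X x') \<theta> (r - 1) (restrict z {..<r}) = plik (Q \<theta>) (g \<theta>) r z x'"
      if x': "x' \<in> space X" for x'
    proof -
      have eq: "lik_from Q g \<theta> (r - 1) (restrict z {..<r}) w = plik (Q \<theta>) (g \<theta>) r z w"
        if "w \<in> space X" for w
      proof -
        have "lik_from Q g \<theta> (r - 1) (restrict z {..<r}) w = plik (Q \<theta>) (g \<theta>) (Suc (r - 1)) (restrict z {..<r}) w"
          by (rule H.lik_from_eq[where Q' = Q and g' = g, OF refl refl that])
        also have "\<dots> = plik (Q \<theta>) (g \<theta>) r z w"
          unfolding plik_def using r by (simp, intro Lop_cong_obs) auto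
        finally show ?thesis .
      qed
      have "lik Q g (return X x') \<theta> (r - 1) (restrict z {..<r}) = (\<integral>\<^sup>+ w. plik (Q \<theta>) (g \<theta>) r z w \<partial>return X x')"
        unfolding lik_def using eq by (intro nn_integral_cong) auto
      also have "\<dots> = plik (Q \<theta>) (g \<theta>) r z x'"
        using x' H.p_measurable[OF z] by (rule nn_integral_return)
      finally show ?thesis .
    qed
    show "\<forall>B. (\<forall>x'\<in>space X. plik (Q \<theta>) (g \<theta>) r z x' \<le> B) \<longrightarrow> ennreal q * plik (Q \<theta>) (g \<theta>) r z x \<le> B"
    proof (intro allI impI)
      fix B assume B: "\<forall>x'\<in>space X. plik (Q \<theta>) (g \<theta>) r z x' \<le> B"
      have "plik (Q \<theta>) (g \<theta>) r z x \<le> (SUP x\<in>space X - C. lik Q g (return X x) \<theta> (r - 1) (restrict z {..<r}))"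
        using x lik[of x] by (intro SUP_upper2[of x]) auto
      also note sup[OF th zK]
      also have "(SUP x\<in>space X. lik Q g (return X x) \<theta> (r - 1) (restrict z {..<r})) \<le> B"
        using B lik by (intro SUP_least) auto
      finally have "plik (Q \<theta>) (g \<theta>) r z x \<le> ennreal (1 / q) * B" by (simp add: mult_left_mono)
      then have "ennreal q * plik (Q \<theta>) (g \<theta>) r z x \<le> ennreal q * (ennreal (1 / q) * B)"
        by (rule mult_left_mono) simp
      also have "\<dots> = B" using q by (simp add: mult.assoc[symmetric] ennreal_mult[symmetric])
      finally show "ennreal q * plik (Q \<theta>) (g \<theta>) r z x \<le> B" .
    qed
  next
    fix \<theta> z assume th: "\<theta> \<in> \<Theta>" and zK: "restrict z {..<r} \<in> K"
    define zr where "zr = restrict z {..<r}"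
    have zr: "zr \<in> K" using zK by (simp add: zr_def)
    have Lk: "Lker Q g \<theta> r zr x A = Lop (Q \<theta>) (g \<theta>) r z (indicator A) x" for x A
      unfolding Lker_eq_Lop zr_def by (rule Lop_cong_obs) simp
    note P = lp[OF th KS[OF zr]]
    show "\<exists>lam\<in>space (prob_algebra X). \<forall>x\<in>C. \<forall>A\<in>sets X.
          Lop (Q \<theta>) (g \<theta>) r z (indicator C) x * emeasure lam A
            \<le> ennreal (1 / i) * Lop (Q \<theta>) (g \<theta>) r z (indicator (A \<inter> C)) x \<and>
          Lop (Q \<theta>) (g \<theta>) r z (indicator (A \<inter> C)) x
            \<le> ennreal (1 / i) * Lop (Q \<theta>) (g \<theta>) r z (indicator C) x * emeasure lam A"
    proof (intro bexI[of _ "lam \<theta> zr"] ballI)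
      fix x A assume x: "x \<in> C" and A: "A \<in> sets X"
      define l where "l = emeasure (lam \<theta> zr) A"
      define LC where "LC = Lop (Q \<theta>) (g \<theta>) r z (indicator C) x"
      define LA where "LA = Lop (Q \<theta>) (g \<theta>) r z (indicator (A \<inter> C)) x"
      have xX: "x \<in> space X" using x CX sets.sets_into_space by blast
      have ph: "0 < phi \<theta> zr x" using P xX by blast
      have e1: "ennreal (em zr * phi \<theta> zr x) * l \<le> LA" "LA \<le> ennreal (ep zr * phi \<theta> zr x) * l"
        using P x A unfolding l_def LA_def Lk by blast+
      have "ennreal (em zr * phi \<theta> zr x) * emeasure (lam \<theta> zr) C \<le> Lker Q g \<theta> r zr x (C \<inter> C)"
        "Lker Q g \<theta> r zr x (C \<inter> C) \<le> ennreal (ep zr * phi \<theta> zr x) * emeasure (lam \<theta> zr) C"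
        using P x CX by blast+
      then have e2: "ennreal (em zr * phi \<theta> zr x) \<le> LC" "LC \<le> ennreal (ep zr * phi \<theta> zr x)"
        using P by (simp_all add: Lk LC_def)
      have "ep zr * phi \<theta> zr x \<le> 1 / i * (em zr * phi \<theta> zr x)"
        using mult_right_mono[OF ep_le[OF zr], of "phi \<theta> zr x"] ph by (simp add: mult.assoc)
      then have e3: "ennreal (ep zr * phi \<theta> zr x) \<le> ennreal (1 / i) * ennreal (em zr * phi \<theta> zr x)"
        using i pos[OF zr] ph by (subst ennreal_mult[symmetric]) (auto intro!: ennreal_leI)
      have "LC * l \<le> ennreal (1 / i) * ennreal (em zr * phi \<theta> zr x) * l"
        using e2(2) e3 by (intro mult_right_mono) auto
      also have "\<dots> \<le> ennreal (1 / i) * LA"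
        using e1(1) by (simp add: mult.assoc mult_left_mono)
      finally have a: "LC * l \<le> ennreal (1 / i) * LA" .
      have "LA \<le> ennreal (1 / i) * ennreal (em zr * phi \<theta> zr x) * l"
        using e1(2) mult_right_mono[OF e3, of l] by simp
      also have "\<dots> \<le> ennreal (1 / i) * LC * l"
        using e2(1) by (intro mult_right_mono mult_left_mono) auto
      finally show "Lop (Q \<theta>) (g \<theta>) r z (indicator C) x * emeasure (lam \<theta> zr) A
            \<le> ennreal (1 / i) * Lop (Q \<theta>) (g \<theta>) r z (indicator (A \<inter> C)) x \<and>
          Lop (Q \<theta>) (g \<theta>) r z (indicator (A \<inter> C)) x
            \<le> ennreal (1 / i) * Lop (Q \<theta>) (g \<theta>) r z (indicator C) x * emeasure (lam \<theta> zr) A"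
        using a unfolding LC_def LA_def l_def by blast
    qed (use P in blast)
  qed
qed

section \<open>The law of the observation process and the verification of the abstract
  setting\<close>

locale hmm_data =
  fixes \<Theta> :: "'t::metric_space set"
    and X :: "'x measure" and Y :: "'y measure"
    and Q :: "'t \<Rightarrow> 'x \<Rightarrow> 'x measure" and g :: "'t \<Rightarrow> 'x \<Rightarrow> 'y \<Rightarrow> real"
    and P :: "'w measure" and Yp :: "int \<Rightarrow> 'w \<Rightarrow> 'y"
    and r :: nat and D :: "'x set"
    and piY :: "'t \<Rightarrow> (int \<Rightarrow> 'y) \<Rightarrow> real"
  assumes compact_\<Theta>: "compact \<Theta>"
    and Q_kernel: "\<And>\<theta>. \<theta> \<in> \<Theta> \<Longrightarrow> Q \<theta> \<in> X \<rightarrow>\<^sub>M prob_algebra X"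
    and g_meas: "\<And>\<theta>. \<theta> \<in> \<Theta> \<Longrightarrow> (\<lambda>(x, y). g \<theta> x y) \<in> borel_measurable (X \<Otimes>\<^sub>M Y)"
    and ergodic: "stationary_ergodic P Y Yp"
    and A1: "A1 \<Theta> X Y Q g P Yp r D"
    and A2: "A2 \<Theta> X Y g P Yp"
    and A3: "A3 \<Theta> X Q g P Yp"
    and init_nonempty: "init_measures \<Theta> X Y Q g P Yp D r \<noteq> {}"
    and density: "limit_density \<Theta> X Y Q g P Yp D r piY"
begin

definition "N = process_law P Y Yp"
definition "W = (\<lambda>\<omega> k. Yp k \<omega>)"
text \<open>The restriction to nonpositive times makes the density a function on the space on which
  the shift acts.\<close>

definition "f = (\<lambda>\<theta> y. piY \<theta> (restrict y {..0}))"

lemma ker: "\<theta> \<in> \<Theta> \<Longrightarrow> hmm_kernel X Y (Q \<theta>) (g \<theta>)"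
  using Q_kernel g_meas by (intro hmm_kernel.intro)

lemma P_prob: "prob_space P" and Yp_measurable: "Yp k \<in> P \<rightarrow>\<^sub>M Y"
  using ergodic by (auto simp: stationary_ergodic_def)

lemma W_measurable_PiM: "W \<in> P \<rightarrow>\<^sub>M (\<Pi>\<^sub>M k\<in>UNIV. Y)"
  unfolding W_def
  by (rule measurable_PiM_single') (use Yp_measurable measurable_space[OF Yp_measurable] in auto)

lemma N_eq: "N = distr P (\<Pi>\<^sub>M k\<in>UNIV. Y) W"
  by (simp add: N_def process_law_def W_def)

lemma N_sets: "sets N = sets (\<Pi>\<^sub>M k\<in>UNIV. Y)"
  by (simp add: N_eq)

lemma N_space: "space N = space (\<Pi>\<^sub>M k\<in>UNIV. Y)"
  by (simp add: N_eq)

lemma N_measurable: "measurable N M = measurable (\<Pi>\<^sub>M k\<in>UNIV. Y) M"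
  "measurable M N = measurable M (\<Pi>\<^sub>M k\<in>UNIV. Y)"
  using measurable_cong_sets[OF N_sets refl] measurable_cong_sets[OF refl N_sets] by auto

lemma W_measurable: "W \<in> P \<rightarrow>\<^sub>M N"
  using W_measurable_PiM by (simp add: N_measurable)

lemma W_law: "distr P N W = N"
  by (subst (2) N_eq) (rule distr_cong, auto simp: N_sets)

lemma N_prob: "prob_space N"
  unfolding N_eq by (rule prob_space.prob_space_distr[OF P_prob W_measurable_PiM])

lemma shift_measurable: "shift \<in> N \<rightarrow>\<^sub>M N"
proof -
  have "shift \<in> (\<Pi>\<^sub>M k\<in>UNIV. Y) \<rightarrow>\<^sub>M (\<Pi>\<^sub>M k\<in>UNIV. Y)"
    unfolding shift_def[abs_def]
    by (intro measurable_PiM_single') (auto simp: space_PiM PiE_def Pi_def)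
  then show ?thesis by (simp add: N_measurable)
qed

lemma N_shift: "distr N N shift = N"
proof -
  have "distr N N shift = distr P N (shift \<circ> W)"
    by (subst W_law[symmetric]) (rule distr_distr[OF shift_measurable W_measurable])
  also have "\<dots> = distr P (\<Pi>\<^sub>M k\<in>UNIV. Y) (\<lambda>\<omega> k. Yp (k + 1) \<omega>)"
    by (rule distr_cong) (auto simp: N_sets shift_def W_def)
  also have "\<dots> = N"
    using ergodic by (simp add: stationary_ergodic_def N_def process_law_def)
  finally show ?thesis .
qed

lemma N_ergodic: "A \<in> sets N \<Longrightarrow> shift -` A \<inter> space N = A \<Longrightarrow> measure N A \<in> {0, 1}"
  using ergodic unfolding stationary_ergodic_def N_def[symmetric] N_sets N_space by blast

lemma block_law_eq: "block_law P Y Yp n = distr N (\<Pi>\<^sub>M i\<in>{..<n}. Y) (\<lambda>y. restrict (seg y) {..<n})"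
proof -
  have "distr N (\<Pi>\<^sub>M i\<in>{..<n}. Y) (\<lambda>y. restrict (seg y) {..<n}) =
      distr P (\<Pi>\<^sub>M i\<in>{..<n}. Y) ((\<lambda>y. restrict (seg y) {..<n}) \<circ> W)"
    unfolding N_eq by (rule distr_distr[OF restrict_seg_measurable W_measurable_PiM])
  then show ?thesis
    unfolding block_law_def by (simp add: block_def[abs_def] seg_def W_def comp_def)
qed

lemma restrict_seg_N: "(\<lambda>y. restrict (seg y) {..<n}) \<in> N \<rightarrow>\<^sub>M (\<Pi>\<^sub>M i\<in>{..<n}. Y)"
  using restrict_seg_measurable by (simp add: N_measurable)

lemma block_majorant:
  assumes "finite_expectation (block_law P Y Yp n) F"
  obtains h :: "(int \<Rightarrow> 'y) \<Rightarrow> real" where "\<And>y. 0 \<le> h y" "integrable N h"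
    "AE y in N. F (restrict (seg y) {..<n}) \<le> ennreal (h y)"
proof -
  obtain h where h: "\<And>z. 0 \<le> h z" "integrable (block_law P Y Yp n) h"
    "AE z in block_law P Y Yp n. F z \<le> ennreal (h z)"
    using finite_expectation_majorant[OF assms] by blast
  show ?thesis
  proof (rule that[of "\<lambda>y. h (restrict (seg y) {..<n})"])
    show "integrable N (\<lambda>y. h (restrict (seg y) {..<n}))"
      using h(2) unfolding block_law_eq by (rule integrable_distr[OF restrict_seg_N])
    show "AE y in N. F (restrict (seg y) {..<n}) \<le> ennreal (h (restrict (seg y) {..<n}))"
      using h(3) unfolding block_law_eq by (rule AE_distrD[OF restrict_seg_N])
  qed (rule h(1))
qed

lemma restrict_Lker: "Lker Q g \<theta> n (restrict (seg y) {..<n}) x A = Lop (Q \<theta>) (g \<theta>) n (seg y) (indicator A) x"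
  unfolding Lker_eq_Lop by (rule Lop_cong_obs) simp

lemma observed: "\<exists>K u v. observed_hmm \<Theta> X Y Q g N r D K u v"
proof -
  have r: "1 \<le> r" using A1 by (simp add: A1_def)
  obtain K where K: "K \<in> sets (\<Pi>\<^sub>M i\<in>{..<r}. Y)" "2 / 3 < measure (block_law P Y Yp r) K"
    "\<And>\<eta>. 0 < \<eta> \<Longrightarrow> \<exists>C em ep.
           local_doeblin_with \<Theta> X Y Q g r C em ep \<and>
           (\<forall>\<theta>\<in>\<Theta>. \<forall>z\<in>K.
              (SUP x\<in>space X - C. lik Q g (return X x) \<theta> (r - 1) z)
                \<le> ennreal \<eta> * (SUP x\<in>space X. lik Q g (return X x) \<theta> (r - 1) z) \<and>
              (SUP x\<in>space X. lik Q g (return X x) \<theta> (r - 1) z) < \<infinity>) \<and>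
           0 < (INF z\<in>K. ennreal (em z / ep z))"
    and D: "D \<in> sets X"
    and vD: "finite_expectation (block_law P Y Yp r)
       (\<lambda>z. ln_neg (INF \<theta>\<in>\<Theta>. INF x\<in>D. Lker Q g \<theta> r z x D))"
    using A1 unfolding A1_def by blast
  have Keq: "{y \<in> space N. restrict (seg y) {..<r} \<in> K} = (\<lambda>y. restrict (seg y) {..<r}) -` K \<inter> space N"
    by auto
  obtain v where v: "\<And>y. 0 \<le> v y" "integrable N v"
    "AE y in N. ln_neg (INF \<theta>\<in>\<Theta>. INF x\<in>D. Lker Q g \<theta> r (restrict (seg y) {..<r}) x D) \<le> ennreal (v y)"
    using block_majorant[OF vD] by blast
  obtain h where h: "\<And>z. 0 \<le> h z" "integrable (distr P Y (Yp 0)) h"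
    "AE y in distr P Y (Yp 0). ln_pos (SUP \<theta>\<in>\<Theta>. SUP x\<in>space X. ennreal (g \<theta> x y)) \<le> ennreal (h y)"
  proof -
    have "finite_expectation (distr P Y (Yp 0)) (\<lambda>y. ln_pos (SUP \<theta>\<in>\<Theta>. SUP x\<in>space X. ennreal (g \<theta> x y)))"
      using A2 by (simp add: A2_def)
    from finite_expectation_majorant[OF this] show ?thesis using that by blast
  qed
  have p0: "(\<lambda>y. y 0) \<in> N \<rightarrow>\<^sub>M Y" by (simp add: N_measurable)
  have N0: "distr P Y (Yp 0) = distr N Y (\<lambda>y. y 0)"
  proof -
    have "distr N Y (\<lambda>y. y 0) = distr P Y ((\<lambda>y. y 0) \<circ> W)"
      by (subst W_law[symmetric]) (rule distr_distr[OF p0 W_measurable])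
    then show ?thesis by (simp add: W_def comp_def)
  qed
  have "observed_hmm \<Theta> X Y Q g N r D K (\<lambda>y. h (y 0)) v"
  proof (intro observed_hmm.intro)
    show "{y \<in> space N. restrict (seg y) {..<r} \<in> K} \<in> sets N"
      unfolding Keq by (rule measurable_sets[OF restrict_seg_N K(1)])
    show "2 / 3 < measure N {y \<in> space N. restrict (seg y) {..<r} \<in> K}"
      using K(2) unfolding Keq block_law_eq measure_distr[OF restrict_seg_N K(1)] .
    show "integrable N (\<lambda>y. h (y 0))"
      using h(2) unfolding N0 by (rule integrable_distr[OF p0])
    have "AE y in N. ln_pos (SUP \<theta>\<in>\<Theta>. SUP x\<in>space X. ennreal (g \<theta> x (y 0))) \<le> ennreal (h (y 0))"
      using h(3) unfolding N0 by (rule AE_distrD[OF p0])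
    then show "AE y in N. \<forall>\<theta>\<in>\<Theta>. \<forall>x\<in>space X. g \<theta> x (y 0) \<le> exp (h (y 0))"
    proof eventually_elim
      case (elim y)
      show ?case
      proof (intro ballI)
        fix \<theta> x assume "\<theta> \<in> \<Theta>" "x \<in> space X"
        then have "ennreal (g \<theta> x (y 0)) \<le> (SUP \<theta>\<in>\<Theta>. SUP x\<in>space X. ennreal (g \<theta> x (y 0)))"
          by (intro SUP_upper2[of \<theta>] SUP_upper)
        also have "\<dots> \<le> ennreal (exp (h (y 0)))" by (rule ln_pos_le_imp[OF elim h(1)])
        finally show "g \<theta> x (y 0) \<le> exp (h (y 0))" by (simp add: ennreal_le_iff)
      qed
    qed
    show "AE y in N. \<forall>\<theta>\<in>\<Theta>. \<forall>x\<in>D. ennreal (exp (- v y)) \<le> Lop (Q \<theta>) (g \<theta>) r (seg y) (indicator D) x"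
      using v(3)
    proof eventually_elim
      case (elim y)
      show ?case
      proof (intro ballI)
        fix \<theta> x assume th: "\<theta> \<in> \<Theta>" "x \<in> D"
        have "ennreal (exp (- v y)) \<le> (INF \<theta>\<in>\<Theta>. INF x\<in>D. Lker Q g \<theta> r (restrict (seg y) {..<r}) x D)"
          by (rule ln_neg_le_imp[OF elim v(1)])
        also have "\<dots> \<le> Lker Q g \<theta> r (restrict (seg y) {..<r}) x D"
          using th by (intro INF_lower2[of \<theta>] INF_lower)
        finally show "ennreal (exp (- v y)) \<le> Lop (Q \<theta>) (g \<theta>) r (seg y) (indicator D) x"
          by (simp add: restrict_Lker)
      qed
    qed
    show "\<exists>C\<in>sets X. \<exists>rho::real. 0 \<le> rho \<and>
      (\<forall>\<theta>\<in>\<Theta>. \<forall>z\<in>space (\<Pi>\<^sub>M i\<in>UNIV. Y). restrict z {..<r} \<in> K \<longrightarrow>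
        doeblin_bounds X (Q \<theta>) (g \<theta>) r C q rho z)"
      if q: "2 \<le> (q::real)" for q
    proof -
      obtain C em ep where C: "local_doeblin_with \<Theta> X Y Q g r C em ep"
        "\<And>\<theta> z. \<theta> \<in> \<Theta> \<Longrightarrow> z \<in> K \<Longrightarrow>
              (SUP x\<in>space X - C. lik Q g (return X x) \<theta> (r - 1) z)
                \<le> ennreal (1 / q) * (SUP x\<in>space X. lik Q g (return X x) \<theta> (r - 1) z)"
        "0 < (INF z\<in>K. ennreal (em z / ep z))"
        using K(3)[of "1 / q"] q by auto
      then have "C \<in> sets X" by (simp add: local_doeblin_with_def)
      then show ?thesis
        using A1_doeblin[OF ker r K(1) q C] by (intro bexI[of _ C])
    qed
  qed (use ker N_prob N_sets N_shift N_ergodic r D v(1,2) h(1) in auto)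
  then show ?thesis by blast
qed

text \<open>The sum of the \<open>r\<close> majorants is a single \<open>c\<close> valid for all
  lengths from 1 to \<open>r\<close>.\<close>

lemma init_lower_bounded:
  assumes obs: "observed_hmm \<Theta> X Y Q g N r D K u v"
    and chi: "chi \<in> init_measures \<Theta> X Y Q g P Yp D r"
  shows "\<exists>c. observed_hmm.lower_bounded \<Theta> X Q g N r v chi c {1..}"
proof -
  interpret O: observed_hmm \<Theta> X Y Q g N r D K u v by (rule obs)
  define F where "F s z = ln_neg (INF \<theta>\<in>\<Theta>. \<integral>\<^sup>+ x. Lker Q g \<theta> s z x D \<partial>chi)" for s z
  have chi_pa: "chi \<in> space (prob_algebra X)" using chi unfolding init_measures_def by blast
  have fe: "finite_expectation (block_law P Y Yp s) (F s)" if "s \<in> {1..r}" for s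
    using chi that unfolding init_measures_def F_def by blast
  have "\<forall>s\<in>{1..r}. \<exists>h :: (int \<Rightarrow> 'y) \<Rightarrow> real. (\<forall>y. 0 \<le> h y) \<and> integrable N h \<and>
      (AE y in N. F s (restrict (seg y) {..<s}) \<le> ennreal (h y))"
  proof
    fix s assume s: "s \<in> {1..r}"
    show "\<exists>h :: (int \<Rightarrow> 'y) \<Rightarrow> real. (\<forall>y. 0 \<le> h y) \<and> integrable N h \<and>
      (AE y in N. F s (restrict (seg y) {..<s}) \<le> ennreal (h y))"
      by (rule block_majorant[OF fe[OF s]]) blast
  qed
  from bchoice[OF this] obtain h :: "nat \<Rightarrow> (int \<Rightarrow> 'y) \<Rightarrow> real"
    where h': "\<forall>s\<in>{1..r}. (\<forall>y. 0 \<le> h s y) \<and> integrable N (h s) \<and>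
      (AE y in N. F s (restrict (seg y) {..<s}) \<le> ennreal (h s y))" ..
  have h: "0 \<le> h s y" "integrable N (h s)" "AE y in N. F s (restrict (seg y) {..<s}) \<le> ennreal (h s y)"
    if "s \<in> {1..r}" for s y
    using h' that by blast+
  define c where "c y = (\<Sum>s\<in>{1..r}. h s y)" for y
  have le: "h s y \<le> c y" if "s \<in> {1..r}" for s y
    unfolding c_def using that h(1) by (intro member_le_sum) auto
  have "O.lower_bounded chi c {1..}"
  proof (rule O.lower_bounded_reaching[OF chi_pa])
    show "integrable N c" unfolding c_def[abs_def] by (intro Bochner_Integration.integrable_sum h(2))
    show "0 \<le> c y" for y unfolding c_def by (intro sum_nonneg h(1))
    have "AE y in N. \<forall>s\<in>{1..r}. F s (restrict (seg y) {..<s}) \<le> ennreal (h s y)"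
      by (rule AE_finite_allI[OF _ h(3)]) simp_all
    then show "AE y in N. \<forall>\<theta>\<in>\<Theta>. \<forall>s\<in>{1..r}.
      ennreal (exp (- c y)) \<le> (\<integral>\<^sup>+ x. Lop (Q \<theta>) (g \<theta>) s (seg y) (indicator D) x \<partial>chi)"
    proof eventually_elim
      case (elim y)
      show ?case
      proof (intro ballI)
        fix \<theta> s assume th: "\<theta> \<in> \<Theta>" and s: "s \<in> {1..r}"
        have "ennreal (exp (- c y)) \<le> ennreal (exp (- h s y))"
          using le[OF s, of y] by (intro ennreal_leI) simp
        also have "\<dots> \<le> (INF \<theta>\<in>\<Theta>. \<integral>\<^sup>+ x. Lker Q g \<theta> s (restrict (seg y) {..<s}) x D \<partial>chi)"
          using bspec[OF elim s] h(1)[OF s, of y] unfolding F_def by (rule ln_neg_le_imp)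
        also have "\<dots> \<le> (\<integral>\<^sup>+ x. Lker Q g \<theta> s (restrict (seg y) {..<s}) x D \<partial>chi)"
          using th by (rule INF_lower)
        finally show "ennreal (exp (- c y)) \<le> (\<integral>\<^sup>+ x. Lop (Q \<theta>) (g \<theta>) s (seg y) (indicator D) x \<partial>chi)"
          unfolding restrict_Lker .
      qed
    qed
  qed
  then show ?thesis by blast
qed

text \<open>Provides the starting point \<open>x0\<close>. For empty \<open>D\<close> the kernels
  into \<open>D\<close> vanish and \<open>ln_neg 0\<close> is infinite, so no integrable majorant
  could exist.\<close>

lemma D_nonempty:
  assumes ne: "\<Theta> \<noteq> {}"
  shows "D \<noteq> {}"
proof
  assume D: "D = {}"
  obtain chi where chi: "chi \<in> init_measures \<Theta> X Y Q g P Yp D r" using init_nonempty by blast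
  have "1 \<le> r" using A1 by (simp add: A1_def)
  then have "1 \<in> {1..r}" by simp
  then have fe: "finite_expectation (block_law P Y Yp 1)
          (\<lambda>z. ln_neg (INF \<theta>\<in>\<Theta>. \<integral>\<^sup>+ x. Lker Q g \<theta> 1 z x D \<partial>chi))"
    using chi unfolding init_measures_def by blast
  obtain h :: "(int \<Rightarrow> 'y) \<Rightarrow> real" where
    h: "AE y in N. ln_neg (INF \<theta>\<in>\<Theta>. \<integral>\<^sup>+ x. Lker Q g \<theta> 1 (restrict (seg y) {..<1}) x D \<partial>chi) \<le> ennreal (h y)"
    "\<And>y. 0 \<le> h y"
    by (rule block_majorant[OF fe]) blast
  interpret NP: prob_space N by (rule N_prob)
  have "AE y in N. False"
    using h(1)
  proof eventually_elim
    case (elim y)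
    have "0 < exp (- h y)" by simp
    moreover have "ennreal (exp (- h y)) \<le> (INF \<theta>\<in>\<Theta>. \<integral>\<^sup>+ x. Lker Q g \<theta> 1 (restrict (seg y) {..<1}) x D \<partial>chi)"
      by (rule ln_neg_le_imp[OF elim h(2)])
    ultimately show False using ne by (simp add: D)
  qed
  then show False by simp
qed

lemma lik_eq:
  assumes "\<theta> \<in> \<Theta>" "space mu = space X"
  shows "lik Q g mu \<theta> n z = (\<integral>\<^sup>+ x. plik (Q \<theta>) (g \<theta>) (Suc n) z x \<partial>mu)"
proof -
  interpret H: hmm_kernel X Y "Q \<theta>" "g \<theta>" by (rule ker[OF assms(1)])
  show ?thesis
    unfolding lik_def using assms(2) H.lik_from_eq[where Q' = Q and g' = g and th = \<theta>]
    by (intro nn_integral_cong) auto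
qed

lemma past_eq: "past Yp \<omega> = restrict (W \<omega>) {..0}"
  by (simp add: past_def W_def)

lemma f_measurable:
  assumes "\<theta> \<in> \<Theta>"
  shows "f \<theta> \<in> borel_measurable N"
proof -
  have "(\<lambda>y. restrict y {..0}) \<in> (\<Pi>\<^sub>M k\<in>UNIV. Y) \<rightarrow>\<^sub>M (\<Pi>\<^sub>M k\<in>{..0::int}. Y)"
    by (rule measurable_restrict_subset) simp
  moreover have "piY \<theta> \<in> borel_measurable (\<Pi>\<^sub>M k\<in>{..0}. Y)"
    using density assms by (simp add: limit_density_def)
  ultimately show ?thesis
    unfolding f_def N_measurable by (rule measurable_compose)
qed

lemma f_pos:
  assumes "\<theta> \<in> \<Theta>"
  shows "AE y in N. 0 < f \<theta> y"
proof -
  have [measurable]: "f \<theta> \<in> borel_measurable N" by (rule f_measurable[OF assms])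
  have "AE \<omega> in P. 0 < f \<theta> (W \<omega>)"
    using density assms by (simp add: limit_density_def f_def past_eq)
  then have "AE y in distr P N W. 0 < f \<theta> y"
    by (subst AE_distr_iff[OF W_measurable]) auto
  then show ?thesis unfolding W_law .
qed

lemma ln_f_measurable: "\<theta> \<in> \<Theta> \<Longrightarrow> (\<lambda>y. ln (f \<theta> y)) \<in> borel_measurable N"
  using f_measurable by measurable

lemma f_int:
  assumes "\<theta> \<in> \<Theta>"
  shows "integrable N (\<lambda>y. ln (f \<theta> y))"
proof -
  have "integrable P (\<lambda>\<omega>. ln (f \<theta> (W \<omega>)))"
    using density assms by (simp add: limit_density_def f_def past_eq)
  then have "integrable (distr P N W) (\<lambda>y. ln (f \<theta> y))"
    by (subst integrable_distr_eq[OF W_measurable ln_f_measurable[OF assms]])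
  then show ?thesis unfolding W_law .
qed

lemma contrast_eq:
  assumes "\<theta> \<in> \<Theta>"
  shows "contrast P Yp piY \<theta> = (\<integral>y. ln (f \<theta> y) \<partial>N)"
  using integral_distr[OF W_measurable ln_f_measurable[OF assms]]
  by (simp add: contrast_def W_law f_def past_eq)

text \<open>To pass from \<open>P\<close> to the image law, the set of convergence has to be
  measurable; it is described through the lower and upper limits of the ratios.\<close>

lemma density_limit:
  assumes th: "\<theta> \<in> \<Theta>" and chi: "chi \<in> init_measures \<Theta> X Y Q g P Yp D r"
  shows "AE y in N. (\<lambda>m. (\<integral>\<^sup>+ x. plik (Q \<theta>) (g \<theta>) (Suc m) (\<lambda>i. y (int i - int m)) x \<partial>chi) /
      (\<integral>\<^sup>+ x. plik (Q \<theta>) (g \<theta>) m (\<lambda>i. y (int i - int m)) x \<partial>chi)) \<longlonglongrightarrow> ennreal (f \<theta> y)"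
proof -
  interpret H: hmm_kernel X Y "Q \<theta>" "g \<theta>" by (rule ker[OF th])
  have chi_pa: "chi \<in> space (prob_algebra X)" using chi by (simp add: init_measures_def)
  define R where "R m y = (\<integral>\<^sup>+ x. plik (Q \<theta>) (g \<theta>) (Suc m) (\<lambda>i. y (int i - int m)) x \<partial>chi) /
      (\<integral>\<^sup>+ x. plik (Q \<theta>) (g \<theta>) m (\<lambda>i. y (int i - int m)) x \<partial>chi)" for m y
  have sm: "(\<lambda>y i. y (int i - int m)) \<in> N \<rightarrow>\<^sub>M (\<Pi>\<^sub>M i\<in>UNIV. Y)" for m
    unfolding N_measurable
    by (rule measurable_PiM_single') (auto simp: space_PiM PiE_def Pi_def)
  have pmm: "(\<lambda>y. \<integral>\<^sup>+ x. plik (Q \<theta>) (g \<theta>) n (\<lambda>i. y (int i - int m)) x \<partial>chi) \<in> borel_measurable N" for n m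
    unfolding plik_def by (rule measurable_compose[OF sm H.p_integral_measurable[OF chi_pa]]) simp
  have [measurable]: "R m \<in> borel_measurable N" for m
    unfolding R_def[abs_def] by (intro borel_measurable_divide_ennreal pmm)
  have fm: "f \<theta> \<in> borel_measurable N" by (rule f_measurable[OF th])
  then have [measurable]: "(\<lambda>y. ennreal (f \<theta> y)) \<in> borel_measurable N" by measurable
  have eq: "(\<lambda>m. R m y) \<longlonglongrightarrow> ennreal (f \<theta> y) \<longleftrightarrow>
      liminf (\<lambda>m. R m y) = ennreal (f \<theta> y) \<and> limsup (\<lambda>m. R m y) = ennreal (f \<theta> y)" for y
    using tendsto_iff_Liminf_eq_Limsup[of sequentially "\<lambda>m. R m y"] by auto
  have meas: "{y \<in> space N. (\<lambda>m. R m y) \<longlonglongrightarrow> ennreal (f \<theta> y)} \<in> sets N"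
  proof -
    have [measurable]: "(\<lambda>y. liminf (\<lambda>m. R m y)) \<in> borel_measurable N"
      "(\<lambda>y. limsup (\<lambda>m. R m y)) \<in> borel_measurable N"
      by measurable
    have "{y \<in> space N. liminf (\<lambda>m. R m y) = ennreal (f \<theta> y)} \<in> sets N"
      "{y \<in> space N. limsup (\<lambda>m. R m y) = ennreal (f \<theta> y)} \<in> sets N"
      by (intro borel_measurable_eq; measurable)+
    moreover have "{y \<in> space N. (\<lambda>m. R m y) \<longlonglongrightarrow> ennreal (f \<theta> y)} =
        {y \<in> space N. liminf (\<lambda>m. R m y) = ennreal (f \<theta> y)} \<inter>
        {y \<in> space N. limsup (\<lambda>m. R m y) = ennreal (f \<theta> y)}"
      unfolding eq by blast
    ultimately show ?thesis by (simp add: sets.Int)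
  qed
  have "AE \<omega> in P. (\<lambda>m. cond_lik Q g chi \<theta> m (\<lambda>k. Yp k \<omega>)) \<longlonglongrightarrow> ennreal (piY \<theta> (past Yp \<omega>))"
    using density th chi by (auto simp: limit_density_def)
  then have "AE \<omega> in P. (\<lambda>m. R m (W \<omega>)) \<longlonglongrightarrow> ennreal (f \<theta> (W \<omega>))"
  proof eventually_elim
    case (elim \<omega>)
    \<comment> \<open>At \<open>m = 0\<close> the truncated difference \<open>m - 1\<close> in
      \<open>cond_lik\<close> gives a different ratio.\<close>
    have "\<forall>\<^sub>F m in sequentially. cond_lik Q g chi \<theta> m (\<lambda>k. Yp k \<omega>) = R m (W \<omega>)"
      using eventually_gt_at_top[of 0]
    proof eventually_elim
      case (elim m)
      then show ?case
        unfolding cond_lik_def R_def using lik_eq[OF th H.prob_algebra_D(3)[OF chi_pa]]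
        by (simp add: W_def)
    qed
    moreover have "piY \<theta> (past Yp \<omega>) = f \<theta> (W \<omega>)" by (simp add: f_def past_def W_def)
    ultimately show ?case using elim by (simp add: filterlim_cong)
  qed
  then have "AE y in distr P N W. (\<lambda>m. R m y) \<longlonglongrightarrow> ennreal (f \<theta> y)"
    using AE_distr_iff[OF W_measurable meas] by simp
  then show ?thesis unfolding W_law R_def .
qed

lemma continuity:
  assumes x: "x \<in> space X"
  shows "\<exists>n0. AE \<omega> in P. \<forall>n\<ge>n0. continuous_on \<Theta> (\<lambda>\<theta>. plik (Q \<theta>) (g \<theta>) n (seg (W \<omega>)) x)"
proof -
  obtain n1 where n1: "\<And>n. n1 \<le> n \<Longrightarrow> AE \<omega> in P.
        continuous_on \<Theta> (\<lambda>\<theta>. lik Q g (return X x) \<theta> n (\<lambda>i. Yp (int i) \<omega>))"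
    using A3 x unfolding A3_def by blast
  \<comment> \<open>The index of \<open>lik\<close> is one less than the number of observations,
    hence \<open>Suc n1\<close>.\<close>
  have "AE \<omega> in P. continuous_on \<Theta> (\<lambda>\<theta>. plik (Q \<theta>) (g \<theta>) n (seg (W \<omega>)) x)" if n: "Suc n1 \<le> n" for n
  proof -
    obtain m where m: "n = Suc m" "n1 \<le> m" using n by (cases n) auto
    show ?thesis
      using n1[OF m(2)] AE_space
    proof eventually_elim
      case (elim \<omega>)
      have "W \<omega> \<in> space N" by (rule measurable_space[OF W_measurable elim(2)])
      then have s: "seg (W \<omega>) \<in> space (\<Pi>\<^sub>M i\<in>UNIV. Y)"
        by (auto simp: N_space space_PiM PiE_def Pi_def seg_def)
      have "lik Q g (return X x) \<theta> m (\<lambda>i. Yp (int i) \<omega>) = plik (Q \<theta>) (g \<theta>) n (seg (W \<omega>)) x"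
        if th: "\<theta> \<in> \<Theta>" for \<theta>
      proof -
        interpret H: hmm_kernel X Y "Q \<theta>" "g \<theta>" by (rule ker[OF th])
        have "lik Q g (return X x) \<theta> m (\<lambda>i. Yp (int i) \<omega>) =
            (\<integral>\<^sup>+ x'. plik (Q \<theta>) (g \<theta>) n (seg (W \<omega>)) x' \<partial>return X x)"
          using lik_eq[OF th, of "return X x"] by (simp add: m seg_def W_def)
        also have "\<dots> = plik (Q \<theta>) (g \<theta>) n (seg (W \<omega>)) x"
          by (rule nn_integral_return[OF x H.p_measurable[OF s]])
        finally show ?thesis .
      qed
      then show ?case using elim(1) by (simp cong: continuous_on_cong)
    qed
  qed
  then have "AE \<omega> in P. \<forall>n. Suc n1 \<le> n \<longrightarrow> continuous_on \<Theta> (\<lambda>\<theta>. plik (Q \<theta>) (g \<theta>) n (seg (W \<omega>)) x)"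
    unfolding AE_all_countable by (auto intro: AE_impI)
  then show ?thesis by blast
qed

lemma consistency_instance:
  assumes ne: "\<Theta> \<noteq> {}" and chi: "chi \<in> init_measures \<Theta> X Y Q g P Yp D r"
  shows "\<exists>K u v c x0 n0. hmm_consistency \<Theta> X Y Q g N r D K u v chi c f P W x0 n0"
proof -
  obtain K u v where obs: "observed_hmm \<Theta> X Y Q g N r D K u v" using observed by blast
  obtain c where c: "observed_hmm.lower_bounded \<Theta> X Q g N r v chi c {1..}"
    using init_lower_bounded[OF obs chi] by blast
  obtain x0 where x0: "x0 \<in> D" using D_nonempty[OF ne] by blast
  have "D \<in> sets X" using A1 unfolding A1_def by blast
  then have "x0 \<in> space X" using x0 sets.sets_into_space by blast
  then obtain n0 where n0: "AE \<omega> in P. \<forall>n\<ge>n0. continuous_on \<Theta> (\<lambda>\<theta>. plik (Q \<theta>) (g \<theta>) n (seg (W \<omega>)) x0)"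
    using continuity by blast
  have "hmm_consistency \<Theta> X Y Q g N r D K u v chi c f P W x0 n0"
    by (intro hmm_consistency.intro hmm_contrast.intro hmm_contrast_axioms.intro
        hmm_consistency_axioms.intro obs c f_measurable f_pos f_int density_limit chi P_prob
        W_measurable W_law compact_\<Theta> x0 n0)
  then show ?thesis by blast
qed

lemma contrast_upper_semicontinuous:
  assumes ne: "\<Theta> \<noteq> {}"
  shows "upper_semicontinuous_on \<Theta> (contrast P Yp piY)"
proof -
  obtain chi where "chi \<in> init_measures \<Theta> X Y Q g P Yp D r" using init_nonempty by blast
  then obtain K u v c x0 n0 where "hmm_consistency \<Theta> X Y Q g N r D K u v chi c f P W x0 n0"
    using consistency_instance[OF ne] by blast
  then interpret C: hmm_consistency \<Theta> X Y Q g N r D K u v chi c f P W x0 n0 .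
  have eq: "contrast P Yp piY \<theta> = C.ell \<theta>" if "\<theta> \<in> \<Theta>" for \<theta>
    unfolding C.ell_def by (rule contrast_eq[OF that])
  show ?thesis
    unfolding upper_semicontinuous_on_def
  proof (intro ballI allI impI)
    fix \<theta> a assume th: "\<theta> \<in> \<Theta>" "contrast P Yp piY \<theta> < a"
    then have "\<forall>\<^sub>F \<theta>' in at \<theta> within \<Theta>. C.ell \<theta>' < a"
      using C.ell_upper_semicontinuous unfolding upper_semicontinuous_on_def by (auto simp: eq)
    then show "\<forall>\<^sub>F \<theta>' in at \<theta> within \<Theta>. contrast P Yp piY \<theta>' < a"
      unfolding eventually_at_filter by eventually_elim (auto simp: eq)
  qed
qed

lemma mle_consistent:
  assumes chi: "chi \<in> init_measures \<Theta> X Y Q g P Yp D r"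
    and mle: "is_mle \<Theta> Q g P Yp chi th"
  shows "AE \<omega> in P. (\<lambda>n. infdist (th n \<omega>) (Theta_star \<Theta> P Yp piY)) \<longlonglongrightarrow> 0"
proof (cases "\<Theta> = {}")
  case True
  \<comment> \<open>\<open>infdist\<close> to the empty set is 0.\<close>
  have "Theta_star \<Theta> P Yp piY = {}" by (auto simp: Theta_star_def is_arg_max_def True)
  then show ?thesis by (simp add: infdist_def)
next
  case False
  obtain K u v c x0 n0 where "hmm_consistency \<Theta> X Y Q g N r D K u v chi c f P W x0 n0"
    using consistency_instance[OF False chi] by blast
  then interpret C: hmm_consistency \<Theta> X Y Q g N r D K u v chi c f P W x0 n0 .
  have chi_X: "space chi = space X"
    using chi by (auto simp: init_measures_def space_prob_algebra dest: sets_eq_imp_space_eq)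
  have eq: "contrast P Yp piY \<theta> = C.ell \<theta>" if "\<theta> \<in> \<Theta>" for \<theta>
    unfolding C.ell_def by (rule contrast_eq[OF that])
  have star: "Theta_star \<Theta> P Yp piY = {\<theta>\<in>\<Theta>. \<forall>\<theta>'\<in>\<Theta>. C.ell \<theta>' \<le> C.ell \<theta>}"
  proof -
    have "is_arg_max (contrast P Yp piY) (\<lambda>\<theta>. \<theta> \<in> \<Theta>) \<theta> \<longleftrightarrow> \<theta> \<in> \<Theta> \<and> (\<forall>\<theta>'\<in>\<Theta>. C.ell \<theta>' \<le> C.ell \<theta>)" for \<theta>
      unfolding is_arg_max_linorder using eq by auto
    then show ?thesis unfolding Theta_star_def by blast
  qed
  have "AE \<omega> in P. \<forall>k::nat. \<forall>\<^sub>F n in sequentially. \<forall>\<theta>\<in>\<Theta>.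
      (\<forall>\<theta>'\<in>\<Theta>. C.ll \<theta>' n (W \<omega>) \<le> C.ll \<theta> n (W \<omega>)) \<longrightarrow>
      infdist \<theta> (Theta_star \<Theta> P Yp piY) < 1 / Suc k"
    unfolding AE_all_countable star by (intro allI C.maximizers_close) simp
  then show ?thesis
    using mle[unfolded is_mle_def] C.AE_W[OF C.AE_low_nice]
  proof eventually_elim
    case (elim \<omega>)
    have ev: "\<forall>\<^sub>F n in sequentially. th n \<omega> \<in> \<Theta> \<and> (\<forall>\<theta>'\<in>\<Theta>. C.ll \<theta>' n (W \<omega>) \<le> C.ll (th n \<omega>) n (W \<omega>))"
      using elim(2) eventually_gt_at_top[of 0]
    proof eventually_elim
      case (elim n)
      \<comment> \<open>The likelihood is positive and finite, so \<open>eln\<close> agrees with the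
        real logarithm; \<open>n > 0\<close> makes \<open>n - 1\<close> the last index of
        \<open>n\<close> observations.\<close>
      have lik: "eln (lik Q g chi \<theta> (n - 1) (\<lambda>i. Yp (int i) \<omega>)) = ereal (C.ll \<theta> n (W \<omega>))"
        if th: "\<theta> \<in> \<Theta>" for \<theta>
      proof -
        have "lik Q g chi \<theta> (n - 1) (\<lambda>i. Yp (int i) \<omega>) = ennreal (exp (C.ll \<theta> n (W \<omega>)))"
          using lik_eq[OF th chi_X, of "n - 1" "seg (W \<omega>)"] C.ll_bounds(1)[OF \<open>C.low_nice (W \<omega>)\<close> th, of n] elim(2)
          by (simp add: seg_def W_def)
        then show ?thesis by (simp add: eln_def)
      qed
      have "th n \<omega> \<in> \<Theta>" using elim(1) by (simp add: is_arg_max_def)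
      moreover have "C.ll \<theta>' n (W \<omega>) \<le> C.ll (th n \<omega>) n (W \<omega>)" if "\<theta>' \<in> \<Theta>" for \<theta>'
      proof -
        have "eln (lik Q g chi \<theta>' (n - 1) (\<lambda>i. Yp (int i) \<omega>)) \<le> eln (lik Q g chi (th n \<omega>) (n - 1) (\<lambda>i. Yp (int i) \<omega>))"
          using elim(1) that unfolding is_arg_max_linorder by blast
        then show ?thesis unfolding lik[OF that] lik[OF \<open>th n \<omega> \<in> \<Theta>\<close>] by simp
      qed
      ultimately show ?case by blast
    qed
    show ?case
    proof (rule tendstoI)
      fix e :: real assume "0 < e"
      then obtain k where k: "1 / Suc k < e" using nat_approx_posE by blast
      have "\<forall>\<^sub>F n in sequentially. \<forall>\<theta>\<in>\<Theta>. (\<forall>\<theta>'\<in>\<Theta>. C.ll \<theta>' n (W \<omega>) \<le> C.ll \<theta> n (W \<omega>)) \<longrightarrow>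
          infdist \<theta> (Theta_star \<Theta> P Yp piY) < 1 / Suc k"
        using elim(1) by blast
      then show "\<forall>\<^sub>F n in sequentially. dist (infdist (th n \<omega>) (Theta_star \<Theta> P Yp piY)) 0 < e"
        using ev
      proof eventually_elim
        case (elim n)
        then have "infdist (th n \<omega>) (Theta_star \<Theta> P Yp piY) < 1 / Suc k" by blast
        then show ?case using k by (simp add: dist_real_def infdist_nonneg)
      qed
    qed
  qed
qed

end

theorem theorem2:
  fixes \<Theta> :: "'t::metric_space set"
    and X :: "'x measure" and Y \<mu> :: "'y measure"
    and Q :: "'t \<Rightarrow> 'x \<Rightarrow> 'x measure" and g :: "'t \<Rightarrow> 'x \<Rightarrow> 'y \<Rightarrow> real"
    and P :: "'w measure" and Yp :: "int \<Rightarrow> 'w \<Rightarrow> 'y"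
    and r :: nat and D :: "'x set"
    and piY :: "'t \<Rightarrow> (int \<Rightarrow> 'y) \<Rightarrow> real"
  assumes "compact \<Theta>"
    and "standard_borel Y"
    and "\<And>\<theta>. \<theta> \<in> \<Theta> \<Longrightarrow> Q \<theta> \<in> X \<rightarrow>\<^sub>M prob_algebra X"
    and "\<And>\<theta>. \<theta> \<in> \<Theta> \<Longrightarrow> (\<lambda>(x, y). g \<theta> x y) \<in> borel_measurable (X \<Otimes>\<^sub>M Y)"
    and "\<And>\<theta> x y. \<theta> \<in> \<Theta> \<Longrightarrow> x \<in> space X \<Longrightarrow> y \<in> space Y \<Longrightarrow> 0 \<le> g \<theta> x y"
    and "sets \<mu> = sets Y"
    and "\<And>\<theta> x. \<theta> \<in> \<Theta> \<Longrightarrow> x \<in> space X \<Longrightarrow> (\<integral>\<^sup>+ y. ennreal (g \<theta> x y) \<partial>\<mu>) = 1"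
    and "stationary_ergodic P Y Yp"
    and "A1 \<Theta> X Y Q g P Yp r D"
    and "A2 \<Theta> X Y g P Yp"
    and "A3 \<Theta> X Q g P Yp"
    and "init_measures \<Theta> X Y Q g P Yp D r \<noteq> {}"
    and "limit_density \<Theta> X Y Q g P Yp D r piY"
  shows "upper_semicontinuous_on \<Theta> (contrast P Yp piY) \<and>
    (\<forall>chi\<in>init_measures \<Theta> X Y Q g P Yp D r. \<forall>\<theta>hat. is_mle \<Theta> Q g P Yp chi \<theta>hat \<longrightarrow>
       (AE \<omega> in P. (\<lambda>n. infdist (\<theta>hat n \<omega>) (Theta_star \<Theta> P Yp piY)) \<longlonglongrightarrow> 0))"
proof -
  interpret hmm_data \<Theta> X Y Q g P Yp r D piY
    by (rule hmm_data.intro) (use assms in blast)+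
  have "upper_semicontinuous_on \<Theta> (contrast P Yp piY)"
    using contrast_upper_semicontinuous by (cases "\<Theta> = {}") (auto simp: upper_semicontinuous_on_def)
  then show ?thesis using mle_consistent by blast
qed

end
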